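(* Consider the non-preemptive variant, an instance $I$ and a makespan $T\ge T_{\min}$. With $m_i$ and $x_i$ as in the context, let \[L_{\mathrm{nonp}}=P(J)+\sum_{i=1}^c m_is_i+\sum_{i:\,x_i>0}s_i\] and $m'=\sum_{i=1}^c m_i$. Then: (i) if $mT<L_{\mathrm{nonp}}$ or $m<m'$, then $T<\mathrm{OPT}_{\mathrm{nonp}}(I)$; (ii) otherwise a feasible non-preemptive schedule with makespan at most $\tfrac32T$ can be computed in time $\mathcal{O}(n)$.
   Context: An instance consists of $m$ identical machines, $n$ jobs $J$, a partition $J=C_1\,\dot\cup\dots\dot\cup\,C_c$ into nonempty classes, processing times $t_j\in\mathbb{N}$, setup times $s_i\in\mathbb{N}$. On each machine one item at a time; a setup of class $i$ (length $s_i$) is required whenever a machine starts processing jobs of class $i$ or switches to class $i$ from a different class; setups are not preempted; in the non-preemptive variant each job runs uninterrupted on one machine. $\mathrm{OPT}_{\mathrm{nonp}}(I)$ is the minimum makespan. $P(K)=\sum_{j\in K}t_j$, $N=\sum_is_i+P(J)$, $t^{(i)}_{\max}=\max_{j\in C_i}t_j$, $T_{\min}=\max\{N/m,\max_i(s_i+t^{(i)}_{\max})\}$. Expensive classes $I_{\exp}=\{i:s_i>T/2\}$, cheap classes $I_{\mathrm{chp}}=\{i:s_i\le T/2\}$. $J_+=\{j:t_j>T/2\}$, $J_-=\{j:t_j\le T/2\}$, $K=\bigcup_{i\in I_{\mathrm{chp}}}\{j\in C_i\cap J_-:s_i+t_j>T/2\}$. For $i\in[c]$: $m_i=\lceil P(C_i)/(T-s_i)\rceil$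 if $i\in I_{\exp}$ and $m_i=|C_i\cap J_+|+\lceil P(C_i\cap K)/(T-s_i)\rceil$ if $i\in I_{\mathrm{chp}}$; $x_i=P(C_i)-m_i(T-s_i)$. *)

theory Defs imports Complex_Main begin

section \<open>Scheduling with setup times\<close>

text \<open>Jobs are \<open>0, ..., njobs - 1\<close>, classes are \<open>0, ..., nclasses - 1\<close>, machines are
  \<open>0, ..., machines - 1\<close>. The partition of the jobs is given by the function \<open>cls\<close>
  that sends a job to its class.\<close>

record inst =
  machines :: nat
  njobs :: nat
  nclasses :: nat
  ptime :: "nat \<Rightarrow> nat"
  stime :: "nat \<Rightarrow> nat"
  cls :: "nat \<Rightarrow> nat"

text \<open>Processing and setup times are positive integers. (With jobs of length 0 one could have
  \<open>T = s\<^sub>i\<close>, and the quotients \<open>P(C\<^sub>i) / (T - s\<^sub>i)\<close> below would be meaningless.)\<close>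

definition valid_inst :: "inst \<Rightarrow> bool" where
  "valid_inst I \<longleftrightarrow> machines I \<ge> 1 \<and> njobs I \<ge> 1
     \<and> (\<forall>j<njobs I. cls I j < nclasses I \<and> ptime I j \<ge> 1)
     \<and> (\<forall>i<nclasses I. stime I i \<ge> 1 \<and> (\<exists>j<njobs I. cls I j = i))"

definition class_jobs :: "inst \<Rightarrow> nat \<Rightarrow> nat set" where
  "class_jobs I i = {j. j < njobs I \<and> cls I j = i}"

definition P_sum :: "inst \<Rightarrow> nat set \<Rightarrow> nat" where
  "P_sum I K = (\<Sum>j\<in>K. ptime I j)"

definition total_load :: "inst \<Rightarrow> nat" where
  "total_load I = (\<Sum>i<nclasses I. stime I i) + P_sum I {..<njobs I}"

definition tmax :: "inst \<Rightarrow> nat \<Rightarrow> nat" where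
  "tmax I i = Max (ptime I ` class_jobs I i)"

definition T_min :: "inst \<Rightarrow> real" where
  "T_min I = max (real (total_load I) / real (machines I))
                 (real (Max ((\<lambda>i. stime I i + tmax I i) ` {..<nclasses I})))"

subsection \<open>Non-preemptive schedules\<close>

text \<open>A job is placed at exactly one machine and start time and then runs without interruption.
  A setup is a triple of machine, class and start time.\<close>

record schedule =
  job_machine :: "nat \<Rightarrow> nat"
  job_start :: "nat \<Rightarrow> real"
  setups :: "(nat \<times> nat \<times> real) list"

text \<open>The items to be executed: \<open>Job j\<close> is job \<open>j\<close>, and \<open>Setup k\<close> is the \<open>k\<close>-th entry of
  \<open>setups\<close>. Setups are addressed by position so that a repeated entry counts as two
  (overlapping) setups.\<close>

datatype item = Job nat | Setup nat

definition items :: "inst \<Rightarrow> schedule \<Rightarrow> item set" where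
  "items I S = Job ` {..<njobs I} \<union> Setup ` {..<length (setups S)}"

fun item_machine :: "schedule \<Rightarrow> item \<Rightarrow> nat" where
  "item_machine S (Job j) = job_machine S j"
| "item_machine S (Setup k) = fst (setups S ! k)"

fun item_class :: "inst \<Rightarrow> schedule \<Rightarrow> item \<Rightarrow> nat" where
  "item_class I S (Job j) = cls I j"
| "item_class I S (Setup k) = fst (snd (setups S ! k))"

fun item_start :: "schedule \<Rightarrow> item \<Rightarrow> real" where
  "item_start S (Job j) = job_start S j"
| "item_start S (Setup k) = snd (snd (setups S ! k))"

fun item_length :: "inst \<Rightarrow> schedule \<Rightarrow> item \<Rightarrow> nat" where
  "item_length I S (Job j) = ptime I j"
| "item_length I S (Setup k) = stime I (item_class I S (Setup k))"

definition item_end :: "inst \<Rightarrow> schedule \<Rightarrow> item \<Rightarrow> real" where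
  "item_end I S a = item_start S a + real (item_length I S a)"

text \<open>The last conjunct is the setup requirement: before a job of class \<open>i\<close> starts, its machine
  has completed a setup of class \<open>i\<close> and has not turned to another class since. Idle time is
  allowed anywhere.\<close>

definition feasible :: "inst \<Rightarrow> schedule \<Rightarrow> bool" where
  "feasible I S \<longleftrightarrow>
     (\<forall>a\<in>items I S. item_machine S a < machines I \<and> item_class I S a < nclasses I
        \<and> item_start S a \<ge> 0)
   \<and> (\<forall>a\<in>items I S. \<forall>b\<in>items I S. a \<noteq> b \<and> item_machine S a = item_machine S b \<longrightarrow>
        item_end I S a \<le> item_start S b \<or> item_end I S b \<le> item_start S a)
   \<and> (\<forall>j<njobs I. \<exists>k<length (setups S).
        item_machine S (Setup k) = job_machine S j
      \<and> item_class I S (Setup k) = cls I j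
      \<and> item_end I S (Setup k) \<le> job_start S j
      \<and> (\<forall>b\<in>items I S. item_machine S b = job_machine S j
            \<and> item_start S (Setup k) < item_start S b \<and> item_start S b < job_start S j
            \<longrightarrow> item_class I S b = cls I j))"

definition makespan :: "inst \<Rightarrow> schedule \<Rightarrow> real" where
  "makespan I S = Max (item_end I S ` items I S)"

definition OPT_nonp :: "inst \<Rightarrow> real" where
  "OPT_nonp I = (LEAST M. \<exists>S. feasible I S \<and> makespan I S = M)"

subsection \<open>The lower bounds\<close>

definition I_exp :: "inst \<Rightarrow> real \<Rightarrow> nat set" where
  "I_exp I T = {i. i < nclasses I \<and> real (stime I i) > T / 2}"

definition I_chp :: "inst \<Rightarrow> real \<Rightarrow> nat set" where
  "I_chp I T = {i. i < nclasses I \<and> real (stime I i) \<le> T / 2}"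

definition J_plus :: "inst \<Rightarrow> real \<Rightarrow> nat set" where
  "J_plus I T = {j. j < njobs I \<and> real (ptime I j) > T / 2}"

definition J_minus :: "inst \<Rightarrow> real \<Rightarrow> nat set" where
  "J_minus I T = {j. j < njobs I \<and> real (ptime I j) \<le> T / 2}"

definition K_jobs :: "inst \<Rightarrow> real \<Rightarrow> nat set" where
  "K_jobs I T = (\<Union>i\<in>I_chp I T.
     {j \<in> class_jobs I i \<inter> J_minus I T. real (stime I i) + real (ptime I j) > T / 2})"

definition m_cls :: "inst \<Rightarrow> real \<Rightarrow> nat \<Rightarrow> int" where
  "m_cls I T i =
     (if i \<in> I_exp I T then \<lceil>real (P_sum I (class_jobs I i)) / (T - real (stime I i))\<rceil>
      else int (card (class_jobs I i \<inter> J_plus I T))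
         + \<lceil>real (P_sum I (class_jobs I i \<inter> K_jobs I T)) / (T - real (stime I i))\<rceil>)"

definition x_cls :: "inst \<Rightarrow> real \<Rightarrow> nat \<Rightarrow> real" where
  "x_cls I T i = real (P_sum I (class_jobs I i)) - of_int (m_cls I T i) * (T - real (stime I i))"

definition L_nonp :: "inst \<Rightarrow> real \<Rightarrow> real" where
  "L_nonp I T = real (P_sum I {..<njobs I})
     + (\<Sum>i<nclasses I. of_int (m_cls I T i) * real (stime I i))
     + (\<Sum>i\<in>{i. i < nclasses I \<and> x_cls I T i > 0}. real (stime I i))"

definition m_total :: "inst \<Rightarrow> real \<Rightarrow> int" where
  "m_total I T = (\<Sum>i<nclasses I. m_cls I T i)"

section \<open>Model of computation\<close>

text \<open>Running times are measured on a unit-cost random access machine, programmed in a small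
  imperative language. The makespan \<open>T\<close> may be any real number, so, as usual for real RAMs, there
  are two separate kinds of storage: index variables and arrays of natural numbers, which alone can
  be used as addresses, and value variables and arrays of real numbers. There is no
  conversion between the two kinds, no multiplication and no rounding: with
  these, unit cost would be unrealistically powerful.\<close>

datatype iexp = IConst nat | IVar nat | IArr nat iexp | IAdd iexp iexp | ISub iexp iexp

datatype vexp = VConst nat | VVar nat | VArr nat iexp | VAdd vexp vexp | VSub vexp vexp | VHalf vexp

datatype bexp = ILess iexp iexp | VLess vexp vexp | BNot bexp | BAnd bexp bexp

datatype com =
    Skip
  | IAssign nat iexp
  | IStore nat iexp iexp
  | VAssign nat vexp
  | VStore nat iexp vexp
  | Seq com com
  | Cond bexp com com
  | While bexp com

text \<open>Variables and arrays are named by natural numbers; a fixed program mentions only finitely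
  many of them.\<close>

record state =
  ivar :: "nat \<Rightarrow> nat"
  iarr :: "nat \<Rightarrow> nat \<Rightarrow> nat"
  vvar :: "nat \<Rightarrow> real"
  varr :: "nat \<Rightarrow> nat \<Rightarrow> real"

fun ival :: "iexp \<Rightarrow> state \<Rightarrow> nat" where
  "ival (IConst n) \<sigma> = n"
| "ival (IVar x) \<sigma> = ivar \<sigma> x"
| "ival (IArr a e) \<sigma> = iarr \<sigma> a (ival e \<sigma>)"
| "ival (IAdd e f) \<sigma> = ival e \<sigma> + ival f \<sigma>"
| "ival (ISub e f) \<sigma> = ival e \<sigma> - ival f \<sigma>"

fun vval :: "vexp \<Rightarrow> state \<Rightarrow> real" where
  "vval (VConst n) \<sigma> = real n"
| "vval (VVar x) \<sigma> = vvar \<sigma> x"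
| "vval (VArr a e) \<sigma> = varr \<sigma> a (ival e \<sigma>)"
| "vval (VAdd e f) \<sigma> = vval e \<sigma> + vval f \<sigma>"
| "vval (VSub e f) \<sigma> = vval e \<sigma> - vval f \<sigma>"
| "vval (VHalf e) \<sigma> = vval e \<sigma> / 2"

fun bval :: "bexp \<Rightarrow> state \<Rightarrow> bool" where
  "bval (ILess e f) \<sigma> \<longleftrightarrow> ival e \<sigma> < ival f \<sigma>"
| "bval (VLess e f) \<sigma> \<longleftrightarrow> vval e \<sigma> < vval f \<sigma>"
| "bval (BNot b) \<sigma> \<longleftrightarrow> \<not> bval b \<sigma>"
| "bval (BAnd b d) \<sigma> \<longleftrightarrow> bval b \<sigma> \<and> bval d \<sigma>"

text \<open>\<open>exec p \<sigma> k \<tau>\<close>: started in \<open>\<sigma>\<close>, program \<open>p\<close> terminates in \<open>\<tau>\<close> after \<open>k\<close> steps. A step is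
  an elementary command or the evaluation of a test. Since the expressions of a fixed program have
  bounded size, counting every single operation would change \<open>k\<close> only by a constant factor.\<close>

inductive exec :: "com \<Rightarrow> state \<Rightarrow> nat \<Rightarrow> state \<Rightarrow> bool" where
  Skip: "exec Skip \<sigma> 1 \<sigma>"
| IAssign: "exec (IAssign x e) \<sigma> 1 (\<sigma>\<lparr>ivar := (ivar \<sigma>)(x := ival e \<sigma>)\<rparr>)"
| IStore: "exec (IStore a d e) \<sigma> 1
    (\<sigma>\<lparr>iarr := (iarr \<sigma>)(a := (iarr \<sigma> a)(ival d \<sigma> := ival e \<sigma>))\<rparr>)"
| VAssign: "exec (VAssign x e) \<sigma> 1 (\<sigma>\<lparr>vvar := (vvar \<sigma>)(x := vval e \<sigma>)\<rparr>)"
| VStore: "exec (VStore a d e) \<sigma> 1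
    (\<sigma>\<lparr>varr := (varr \<sigma>)(a := (varr \<sigma> a)(ival d \<sigma> := vval e \<sigma>))\<rparr>)"
| Seq: "exec p \<sigma> k \<sigma>' \<Longrightarrow> exec q \<sigma>' l \<tau> \<Longrightarrow> exec (Seq p q) \<sigma> (k + l) \<tau>"
| CondTrue: "bval b \<sigma> \<Longrightarrow> exec p \<sigma> k \<tau> \<Longrightarrow> exec (Cond b p q) \<sigma> (1 + k) \<tau>"
| CondFalse: "\<not> bval b \<sigma> \<Longrightarrow> exec q \<sigma> k \<tau> \<Longrightarrow> exec (Cond b p q) \<sigma> (1 + k) \<tau>"
| WhileFalse: "\<not> bval b \<sigma> \<Longrightarrow> exec (While b p) \<sigma> 1 \<sigma>"
| WhileTrue: "bval b \<sigma> \<Longrightarrow> exec p \<sigma> k \<sigma>' \<Longrightarrow> exec (While b p) \<sigma>' l \<tau> \<Longrightarrow>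
    exec (While b p) \<sigma> (1 + k + l) \<tau>"

text \<open>Input: \<open>m, n, c\<close> in index variables 0, 1, 2; the class of each job in index array 0;
  \<open>T\<close> in value variable 0; processing times in value array 0, setup times in value array 1.
  All other cells are 0.\<close>

definition input_state :: "inst \<Rightarrow> real \<Rightarrow> state" where
  "input_state I T = \<lparr>
     ivar = (\<lambda>_. 0)(0 := machines I, 1 := njobs I, 2 := nclasses I),
     iarr = (\<lambda>_ _. 0)(0 := \<lambda>j. if j < njobs I then cls I j else 0),
     vvar = (\<lambda>_. 0)(0 := T),
     varr = (\<lambda>_ _. 0)(0 := \<lambda>j. if j < njobs I then real (ptime I j) else 0,
                      1 := \<lambda>i. if i < nclasses I then real (stime I i) else 0)\<rparr>"

text \<open>Output: machine and start time of each job in index array 1 and value array 2; the number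
  of setups in index variable 3, and machine, class and start time of each setup in index arrays 2
  and 3 and value array 3.\<close>

definition output_schedule :: "state \<Rightarrow> schedule" where
  "output_schedule \<sigma> = \<lparr>
     job_machine = iarr \<sigma> 1,
     job_start = varr \<sigma> 2,
     setups = map (\<lambda>k. (iarr \<sigma> 2 k, iarr \<sigma> 3 k, varr \<sigma> 3 k)) [0..<ivar \<sigma> 3]\<rparr>"

end

theory Submission imports Defs begin

text \<open>Call a job big if together with its setup it is longer than \<open>T/2\<close>. In a schedule of makespan at
  most \<open>T\<close>, two big jobs share a machine only if they belong to the same class and neither is
  longer than \<open>T/2\<close>; hence class \<open>i\<close> occupies \<open>m\<^sub>i\<close> machines of its own with big jobs. As it also
  needs \<open>P(C\<^sub>i) / (T - s\<^sub>i)\<close> setups, it needs one setup more if \<open>x\<^sub>i > 0\<close>. The optimum is attained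
  because rounding down all start times keeps a schedule feasible.

  The algorithm puts the big jobs on machines reserved for their class, opening one for every job
  longer than \<open>T/2\<close> and otherwise only if all others of the class have load \<open>T\<close> or more. The small
  jobs first fill up the machines of their class; those left over are placed class by class on all
  machines in turn. A job that would exceed \<open>T\<close> is charged to its machine, which is then closed, but
  moved with an extra setup to the next one; job and setup take at most \<open>T/2\<close>. Closed machines have
  been charged more than \<open>T\<close>, and the total charge is at most \<open>L\<^sub>n\<^sub>o\<^sub>n\<^sub>p\<close>, so the machines
  suffice.\<close>

subsection \<open>Partial schedules\<close>

text \<open>The machine model has no multiplication, division or rounding, so the program cannot
  compute \<open>m_cls\<close>, \<open>x_cls\<close> or \<open>L_nonp\<close>. They occur in the
  analysis only: opening machines greedily leaves, in each class, at most one machine opened for a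
  middle job below T, and this alone keeps the number of machines of the class within
  \<open>m_cls\<close>. Linear time excludes sorting and any search for a machine with room, hence
  the lists of machines with load below T. The number of machines may be far larger than the number
  of jobs, so steps can be paid for only by jobs, classes and opened machines. The last phase has to
  keep load and charge apart. The load of a machine may exceed its charge by a moved job with its
  setup, at most T/2, and it may fall short of the charge by a job moved away. Charges are what adds
  up to more than T per closed machine and so proves that the machines suffice; the gap of T/2 gives
  the makespan. In the earlier phases the factor 3/2 arises differently: a machine below T receives
  one more job of length at most T/2.\<close>

definition items_on :: "nat set \<Rightarrow> schedule \<Rightarrow> item set" where
  "items_on D S = Job ` D \<union> Setup ` {..<length (setups S)}"

definition add_setup :: "nat \<Rightarrow> nat \<Rightarrow> real \<Rightarrow> schedule \<Rightarrow> schedule" where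
  "add_setup u i x S = S\<lparr>setups := setups S @ [(u, i, x)]\<rparr>"

definition add_job :: "nat \<Rightarrow> nat \<Rightarrow> real \<Rightarrow> schedule \<Rightarrow> schedule" where
  "add_job j u x S = S\<lparr>job_machine := (job_machine S)(j := u), job_start := (job_start S)(j := x)\<rparr>"

text \<open>Only the jobs in \<open>D\<close> have been scheduled, on machines below \<open>mb\<close>; machine \<open>u\<close> is free from
  time \<open>ld u\<close> on, and \<open>tp u\<close> is the class of jobs that may be appended to it without a new
  setup.\<close>

definition partial_schedule ::
  "inst \<Rightarrow> nat \<Rightarrow> nat set \<Rightarrow> schedule \<Rightarrow> (nat \<Rightarrow> real) \<Rightarrow> (nat \<Rightarrow> nat option) \<Rightarrow> bool" where
  "partial_schedule I mb D S ld tp \<longleftrightarrow>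
     (\<forall>a\<in>items_on D S. item_machine S a < mb \<and> item_class I S a < nclasses I
        \<and> 0 \<le> item_start S a \<and> item_end I S a \<le> ld (item_machine S a))
   \<and> (\<forall>a\<in>items_on D S. \<forall>b\<in>items_on D S. a \<noteq> b \<and> item_machine S a = item_machine S b \<longrightarrow>
        item_end I S a \<le> item_start S b \<or> item_end I S b \<le> item_start S a)
   \<and> (\<forall>j\<in>D. \<exists>k<length (setups S).
        item_machine S (Setup k) = job_machine S j
      \<and> item_class I S (Setup k) = cls I j
      \<and> item_end I S (Setup k) \<le> job_start S j
      \<and> (\<forall>b\<in>items_on D S. item_machine S b = job_machine S j
            \<and> item_start S (Setup k) < item_start S b \<and> item_start S b < job_start S j
            \<longrightarrow> item_class I S b = cls I j))
   \<and> (\<forall>u i. tp u = Some i \<longrightarrow> (\<exists>k<length (setups S).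
        item_machine S (Setup k) = u \<and> item_class I S (Setup k) = i
      \<and> item_end I S (Setup k) \<le> ld u
      \<and> (\<forall>b\<in>items_on D S. item_machine S b = u
            \<and> item_start S (Setup k) < item_start S b \<longrightarrow> item_class I S b = i)))
   \<and> (\<forall>u. 0 \<le> ld u)"

lemma item_start_le_end: "item_start S a \<le> item_end I S a"
  by (simp add: item_end_def)

lemma add_setup_simps [simp]:
  "setups (add_setup u i x S) = setups S @ [(u, i, x)]"
  "job_machine (add_setup u i x S) = job_machine S"
  "job_start (add_setup u i x S) = job_start S"
  by (simp_all add: add_setup_def)

lemma add_job_simps [simp]:
  "setups (add_job j u x S) = setups S"
  "job_machine (add_job j u x S) = (job_machine S)(j := u)"
  "job_start (add_job j u x S) = (job_start S)(j := x)"
  by (simp_all add: add_job_def)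

lemma items_on_add_setup:
  "items_on D (add_setup u i x S) = insert (Setup (length (setups S))) (items_on D S)"
  by (auto simp: items_on_def lessThan_Suc)

lemma items_on_add_job:
  "items_on (insert j D) (add_job j u x S) = insert (Job j) (items_on D S)"
  by (auto simp: items_on_def)

lemma item_add_setup_old:
  assumes "a \<in> items_on D S"
  shows "item_machine (add_setup u i x S) a = item_machine S a"
    "item_class I (add_setup u i x S) a = item_class I S a"
    "item_start (add_setup u i x S) a = item_start S a"
    "item_end I (add_setup u i x S) a = item_end I S a"
  using assms by (auto simp: items_on_def item_end_def nth_append)

lemma item_add_setup_new:
  "item_machine (add_setup u i x S) (Setup (length (setups S))) = u"
  "item_class I (add_setup u i x S) (Setup (length (setups S))) = i"
  "item_start (add_setup u i x S) (Setup (length (setups S))) = x"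
  "item_end I (add_setup u i x S) (Setup (length (setups S))) = x + real (stime I i)"
  by (auto simp: item_end_def)

lemma item_add_job_old:
  assumes "a \<in> items_on D S" "j \<notin> D"
  shows "item_machine (add_job j u x S) a = item_machine S a"
    "item_class I (add_job j u x S) a = item_class I S a"
    "item_start (add_job j u x S) a = item_start S a"
    "item_end I (add_job j u x S) a = item_end I S a"
  using assms by (auto simp: items_on_def item_end_def)

lemma item_add_job_new:
  "item_machine (add_job j u x S) (Job j) = u"
  "item_class I (add_job j u x S) (Job j) = cls I j"
  "item_start (add_job j u x S) (Job j) = x"
  "item_end I (add_job j u x S) (Job j) = x + real (ptime I j)"
  by (auto simp: item_end_def)

lemma partial_scheduleD:
  assumes "partial_schedule I mb D S ld tp"
  shows "a \<in> items_on D S \<Longrightarrow> item_machine S a < mb"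
    and "a \<in> items_on D S \<Longrightarrow> item_class I S a < nclasses I"
    and "a \<in> items_on D S \<Longrightarrow> 0 \<le> item_start S a"
    and "a \<in> items_on D S \<Longrightarrow> item_end I S a \<le> ld (item_machine S a)"
    and "a \<in> items_on D S \<Longrightarrow> b \<in> items_on D S \<Longrightarrow> a \<noteq> b \<Longrightarrow>
      item_machine S a = item_machine S b \<Longrightarrow>
      item_end I S a \<le> item_start S b \<or> item_end I S b \<le> item_start S a"
    and "0 \<le> ld u"
  using assms unfolding partial_schedule_def by blast+

lemma partial_schedule_job_setup:
  assumes "partial_schedule I mb D S ld tp" "j \<in> D"
  obtains k where "Setup k \<in> items_on D S" "item_machine S (Setup k) = job_machine S j"
    "item_class I S (Setup k) = cls I j" "item_end I S (Setup k) \<le> job_start S j"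
    "\<And>b. b \<in> items_on D S \<Longrightarrow> item_machine S b = job_machine S j \<Longrightarrow>
       item_start S (Setup k) < item_start S b \<Longrightarrow> item_start S b < job_start S j \<Longrightarrow>
       item_class I S b = cls I j"
proof -
  have "\<exists>k<length (setups S).
        item_machine S (Setup k) = job_machine S j
      \<and> item_class I S (Setup k) = cls I j
      \<and> item_end I S (Setup k) \<le> job_start S j
      \<and> (\<forall>b\<in>items_on D S. item_machine S b = job_machine S j
            \<and> item_start S (Setup k) < item_start S b \<and> item_start S b < job_start S j
            \<longrightarrow> item_class I S b = cls I j)"
    using assms unfolding partial_schedule_def by blast
  then show ?thesis
    using that unfolding items_on_def by blast
qed

lemma partial_schedule_top:
  assumes "partial_schedule I mb D S ld tp" "tp u = Some i"
  obtains k where "Setup k \<in> items_on D S" "item_machine S (Setup k) = u"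
    "item_class I S (Setup k) = i" "item_end I S (Setup k) \<le> ld u"
    "\<And>b. b \<in> items_on D S \<Longrightarrow> item_machine S b = u \<Longrightarrow>
       item_start S (Setup k) < item_start S b \<Longrightarrow> item_class I S b = i"
proof -
  have "\<exists>k<length (setups S).
        item_machine S (Setup k) = u \<and> item_class I S (Setup k) = i
      \<and> item_end I S (Setup k) \<le> ld u
      \<and> (\<forall>b\<in>items_on D S. item_machine S b = u
            \<and> item_start S (Setup k) < item_start S b \<longrightarrow> item_class I S b = i)"
    using assms unfolding partial_schedule_def by blast
  then show ?thesis
    using that unfolding items_on_def by blast
qed

text \<open>Setups are addressed by \<open>Setup k \<in> items_on D S\<close> instead of a bound on
  k, the form in which the lemmas on old items apply after an insertion.\<close>

lemma partial_scheduleI: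
  assumes "\<And>a. a \<in> items_on D S \<Longrightarrow> item_machine S a < mb \<and> item_class I S a < nclasses I
        \<and> 0 \<le> item_start S a \<and> item_end I S a \<le> ld (item_machine S a)"
    and "\<And>a b. a \<in> items_on D S \<Longrightarrow> b \<in> items_on D S \<Longrightarrow> a \<noteq> b \<Longrightarrow>
      item_machine S a = item_machine S b \<Longrightarrow>
      item_end I S a \<le> item_start S b \<or> item_end I S b \<le> item_start S a"
    and "\<And>j. j \<in> D \<Longrightarrow> \<exists>k. Setup k \<in> items_on D S \<and> item_machine S (Setup k) = job_machine S j
      \<and> item_class I S (Setup k) = cls I j \<and> item_end I S (Setup k) \<le> job_start S j
      \<and> (\<forall>b\<in>items_on D S. item_machine S b = job_machine S j
            \<and> item_start S (Setup k) < item_start S b \<and> item_start S b < job_start S j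
            \<longrightarrow> item_class I S b = cls I j)"
    and "\<And>u i. tp u = Some i \<Longrightarrow> \<exists>k. Setup k \<in> items_on D S \<and> item_machine S (Setup k) = u
      \<and> item_class I S (Setup k) = i \<and> item_end I S (Setup k) \<le> ld u
      \<and> (\<forall>b\<in>items_on D S. item_machine S b = u
            \<and> item_start S (Setup k) < item_start S b \<longrightarrow> item_class I S b = i)"
    and "\<And>u. 0 \<le> ld u"
  shows "partial_schedule I mb D S ld tp"
proof -
  have mem: "Setup k \<in> items_on D S \<longleftrightarrow> k < length (setups S)" for k
    by (auto simp: items_on_def)
  show ?thesis
    unfolding partial_schedule_def using assms unfolding mem by blast
qed

text \<open>Every item on u has ended by \<open>ld u\<close>, so a setup started then overlaps
  nothing and starts no earlier than any job already placed there. The windows between those jobs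
  and their setups therefore stay intact.\<close>

lemma partial_schedule_add_setup:
  assumes ps: "partial_schedule I mb D S ld tp" and u: "u < mb" and i: "i < nclasses I"
  shows "partial_schedule I mb D (add_setup u i (ld u) S)
           (ld(u := ld u + real (stime I i))) (tp(u := Some i))"
proof -
  note D = partial_scheduleD[OF ps]
  note simps = item_add_setup_old item_add_setup_new
  let ?S = "add_setup u i (ld u) S" and ?n = "Setup (length (setups S))"
  have start: "item_start S a \<le> ld (item_machine S a)" if "a \<in> items_on D S" for a
    using D(4)[OF that] item_start_le_end[of S a I] by linarith
  show ?thesis
  proof (rule partial_scheduleI, unfold items_on_add_setup)
    fix a assume "a \<in> insert ?n (items_on D S)"
    then show "item_machine ?S a < mb \<and> item_class I ?S a < nclasses I \<and> 0 \<le> item_start ?S a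
        \<and> item_end I ?S a \<le> (ld(u := ld u + real (stime I i))) (item_machine ?S a)"
      using D(1-4)[of a] D(6)[of u] u i by (auto simp: simps intro: order_trans)
  next
    fix a b assume "a \<in> insert ?n (items_on D S)" "b \<in> insert ?n (items_on D S)" "a \<noteq> b"
      "item_machine ?S a = item_machine ?S b"
    then show "item_end I ?S a \<le> item_start ?S b \<or> item_end I ?S b \<le> item_start ?S a"
      using D(4)[of a] D(4)[of b] D(5)[of a b] by (auto simp: simps)
  next
    fix j assume j: "j \<in> D"
    obtain k where k: "Setup k \<in> items_on D S" "item_machine S (Setup k) = job_machine S j"
      "item_class I S (Setup k) = cls I j" "item_end I S (Setup k) \<le> job_start S j"
      "\<And>b. b \<in> items_on D S \<Longrightarrow> item_machine S b = job_machine S j \<Longrightarrow>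
       item_start S (Setup k) < item_start S b \<Longrightarrow> item_start S b < job_start S j \<Longrightarrow>
       item_class I S b = cls I j"
      using partial_schedule_job_setup[OF ps j] by blast
    have "Job j \<in> items_on D S" using j by (auto simp: items_on_def)
    then have "job_start S j \<le> ld (job_machine S j)" using start[of "Job j"] by simp
    then have "\<forall>b\<in>insert ?n (items_on D S). item_machine ?S b = job_machine ?S j
            \<and> item_start ?S (Setup k) < item_start ?S b \<and> item_start ?S b < job_start ?S j
            \<longrightarrow> item_class I ?S b = cls I j"
      using k(1,5) by (auto simp: simps simp del: item_class.simps item_machine.simps item_start.simps)
    then show "\<exists>k. Setup k \<in> insert ?n (items_on D S) \<and> item_machine ?S (Setup k) = job_machine ?S j
      \<and> item_class I ?S (Setup k) = cls I j \<and> item_end I ?S (Setup k) \<le> job_start ?S j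
      \<and> (\<forall>b\<in>insert ?n (items_on D S). item_machine ?S b = job_machine ?S j
            \<and> item_start ?S (Setup k) < item_start ?S b \<and> item_start ?S b < job_start ?S j
            \<longrightarrow> item_class I ?S b = cls I j)"
      using k(1-4) by (intro exI[of _ k]) (simp add: item_add_setup_old[OF k(1)] del: item_class.simps item_machine.simps item_start.simps)
  next
    fix v l assume tp: "(tp(u := Some i)) v = Some l"
    show "\<exists>k. Setup k \<in> insert ?n (items_on D S) \<and> item_machine ?S (Setup k) = v
      \<and> item_class I ?S (Setup k) = l
      \<and> item_end I ?S (Setup k) \<le> (ld(u := ld u + real (stime I i))) v
      \<and> (\<forall>b\<in>insert ?n (items_on D S). item_machine ?S b = v
            \<and> item_start ?S (Setup k) < item_start ?S b \<longrightarrow> item_class I ?S b = l)"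
    proof (cases "v = u")
      case True
      \<comment> \<open>No item on u starts strictly later than \<open>ld u\<close>, so the class
        condition after the new setup holds vacuously.\<close>
      then have "\<forall>b\<in>insert ?n (items_on D S). item_machine ?S b = v
            \<and> item_start ?S ?n < item_start ?S b \<longrightarrow> item_class I ?S b = l"
        using start by (fastforce simp: simps simp del: item_class.simps item_machine.simps item_start.simps)
      then show ?thesis
        using True tp by (intro exI[of _ "length (setups S)"])
          (simp add: simps del: item_class.simps item_machine.simps item_start.simps)
    next
      case False
      then have "tp v = Some l" using tp by simp
      then obtain k where k: "Setup k \<in> items_on D S" "item_machine S (Setup k) = v"
        "item_class I S (Setup k) = l" "item_end I S (Setup k) \<le> ld v"
        "\<And>b. b \<in> items_on D S \<Longrightarrow> item_machine S b = v \<Longrightarrow>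
          item_start S (Setup k) < item_start S b \<Longrightarrow> item_class I S b = l"
        using partial_schedule_top[OF ps] by blast
      have "\<forall>b\<in>insert ?n (items_on D S). item_machine ?S b = v
            \<and> item_start ?S (Setup k) < item_start ?S b \<longrightarrow> item_class I ?S b = l"
        using k(1,5) False by (auto simp: simps simp del: item_class.simps item_machine.simps item_start.simps)
      then show ?thesis
        using k(1-4) False by (intro exI[of _ k])
          (simp add: item_add_setup_old[OF k(1)] del: item_class.simps item_machine.simps item_start.simps)
    qed
  next
    fix v show "0 \<le> (ld(u := ld u + real (stime I i))) v" using D(6) by simp
  qed
qed

text \<open>The setup that witnesses \<open>tp u\<close> serves the new job as well and shows that
  its machine and class are in range. The class on top does not change, so \<open>tp\<close> is
  kept.\<close>

lemma partial_schedule_add_job: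
  assumes ps: "partial_schedule I mb D S ld tp" and tp: "tp u = Some (cls I j)"
    and j: "j \<notin> D" 
  shows "partial_schedule I mb (insert j D) (add_job j u (ld u) S)
           (ld(u := ld u + real (ptime I j))) tp"
proof -
  note D = partial_scheduleD[OF ps]
  note simps = item_add_job_old[OF _ j] item_add_job_new
  let ?S = "add_job j u (ld u) S"
  note del = item_class.simps item_machine.simps item_start.simps add_job_simps
  have start: "item_start S a \<le> ld (item_machine S a)" if "a \<in> items_on D S" for a
    using D(4)[OF that] item_start_le_end[of S a I] by linarith
  obtain k0 where k0: "Setup k0 \<in> items_on D S" "item_machine S (Setup k0) = u"
    "item_class I S (Setup k0) = cls I j" "item_end I S (Setup k0) \<le> ld u"
    "\<And>b. b \<in> items_on D S \<Longrightarrow> item_machine S b = u \<Longrightarrow>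
       item_start S (Setup k0) < item_start S b \<Longrightarrow> item_class I S b = cls I j"
    using partial_schedule_top[OF ps tp] by blast
  show ?thesis
  proof (rule partial_scheduleI, unfold items_on_add_job)
    fix a assume "a \<in> insert (Job j) (items_on D S)"
    then show "item_machine ?S a < mb \<and> item_class I ?S a < nclasses I \<and> 0 \<le> item_start ?S a
        \<and> item_end I ?S a \<le> (ld(u := ld u + real (ptime I j))) (item_machine ?S a)"
      using D(1-4)[of a] D(6)[of u] D(1,2)[OF k0(1)] k0(2,3)
      by (auto simp: simps simp del: del intro: order_trans)
  next
    fix a b assume "a \<in> insert (Job j) (items_on D S)" "b \<in> insert (Job j) (items_on D S)"
      "a \<noteq> b" "item_machine ?S a = item_machine ?S b"
    then show "item_end I ?S a \<le> item_start ?S b \<or> item_end I ?S b \<le> item_start ?S a"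
      using D(4)[of a] D(4)[of b] D(5)[of a b] by (auto simp: simps simp del: del)
  next
    fix l assume l: "l \<in> insert j D"
    show "\<exists>k. Setup k \<in> insert (Job j) (items_on D S)
      \<and> item_machine ?S (Setup k) = job_machine ?S l
      \<and> item_class I ?S (Setup k) = cls I l \<and> item_end I ?S (Setup k) \<le> job_start ?S l
      \<and> (\<forall>b\<in>insert (Job j) (items_on D S). item_machine ?S b = job_machine ?S l
            \<and> item_start ?S (Setup k) < item_start ?S b \<and> item_start ?S b < job_start ?S l
            \<longrightarrow> item_class I ?S b = cls I l)"
    proof (cases "l = j")
      case True
      have "job_machine ?S j = u" "job_start ?S j = ld u" by simp_all
      moreover have "\<forall>b\<in>insert (Job j) (items_on D S). item_machine ?S b = u
            \<and> item_start ?S (Setup k0) < item_start ?S b \<and> item_start ?S b < ld u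
            \<longrightarrow> item_class I ?S b = cls I j"
        using k0(1,5) by (auto simp: simps simp del: del)
      ultimately show ?thesis using k0(1-4) True by (intro exI[of _ k0])
          (simp add: item_add_job_old[OF k0(1) j] del: del)
    next
      case False
      then have lD: "l \<in> D" using l by simp
      have eqs: "job_machine ?S l = job_machine S l" "job_start ?S l = job_start S l"
        using False by auto
      obtain k where k: "Setup k \<in> items_on D S" "item_machine S (Setup k) = job_machine S l"
        "item_class I S (Setup k) = cls I l" "item_end I S (Setup k) \<le> job_start S l"
        "\<And>b. b \<in> items_on D S \<Longrightarrow> item_machine S b = job_machine S l \<Longrightarrow>
         item_start S (Setup k) < item_start S b \<Longrightarrow> item_start S b < job_start S l \<Longrightarrow>
         item_class I S b = cls I l"
        using partial_schedule_job_setup[OF ps lD] by blast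
      have "Job l \<in> items_on D S" using lD by (auto simp: items_on_def)
      then have "job_start S l \<le> ld (job_machine S l)" using start[of "Job l"] by simp
      then have "\<forall>b\<in>insert (Job j) (items_on D S). item_machine ?S b = job_machine S l
            \<and> item_start ?S (Setup k) < item_start ?S b \<and> item_start ?S b < job_start S l
            \<longrightarrow> item_class I ?S b = cls I l"
        using k(1,5) by (auto simp: simps simp del: del)
      then show ?thesis
        using k(1-4) unfolding eqs by (intro exI[of _ k])
          (simp add: item_add_job_old[OF k(1) j] del: del)
    qed
  next
    fix v l assume tp': "tp v = Some l"
    then obtain k where k: "Setup k \<in> items_on D S" "item_machine S (Setup k) = v"
        "item_class I S (Setup k) = l" "item_end I S (Setup k) \<le> ld v"
        "\<And>b. b \<in> items_on D S \<Longrightarrow> item_machine S b = v \<Longrightarrow>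
          item_start S (Setup k) < item_start S b \<Longrightarrow> item_class I S b = l"
      using partial_schedule_top[OF ps] by blast
    have "\<forall>b\<in>insert (Job j) (items_on D S). item_machine ?S b = v
            \<and> item_start ?S (Setup k) < item_start ?S b \<longrightarrow> item_class I ?S b = l"
      using k(1,5) tp tp' by (auto simp: simps simp del: del)
    moreover have "item_end I ?S (Setup k) \<le> (ld(u := ld u + real (ptime I j))) v"
      using k(4) by (auto simp: item_add_job_old[OF k(1) j] simp del: del)
    ultimately show "\<exists>k. Setup k \<in> insert (Job j) (items_on D S) \<and> item_machine ?S (Setup k) = v
      \<and> item_class I ?S (Setup k) = l
      \<and> item_end I ?S (Setup k) \<le> (ld(u := ld u + real (ptime I j))) v
      \<and> (\<forall>b\<in>insert (Job j) (items_on D S). item_machine ?S b = v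
            \<and> item_start ?S (Setup k) < item_start ?S b \<longrightarrow> item_class I ?S b = l)"
      using k(1-3) by (intro exI[of _ k])
          (simp add: item_add_job_old[OF k(1) j] del: del)
  next
    fix v show "0 \<le> (ld(u := ld u + real (ptime I j))) v" using D(6) by simp
  qed
qed

lemma partial_schedule_empty:
  "setups S = [] \<Longrightarrow> (\<And>u. tp u = None) \<Longrightarrow> (\<And>u. 0 \<le> ld u) \<Longrightarrow> partial_schedule I mb {} S ld tp"
  by (simp add: partial_schedule_def items_on_def)

lemma partial_schedule_mono:
  assumes "partial_schedule I mb D S ld tp" "mb \<le> mb'" "\<And>u i. tp' u = Some i \<Longrightarrow> tp u = Some i"
  shows "partial_schedule I mb' D S ld tp'"
  using assms(1,2) assms(3)[of _ _] unfolding partial_schedule_def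
  by (meson order_less_le_trans)

section \<open>Complete schedules\<close>

lemma items_conv: "items I S = items_on {..<njobs I} S"
  by (simp add: items_def items_on_def)

lemma finite_items [simp]: "finite (items I S)"
  by (simp add: items_def)

lemma partial_schedule_feasible:
  assumes "partial_schedule I (machines I) {..<njobs I} S ld tp"
  shows "feasible I S"
  using assms unfolding partial_schedule_def feasible_def items_conv by (simp add: Ball_def)

lemma partial_schedule_makespan_le:
  assumes "partial_schedule I (machines I) {..<njobs I} S ld tp" "njobs I \<ge> 1"
    and "\<And>u. u < machines I \<Longrightarrow> ld u \<le> B"
  shows "makespan I S \<le> B"
proof -
  have "Job 0 \<in> items I S" using assms(2) by (auto simp: items_def)
  then have "items I S \<noteq> {}" by auto
  moreover have "item_end I S a \<le> B" if "a \<in> items I S" for a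
    using partial_scheduleD(1,4)[OF assms(1)] assms(3) that unfolding items_conv
    by (meson order_trans)
  ultimately show ?thesis unfolding makespan_def by auto
qed

subsection \<open>The machine numbers\<close>

lemma finite_class_jobs [simp]: "finite (class_jobs I i)"
  by (simp add: class_jobs_def)

lemma P_sum_mono: "finite B \<Longrightarrow> A \<subseteq> B \<Longrightarrow> P_sum I A \<le> P_sum I B"
  by (simp add: P_sum_def sum_mono2)

lemma P_sum_partition_classes:
  assumes "valid_inst I"
  shows "P_sum I {..<njobs I} = (\<Sum>i<nclasses I. P_sum I (class_jobs I i))"
proof -
  have "(\<Sum>i<nclasses I. \<Sum>j\<in>{j \<in> {..<njobs I}. cls I j = i}. ptime I j) = (\<Sum>j<njobs I. ptime I j)"
    using assms by (intro sum.group) (auto simp: valid_inst_def)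
  then show ?thesis
    by (simp add: P_sum_def class_jobs_def)
qed

lemma T_min_bounds:
  assumes "valid_inst I" "T \<ge> T_min I" "j < njobs I"
  shows "real (stime I (cls I j)) + real (ptime I j) \<le> T"
proof -
  let ?i = "cls I j"
  have "ptime I j \<in> ptime I ` class_jobs I ?i" using assms(3) by (auto simp: class_jobs_def)
  then have "ptime I j \<le> tmax I ?i" unfolding tmax_def by (intro Max_ge) auto
  moreover have "stime I ?i + tmax I ?i \<le> Max ((\<lambda>i. stime I i + tmax I i) ` {..<nclasses I})"
    using assms(1,3) by (intro Max_ge) (auto simp: valid_inst_def)
  ultimately have "stime I ?i + ptime I j \<le> Max ((\<lambda>i. stime I i + tmax I i) ` {..<nclasses I})"
    by linarith
  then show ?thesis using assms(2) unfolding T_min_def by linarith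
qed

text \<open>Strict because every class contains a job of length at least 1. This keeps the divisor
  \<open>T - real (stime I i)\<close> positive throughout.\<close>

lemma stime_less_T:
  assumes "valid_inst I" "T \<ge> T_min I" "i < nclasses I"
  shows "real (stime I i) < T"
proof -
  obtain j where j: "j < njobs I" "cls I j = i" using assms by (auto simp: valid_inst_def)
  then have "1 \<le> ptime I j" using assms(1) by (auto simp: valid_inst_def)
  then show ?thesis using T_min_bounds[OF assms(1,2) j(1)] j by simp
qed

definition mid_jobs :: "inst \<Rightarrow> real \<Rightarrow> nat \<Rightarrow> nat set" where
  "mid_jobs I T i = {j \<in> class_jobs I i. real (ptime I j) \<le> T / 2
      \<and> T / 2 < real (stime I i) + real (ptime I j)}"

definition long_jobs :: "inst \<Rightarrow> real \<Rightarrow> nat \<Rightarrow> nat set" where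
  "long_jobs I T i = {j \<in> class_jobs I i. T / 2 < real (ptime I j)}"

lemma finite_mid_long [simp]: "finite (mid_jobs I T i)" "finite (long_jobs I T i)"
  by (simp_all add: mid_jobs_def long_jobs_def)

text \<open>In an expensive class every job counts as a middle job, so that both cases of the
  definition of \<open>m\<^sub>i\<close> take the same form.\<close>

lemma m_cls_eq:
  assumes "valid_inst I" "T \<ge> T_min I" "i < nclasses I"
  shows "m_cls I T i = int (card (long_jobs I T i))
           + \<lceil>real (P_sum I (mid_jobs I T i)) / (T - real (stime I i))\<rceil>"
proof (cases "i \<in> I_exp I T")
  case True
  have b: "real (stime I i) + real (ptime I j) \<le> T" "1 \<le> ptime I j" if "j \<in> class_jobs I i" for j
    using T_min_bounds[OF assms(1,2), of j] assms(1) that by (auto simp: class_jobs_def valid_inst_def)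
  have s: "T / 2 < real (stime I i)" using True by (simp add: I_exp_def)
  have "long_jobs I T i = {}" using b(1) s by (fastforce simp: long_jobs_def)
  moreover have "mid_jobs I T i = class_jobs I i"
    using b s by (force simp: mid_jobs_def)
  ultimately show ?thesis using True by (simp add: m_cls_def)
next
  case False
  then have s: "i \<in> I_chp I T" using assms by (auto simp: I_exp_def I_chp_def)
  have "long_jobs I T i = class_jobs I i \<inter> J_plus I T"
    by (auto simp: long_jobs_def class_jobs_def J_plus_def)
  moreover have "mid_jobs I T i = class_jobs I i \<inter> K_jobs I T"
    using s by (auto simp: mid_jobs_def class_jobs_def K_jobs_def J_minus_def)
  ultimately show ?thesis using False by (simp add: m_cls_def)
qed

text \<open>Collecting the setups class by class allows a termwise comparison, with the setups of an
  arbitrary schedule in the lower bound and with the charges of the algorithm in the upper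
  bound.\<close>

lemma L_nonp_eq:
  "L_nonp I T = real (P_sum I {..<njobs I}) + (\<Sum>i<nclasses I.
      (of_int (m_cls I T i) + (if x_cls I T i > 0 then 1 else 0)) * real (stime I i))"
proof -
  have "(\<Sum>i\<in>{i. i < nclasses I \<and> x_cls I T i > 0}. real (stime I i))
      = (\<Sum>i<nclasses I. if x_cls I T i > 0 then real (stime I i) else 0)"
    by (subst sum.inter_filter[symmetric]) (auto intro: sum.cong)
  then show ?thesis
    unfolding L_nonp_def
    by (simp add: sum.distrib[symmetric] distrib_right if_distrib[of "\<lambda>x. x * _"] cong: if_cong)
qed

subsection \<open>The lower bound\<close>

text \<open>Induction on the number of items: all others must end before the one that starts last,
  so its start replaces the bound M. Positive lengths exclude the opposite order.\<close>

lemma sum_length_le_of_disjoint: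
  fixes st len :: "'a \<Rightarrow> real"
  assumes "finite A" "\<And>a. a \<in> A \<Longrightarrow> 0 \<le> st a" "\<And>a. a \<in> A \<Longrightarrow> 0 < len a"
    "\<And>a. a \<in> A \<Longrightarrow> st a + len a \<le> M" "0 \<le> M"
    "\<And>a b. a \<in> A \<Longrightarrow> b \<in> A \<Longrightarrow> a \<noteq> b \<Longrightarrow> st a + len a \<le> st b \<or> st b + len b \<le> st a"
  shows "sum len A \<le> M"
  using assms
proof (induction "card A" arbitrary: A M)
  case 0
  then show ?case by simp
next
  case (Suc n)
  then have ne: "A \<noteq> {}" "finite A" by auto
  have "Max (st ` A) \<in> st ` A" using ne by (intro Max_in) auto
  then obtain a where a: "a \<in> A" "st a = Max (st ` A)" by auto
  have mx: "st b \<le> st a" if "b \<in> A" for b using that ne a(2) by simp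
  have "sum len (A - {a}) \<le> st a"
  proof (rule Suc.hyps)
    show "n = card (A - {a})" using Suc.hyps(2) a ne by simp
    show "st b + len b \<le> st a" if "b \<in> A - {a}" for b
      using Suc.prems(6)[of b a] Suc.prems(3)[OF a(1)] mx[of b] that a by fastforce
  qed (use Suc.prems a(1) in auto)
  moreover have "sum len A = len a + sum len (A - {a})" using a ne by (simp add: sum.remove)
  ultimately show ?case using Suc.prems(4)[OF a(1)] by linarith
qed

context
  fixes I :: inst and T :: real and S :: schedule
  assumes valid: "valid_inst I" and T: "T \<ge> T_min I"
    and feas: "feasible I S" and span: "makespan I S \<le> T"
begin

lemma machine_load_le:
  assumes "A \<subseteq> items I S" "\<And>a. a \<in> A \<Longrightarrow> item_machine S a = u"
  shows "(\<Sum>a\<in>A. real (item_length I S a)) \<le> T"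
proof (rule sum_length_le_of_disjoint)
  show "finite A" using assms(1) finite_subset[OF _ finite_items] by blast
  have cl: "item_class I S a < nclasses I" if "a \<in> items I S" for a
    using that feas by (auto simp: feasible_def)
  have "0 < item_length I S a" if "a \<in> items I S" for a
  proof (cases a)
    case (Job j)
    then show ?thesis using that valid by (auto simp: items_def valid_inst_def)
  next
    case (Setup k)
    then show ?thesis using cl[OF that] valid by (fastforce simp: valid_inst_def)
  qed
  then show "0 < real (item_length I S a)" if "a \<in> A" for a
    using that assms(1) by auto
  show "0 \<le> item_start S a" if "a \<in> A" for a
    using that assms(1) feas by (auto simp: feasible_def)
  show "item_start S a + real (item_length I S a) \<le> T" if "a \<in> A" for a
  proof -
    have "item_end I S a \<le> makespan I S"
      unfolding makespan_def using that assms(1) by (intro Max_ge) auto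
    then show ?thesis using span by (simp add: item_end_def)
  qed
  show "0 \<le> T" using stime_less_T[OF valid T, of "cls I 0"] valid by (force simp: valid_inst_def)
  show "item_start S a + real (item_length I S a) \<le> item_start S b \<or>
      item_start S b + real (item_length I S b) \<le> item_start S a"
    if "a \<in> A" "b \<in> A" "a \<noteq> b" for a b
    using that assms feas unfolding feasible_def item_end_def by (metis subsetD)
qed

section \<open>Setups and machines of a class\<close>

definition setup_positions :: "nat \<Rightarrow> nat set" where
  "setup_positions i = {k. k < length (setups S) \<and> fst (snd (setups S ! k)) = i}"

lemma finite_setup_positions [simp]: "finite (setup_positions i)"
  by (simp add: setup_positions_def)

lemma setup_of_job:
  assumes "j < njobs I"
  obtains k where "k \<in> setup_positions (cls I j)" "fst (setups S ! k) = job_machine S j"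
proof -
  obtain k where "k < length (setups S)" "item_machine S (Setup k) = job_machine S j"
      "item_class I S (Setup k) = cls I j"
    using feas assms unfolding feasible_def by blast
  then show ?thesis using that by (simp add: setup_positions_def)
qed

lemma job_machine_less: "j < njobs I \<Longrightarrow> job_machine S j < machines I"
  using feas unfolding feasible_def items_def by (metis UnI1 image_eqI item_machine.simps(1) lessThan_iff)

lemma setup_class_less: "k < length (setups S) \<Longrightarrow> fst (snd (setups S ! k)) < nclasses I"
  using feas unfolding feasible_def items_def by (metis UnI2 image_eqI item_class.simps(2) lessThan_iff)

text \<open>A machine that runs jobs of \<open>X\<close> also carries a setup of class i; counting
  one of them is enough.\<close>

lemma class_load_le:
  assumes X: "X \<subseteq> class_jobs I i" and u: "u \<in> job_machine S ` X"
  shows "real (stime I i) + real (P_sum I {j \<in> X. job_machine S j = u}) \<le> T"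
proof -
  obtain j where j: "j \<in> X" "job_machine S j = u" using u by auto
  then have "j < njobs I" "cls I j = i" using X by (auto simp: class_jobs_def)
  then obtain k where k: "k \<in> setup_positions i" "fst (setups S ! k) = u"
    using setup_of_job[of j] j by auto
  let ?Y = "{j \<in> X. job_machine S j = u}"
  have "finite X" using X finite_subset[OF _ finite_class_jobs] by blast
  then have fin: "finite ?Y" by simp
  have "(\<Sum>a\<in>insert (Setup k) (Job ` ?Y). real (item_length I S a)) \<le> T"
    using k X by (intro machine_load_le) (auto simp: items_def setup_positions_def class_jobs_def)
  moreover have "(\<Sum>a\<in>insert (Setup k) (Job ` ?Y). real (item_length I S a))
      = real (stime I i) + (\<Sum>j\<in>?Y. real (ptime I j))"
    using fin k by (subst sum.insert) (auto simp: sum.reindex inj_on_def setup_positions_def)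
  ultimately show ?thesis by (simp add: P_sum_def)
qed

lemma P_sum_le_machines:
  assumes X: "X \<subseteq> class_jobs I i"
  shows "real (P_sum I X) \<le> real (card (job_machine S ` X)) * (T - real (stime I i))"
proof -
  have fin: "finite X" using X finite_subset[OF _ finite_class_jobs] by blast
  have eq: "(\<Sum>u\<in>job_machine S ` X. P_sum I {j \<in> X. job_machine S j = u}) = P_sum I X"
    unfolding P_sum_def using fin by (intro sum.group) auto
  then have "real (P_sum I X) = (\<Sum>u\<in>job_machine S ` X. real (P_sum I {j \<in> X. job_machine S j = u}))"
    using arg_cong[OF eq, of real] by simp
  also have "\<dots> \<le> (\<Sum>u\<in>job_machine S ` X. T - real (stime I i))"
    using class_load_le[OF X] by (intro sum_mono) (simp add: algebra_simps)
  finally show ?thesis by simp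
qed

lemma machines_le_setups:
  assumes X: "X \<subseteq> class_jobs I i"
  shows "card (job_machine S ` X) \<le> card (setup_positions i)"
proof -
  have "job_machine S ` X \<subseteq> (\<lambda>k. fst (setups S ! k)) ` setup_positions i"
  proof
    fix u assume "u \<in> job_machine S ` X"
    then obtain j where j: "j < njobs I" "cls I j = i" "job_machine S j = u"
      using X by (auto simp: class_jobs_def)
    then obtain k where "k \<in> setup_positions i" "fst (setups S ! k) = u"
      using setup_of_job[of j] by auto
    then show "u \<in> (\<lambda>k. fst (setups S ! k)) ` setup_positions i" by (intro image_eqI) auto
  qed
  then show ?thesis by (rule surj_card_le[rotated]) simp
qed

section \<open>Machines occupied by big jobs\<close>

definition big_jobs :: "nat \<Rightarrow> nat set" where
  "big_jobs i = long_jobs I T i \<union> mid_jobs I T i"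

lemma big_jobs_iff:
  "j \<in> big_jobs i \<longleftrightarrow> j < njobs I \<and> cls I j = i \<and>
    (T / 2 < real (ptime I j) \<or> T / 2 < real (stime I i) + real (ptime I j))"
  by (auto simp: big_jobs_def long_jobs_def mid_jobs_def class_jobs_def)

text \<open>A long job together with its setup and any other big job (and its setup) exceeds \<open>T\<close>, and
  so do two big jobs with distinct setups.\<close>

lemma big_jobs_same_machine:
  assumes "j \<in> big_jobs i" "l \<in> big_jobs h" "job_machine S j = job_machine S l" "j \<noteq> l"
  shows "i = h \<and> j \<in> mid_jobs I T i"
proof (rule ccontr)
  assume "\<not> ?thesis"
  then have c: "i \<noteq> h \<or> T / 2 < real (ptime I j)"
    using assms(1) by (auto simp: big_jobs_def mid_jobs_def long_jobs_def)
  have j: "j < njobs I" "cls I j = i" and l: "l < njobs I" "cls I l = h"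
    using assms by (auto simp: big_jobs_iff)
  obtain k where k: "k \<in> setup_positions i" "fst (setups S ! k) = job_machine S j"
    using setup_of_job[OF j(1)] j(2) by auto
  obtain k' where k': "k' \<in> setup_positions h" "fst (setups S ! k') = job_machine S j"
    using setup_of_job[OF l(1)] l(2) assms(3) by auto
  have tj: "T / 2 < real (stime I i) + real (ptime I j)" 
    and tl: "T / 2 < real (stime I h) + real (ptime I l)"
    using assms(1,2) by (auto simp: big_jobs_iff)
  show False
  proof (cases "i = h")
    case False
    then have "k \<noteq> k'" using k k' by (auto simp: setup_positions_def)
    moreover have "(\<Sum>a\<in>{Setup k, Job j, Setup k', Job l}. real (item_length I S a)) \<le> T"
      by (rule machine_load_le[of _ "job_machine S j"])
        (use j l k k' assms(3) in \<open>auto simp: items_def setup_positions_def\<close>)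
    ultimately show False using assms(4) k k' tj tl by (simp add: setup_positions_def)
  next
    case True
    have "(\<Sum>a\<in>{Setup k, Job j, Job l}. real (item_length I S a)) \<le> T"
      by (rule machine_load_le[of _ "job_machine S j"])
        (use j l k assms(3) in \<open>auto simp: items_def setup_positions_def\<close>)
    then show False using assms(4) k c tl True by (simp add: setup_positions_def)
  qed
qed

text \<open>By \<open>P_sum_le_machines\<close> the middle jobs occupy at least the rounded-up
  quotient of machines. Long jobs sit on pairwise different machines and share none with a middle
  job, so the two counts add up.\<close>

lemma m_cls_le_machines:
  assumes i: "i < nclasses I"
  shows "m_cls I T i \<le> int (card (job_machine S ` big_jobs i))"
proof -
  have pos: "0 < T - real (stime I i)" using stime_less_T[OF valid T i] by simp
  have "mid_jobs I T i \<subseteq> class_jobs I i" by (auto simp: mid_jobs_def)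
  then have "real (P_sum I (mid_jobs I T i)) / (T - real (stime I i))
      \<le> real (card (job_machine S ` mid_jobs I T i))"
    using P_sum_le_machines[of "mid_jobs I T i" i] pos by (simp add: divide_le_eq)
  then have "\<lceil>real (P_sum I (mid_jobs I T i)) / (T - real (stime I i))\<rceil>
      \<le> int (card (job_machine S ` mid_jobs I T i))"
    by linarith
  moreover have "inj_on (job_machine S) (long_jobs I T i)"
  proof (rule inj_onI, rule ccontr)
    fix j l assume *: "j \<in> long_jobs I T i" "l \<in> long_jobs I T i"
      "job_machine S j = job_machine S l" "j \<noteq> l"
    then have "j \<in> mid_jobs I T i" using big_jobs_same_machine[of j i l i] by (auto simp: big_jobs_def)
    then show False using *(1) by (auto simp: mid_jobs_def long_jobs_def)
  qed
  then have "card (job_machine S ` long_jobs I T i) = card (long_jobs I T i)"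
    by (rule card_image)
  moreover have "job_machine S ` long_jobs I T i \<inter> job_machine S ` mid_jobs I T i = {}"
  proof (rule ccontr)
    assume "\<not> ?thesis"
    then obtain j l where *: "j \<in> long_jobs I T i" "l \<in> mid_jobs I T i"
      "job_machine S j = job_machine S l" by auto
    then have "j \<noteq> l" "j \<notin> mid_jobs I T i" by (auto simp: mid_jobs_def long_jobs_def)
    then show False using big_jobs_same_machine[of j i l i] * by (auto simp: big_jobs_def)
  qed
  then have "card (job_machine S ` big_jobs i)
      = card (job_machine S ` long_jobs I T i) + card (job_machine S ` mid_jobs I T i)"
    unfolding big_jobs_def image_Un by (intro card_Un_disjoint) auto
  ultimately show ?thesis using m_cls_eq[OF valid T i] by simp
qed

text \<open>Big jobs of different classes never share a machine, so the counts of the classes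
  concern disjoint sets of machines.\<close>

lemma m_total_le_machines: "m_total I T \<le> int (machines I)"
proof -
  let ?W = "\<lambda>i. job_machine S ` big_jobs i"
  have fin: "finite (?W i)" for i by (simp add: big_jobs_def)
  have "m_total I T \<le> (\<Sum>i<nclasses I. int (card (?W i)))"
    unfolding m_total_def using m_cls_le_machines by (intro sum_mono) simp
  also have "\<dots> = int (card (\<Union>i\<in>{..<nclasses I}. ?W i))"
  proof (subst card_UN_disjoint)
    show "\<forall>i\<in>{..<nclasses I}. \<forall>h\<in>{..<nclasses I}. i \<noteq> h \<longrightarrow> ?W i \<inter> ?W h = {}"
    proof (intro ballI impI, rule ccontr)
      fix i h assume "i \<noteq> h" "?W i \<inter> ?W h \<noteq> {}"
      then obtain j l where *: "j \<in> big_jobs i" "l \<in> big_jobs h" "job_machine S j = job_machine S l"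
        by auto
      then have "j \<noteq> l" using \<open>i \<noteq> h\<close> by (auto simp: big_jobs_iff)
      then show False using big_jobs_same_machine[OF *] \<open>i \<noteq> h\<close> by simp
    qed
  qed (use fin in auto)
  finally have le: "m_total I T \<le> int (card (\<Union>i\<in>{..<nclasses I}. ?W i))" .
  have "(\<Union>i\<in>{..<nclasses I}. ?W i) \<subseteq> {..<machines I}"
    using job_machine_less by (auto simp: big_jobs_iff)
  from card_mono[OF _ this] le show ?thesis by simp
qed

section \<open>Area bound and number of setups\<close>

lemma total_load_le_area:
  "real (P_sum I {..<njobs I}) + (\<Sum>i<nclasses I. real (card (setup_positions i)) * real (stime I i))
     \<le> real (machines I) * T"
proof -
  have mach: "item_machine S a < machines I" if "a \<in> items I S" for a
    using that feas by (auto simp: feasible_def)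
  have "(\<Sum>a\<in>items I S. real (item_length I S a))
      = (\<Sum>u<machines I. \<Sum>a\<in>{a \<in> items I S. item_machine S a = u}. real (item_length I S a))"
    using mach by (intro sum.group[symmetric]) auto
  also have "\<dots> \<le> (\<Sum>u<machines I. T)"
    by (intro sum_mono machine_load_le) auto
  finally have *: "(\<Sum>a\<in>items I S. real (item_length I S a)) \<le> real (machines I) * T" by simp
  have "(\<Sum>a\<in>items I S. real (item_length I S a))
      = (\<Sum>j<njobs I. real (ptime I j)) + (\<Sum>k<length (setups S). real (stime I (fst (snd (setups S ! k)))))"
    unfolding items_def by (subst sum.union_disjoint) (auto simp: sum.reindex inj_on_def)
  moreover have "(\<Sum>k<length (setups S). real (stime I (fst (snd (setups S ! k)))))
      = (\<Sum>i<nclasses I. \<Sum>k\<in>{k \<in> {..<length (setups S)}. fst (snd (setups S ! k)) = i}.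
           real (stime I (fst (snd (setups S ! k)))))"
    using setup_class_less by (intro sum.group[symmetric]) auto
  moreover have "\<dots> = (\<Sum>i<nclasses I. real (card (setup_positions i)) * real (stime I i))"
    by (intro sum.cong) (simp_all add: setup_positions_def)
  ultimately show ?thesis using * by (simp add: P_sum_def)
qed

text \<open>The machines with big jobs already force \<open>m_cls\<close> setups. Moreover the
  processing time of the class is at most the number of setups times
  \<open>T - real (stime I i)\<close>; if \<open>x_cls\<close> is positive, that number strictly
  exceeds \<open>m_cls\<close>, and integrality supplies the extra setup.\<close>

lemma setups_lower_bound:
  assumes i: "i < nclasses I"
  shows "of_int (m_cls I T i) + (if x_cls I T i > 0 then 1 else 0) \<le> real (card (setup_positions i))"
proof -
  have "big_jobs i \<subseteq> class_jobs I i" by (auto simp: big_jobs_def mid_jobs_def long_jobs_def)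
  then have m: "m_cls I T i \<le> int (card (setup_positions i))"
    using m_cls_le_machines[OF i] machines_le_setups[of "big_jobs i" i] by linarith
  show ?thesis
  proof (cases "x_cls I T i > 0")
    case True
    have pos: "0 < T - real (stime I i)" using stime_less_T[OF valid T i] by simp
    have "real (card (job_machine S ` class_jobs I i)) \<le> real (card (setup_positions i))"
      using machines_le_setups[of "class_jobs I i" i] by simp
    then have "real (P_sum I (class_jobs I i)) \<le> real (card (setup_positions i)) * (T - real (stime I i))"
      using P_sum_le_machines[of "class_jobs I i" i] pos
      by (meson mult_right_mono order_refl order_trans less_imp_le)
    then have "of_int (m_cls I T i) * (T - real (stime I i))
        < real (card (setup_positions i)) * (T - real (stime I i))"
      using True by (simp add: x_cls_def)
    then have "of_int (m_cls I T i) < real (card (setup_positions i))"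
      using pos by simp
    then have "m_cls I T i < int (card (setup_positions i))" by linarith
    then have "m_cls I T i + 1 \<le> int (card (setup_positions i))" by linarith
    then have "of_int (m_cls I T i + 1) \<le> real_of_int (int (card (setup_positions i)))"
      by (simp only: of_int_le_iff)
    then show ?thesis using True by simp
  next
    case False
    then show ?thesis using m by simp
  qed
qed

lemma L_nonp_le_area: "L_nonp I T \<le> real (machines I) * T"
proof -
  have "L_nonp I T = real (P_sum I {..<njobs I}) + (\<Sum>i<nclasses I.
      (of_int (m_cls I T i) + (if x_cls I T i > 0 then 1 else 0)) * real (stime I i))"
    by (rule L_nonp_eq)
  also have "\<dots> \<le> real (P_sum I {..<njobs I}) +
      (\<Sum>i<nclasses I. real (card (setup_positions i)) * real (stime I i))"
    using setups_lower_bound by (intro add_left_mono sum_mono mult_right_mono) auto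
  also have "\<dots> \<le> real (machines I) * T" by (rule total_load_le_area)
  finally show ?thesis .
qed

end

subsection \<open>An optimal schedule exists\<close>

definition floor_schedule :: "schedule \<Rightarrow> schedule" where
  "floor_schedule S = S\<lparr>job_start := (\<lambda>j. of_int \<lfloor>job_start S j\<rfloor>),
     setups := map (\<lambda>(u, i, x). (u, i, of_int \<lfloor>x\<rfloor>)) (setups S)\<rparr>"

lemma items_floor [simp]: "items I (floor_schedule S) = items I S"
  by (simp add: items_def floor_schedule_def)

lemma item_floor:
  assumes "a \<in> items I S"
  shows "item_machine (floor_schedule S) a = item_machine S a"
    "item_class I (floor_schedule S) a = item_class I S a"
    "item_start (floor_schedule S) a = of_int \<lfloor>item_start S a\<rfloor>"
    "item_length I (floor_schedule S) a = item_length I S a"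
  using assms by (auto simp: items_def floor_schedule_def case_prod_beta)

lemma floor_add_nat_le:
  fixes x y :: real
  assumes "x + real n \<le> y"
  shows "of_int \<lfloor>x\<rfloor> + real n \<le> of_int \<lfloor>y\<rfloor>"
proof -
  have "\<lfloor>x\<rfloor> + int n \<le> \<lfloor>y\<rfloor>" using assms by linarith
  then have "real_of_int (\<lfloor>x\<rfloor> + int n) \<le> of_int \<lfloor>y\<rfloor>" by (simp only: of_int_le_iff)
  then show ?thesis by simp
qed

text \<open>As lengths are integers, the order of an end and a later start survives rounding
  (\<open>floor_add_nat_le\<close>). Strictly ordered floors come from strictly ordered starts, so
  no item newly enters the window between a setup and its job.\<close>

lemma feasible_floor:
  assumes "feasible I S"
  shows "feasible I (floor_schedule S)"
proof -
  let ?F = "floor_schedule S"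
  have len: "length (setups ?F) = length (setups S)" by (simp add: floor_schedule_def)
  have job: "job_machine ?F j = job_machine S j" "job_start ?F j = of_int \<lfloor>job_start S j\<rfloor>" for j
    by (simp_all add: floor_schedule_def)
  have su: "Setup k \<in> items I S" if "k < length (setups S)" for k
    using that by (auto simp: items_def)
  have endF: "item_end I ?F a = of_int \<lfloor>item_start S a\<rfloor> + real (item_length I S a)"
    if "a \<in> items I S" for a
    by (simp add: item_end_def item_floor[OF that])
  show ?thesis
    unfolding feasible_def items_floor len job
  proof (intro conjI ballI allI impI)
    fix a assume a: "a \<in> items I S"
    then show "item_machine ?F a < machines I" "item_class I ?F a < nclasses I" "item_start ?F a \<ge> 0"
      using assms by (auto simp: item_floor[OF a] feasible_def simp del: item_floor)
  next
    fix a b assume a: "a \<in> items I S" "b \<in> items I S" "a \<noteq> b \<and> item_machine ?F a = item_machine ?F b"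
    then have "item_end I S a \<le> item_start S b \<or> item_end I S b \<le> item_start S a"
      using assms by (auto simp: item_floor[OF a(1)] item_floor[OF a(2)] feasible_def)
    then show "item_end I ?F a \<le> item_start ?F b \<or> item_end I ?F b \<le> item_start ?F a"
      unfolding endF[OF a(1)] endF[OF a(2)] item_floor(3)[OF a(1)] item_floor(3)[OF a(2)]
      using floor_add_nat_le unfolding item_end_def by blast
  next
    fix j assume "j < njobs I"
    then obtain k where k: "k < length (setups S)"
      "item_machine S (Setup k) = job_machine S j" "item_class I S (Setup k) = cls I j"
      "item_end I S (Setup k) \<le> job_start S j"
      "\<forall>b\<in>items I S. item_machine S b = job_machine S j
            \<and> item_start S (Setup k) < item_start S b \<and> item_start S b < job_start S j
            \<longrightarrow> item_class I S b = cls I j"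
      using assms unfolding feasible_def by blast
    have "\<forall>b\<in>items I S. item_machine ?F b = job_machine S j \<and> item_start ?F (Setup k) < item_start ?F b
            \<and> item_start ?F b < of_int \<lfloor>job_start S j\<rfloor> \<longrightarrow> item_class I ?F b = cls I j"
    proof (intro ballI impI)
      fix b assume b: "b \<in> items I S" and h: "item_machine ?F b = job_machine S j
        \<and> item_start ?F (Setup k) < item_start ?F b \<and> item_start ?F b < of_int \<lfloor>job_start S j\<rfloor>"
      from h have "\<lfloor>item_start S (Setup k)\<rfloor> < \<lfloor>item_start S b\<rfloor>" "\<lfloor>item_start S b\<rfloor> < \<lfloor>job_start S j\<rfloor>"
        unfolding item_floor(3)[OF b] item_floor(3)[OF su[OF k(1)]] by simp_all
      then have "item_start S (Setup k) < item_start S b" "item_start S b < job_start S j"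
        using floor_mono by (metis not_less)+
      then show "item_class I ?F b = cls I j"
        using h k(5) b unfolding item_floor(1,2)[OF b] by blast
    qed
    then show "\<exists>k<length (setups S). item_machine ?F (Setup k) = job_machine S j
      \<and> item_class I ?F (Setup k) = cls I j \<and> item_end I ?F (Setup k) \<le> of_int \<lfloor>job_start S j\<rfloor>
      \<and> (\<forall>b\<in>items I S. item_machine ?F b = job_machine S j \<and> item_start ?F (Setup k) < item_start ?F b
            \<and> item_start ?F b < of_int \<lfloor>job_start S j\<rfloor> \<longrightarrow> item_class I ?F b = cls I j)"
      using k(1-4) floor_add_nat_le[of "item_start S (Setup k)" "item_length I S (Setup k)" "job_start S j"]
      by (intro exI[of _ k]) (simp only: item_floor[OF su[OF k(1)]] endF[OF su[OF k(1)]] item_end_def simp_thms)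
  qed
qed

lemma makespan_floor:
  assumes "feasible I S" "njobs I \<ge> 1"
  shows "makespan I (floor_schedule S) \<le> makespan I S"
    and "makespan I (floor_schedule S) \<in> \<nat>"
proof -
  let ?F = "floor_schedule S"
  have "Job 0 \<in> items I S" using assms(2) by (auto simp: items_def)
  then have ne: "items I S \<noteq> {}" by auto
  have endF: "item_end I ?F a = of_int \<lfloor>item_start S a\<rfloor> + real (item_length I S a)"
    if "a \<in> items I S" for a
    by (simp add: item_end_def item_floor[OF that])
  have "item_end I ?F a \<le> makespan I S" if "a \<in> items I S" for a
  proof -
    have "item_end I ?F a \<le> item_end I S a"
      using endF[OF that] of_int_floor_le[of "item_start S a"] unfolding item_end_def by linarith
    also have "\<dots> \<le> makespan I S" unfolding makespan_def using that by (intro Max_ge) auto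
    finally show ?thesis .
  qed
  then show "makespan I ?F \<le> makespan I S"
    using ne unfolding makespan_def[of I ?F] by simp
  have "makespan I ?F \<in> item_end I ?F ` items I ?F"
    unfolding makespan_def using ne by (intro Max_in) auto
  then obtain a where a: "a \<in> items I S" "makespan I ?F = item_end I ?F a" by auto
  have "0 \<le> item_start S a" using assms(1) a by (auto simp: feasible_def)
  then have "real_of_int \<lfloor>item_start S a\<rfloor> = real (nat \<lfloor>item_start S a\<rfloor>)" by simp
  then have "makespan I ?F = real (nat \<lfloor>item_start S a\<rfloor> + item_length I S a)"
    using a endF[OF a(1)] by simp
  then show "makespan I ?F \<in> \<nat>" by (metis of_nat_in_Nats)
qed

text \<open>All jobs run on machine 0, each directly after a setup of its own.\<close>

lemma feasible_schedule_exists: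
  assumes "valid_inst I"
  shows "\<exists>S. feasible I S"
proof -
  have "\<exists>S ld tp. partial_schedule I (machines I) {..<n} S ld tp" if "n \<le> njobs I" for n
    using that
  proof (induction n)
    case 0
    have "partial_schedule I (machines I) {} \<lparr>job_machine = \<lambda>_. 0, job_start = \<lambda>_. 0, setups = []\<rparr>
        (\<lambda>_. 0) (\<lambda>_. None)"
      by (rule partial_schedule_empty) auto
    then show ?case by auto
  next
    case (Suc n)
    then obtain S ld tp where ps: "partial_schedule I (machines I) {..<n} S ld tp" by auto
    have "0 < machines I" "cls I n < nclasses I" using assms Suc.prems by (auto simp: valid_inst_def)
    from partial_schedule_add_setup[OF ps this]
    have "partial_schedule I (machines I) (insert n {..<n}) (add_job n 0
        ((ld(0 := ld 0 + real (stime I (cls I n)))) 0) (add_setup 0 (cls I n) (ld 0) S))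
        ((ld(0 := ld 0 + real (stime I (cls I n))))
          (0 := (ld(0 := ld 0 + real (stime I (cls I n)))) 0 + real (ptime I n)))
        (tp(0 := Some (cls I n)))"
      by (rule partial_schedule_add_job) auto
    then show ?case unfolding lessThan_Suc by blast
  qed
  from this[of "njobs I"] show ?thesis using partial_schedule_feasible by blast
qed

text \<open>A \<open>LEAST\<close> over the reals is meaningful only if a minimum exists. By
  rounding, every makespan is at least some attained integral makespan, and a nonempty set of
  natural numbers has a least element.\<close>

lemma OPT_nonp_attained:
  assumes "valid_inst I"
  obtains S where "feasible I S" "makespan I S = OPT_nonp I"
proof -
  have n: "njobs I \<ge> 1" using assms by (simp add: valid_inst_def)
  define Q where "Q = (\<lambda>k. \<exists>S. feasible I S \<and> makespan I S = real k)"
  have fl: "\<exists>k. Q k \<and> real k \<le> makespan I S" if "feasible I S" for S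
    using makespan_floor[OF that n] feasible_floor[OF that] unfolding Q_def by (metis Nats_cases)
  obtain S where "feasible I S" using feasible_schedule_exists[OF assms] by blast
  then have Q0: "Q (LEAST k. Q k)" using fl LeastI by metis
  have "OPT_nonp I = real (LEAST k. Q k)"
    unfolding OPT_nonp_def
  proof (rule Least_equality)
    show "\<exists>S. feasible I S \<and> makespan I S = real (LEAST k. Q k)" using Q0 by (simp add: Q_def)
    fix M assume "\<exists>S. feasible I S \<and> makespan I S = M"
    then obtain k where "Q k" "real k \<le> M" using fl by blast
    then show "real (LEAST k. Q k) \<le> M" using Least_le[of Q k] by linarith
  qed
  then show ?thesis using Q0 that unfolding Q_def by auto
qed

text \<open>An optimal schedule of makespan at most T would satisfy both the area bound and the
  machine bound.\<close>

theorem lower_bound: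
  assumes "valid_inst I" "T \<ge> T_min I"
    and "real (machines I) * T < L_nonp I T \<or> int (machines I) < m_total I T"
  shows "T < OPT_nonp I"
proof (rule ccontr)
  assume "\<not> T < OPT_nonp I"
  then obtain S where "feasible I S" "makespan I S \<le> T"
    using OPT_nonp_attained[OF assms(1)] by (metis linorder_not_less)
  then show False
    using assms(3) L_nonp_le_area[OF assms(1,2)] m_total_le_machines[OF assms(1,2)] by fastforce
qed

subsection \<open>Loop-free programs and loops\<close>

text \<open>Loop bodies contain no loops themselves. On them \<open>run\<close> gives the final
  state as a function that simplification evaluates, and \<open>cost\<close> is a constant bound on
  the steps; only the three loops of the program need \<open>exec\<close> and a measure.\<close>

primrec loop_free :: "com \<Rightarrow> bool" where
  "loop_free Skip \<longleftrightarrow> True"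
| "loop_free (IAssign x e) \<longleftrightarrow> True"
| "loop_free (IStore a d e) \<longleftrightarrow> True"
| "loop_free (VAssign x e) \<longleftrightarrow> True"
| "loop_free (VStore a d e) \<longleftrightarrow> True"
| "loop_free (Seq p q) \<longleftrightarrow> loop_free p \<and> loop_free q"
| "loop_free (Cond b p q) \<longleftrightarrow> loop_free p \<and> loop_free q"
| "loop_free (While b p) \<longleftrightarrow> False"

text \<open>The value on loops is irrelevant.\<close>

primrec run :: "com \<Rightarrow> state \<Rightarrow> state" where
  "run Skip \<sigma> = \<sigma>"
| "run (IAssign x e) \<sigma> = \<sigma>\<lparr>ivar := (ivar \<sigma>)(x := ival e \<sigma>)\<rparr>"
| "run (IStore a d e) \<sigma> = \<sigma>\<lparr>iarr := (iarr \<sigma>)(a := (iarr \<sigma> a)(ival d \<sigma> := ival e \<sigma>))\<rparr>"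
| "run (VAssign x e) \<sigma> = \<sigma>\<lparr>vvar := (vvar \<sigma>)(x := vval e \<sigma>)\<rparr>"
| "run (VStore a d e) \<sigma> = \<sigma>\<lparr>varr := (varr \<sigma>)(a := (varr \<sigma> a)(ival d \<sigma> := vval e \<sigma>))\<rparr>"
| "run (Seq p q) \<sigma> = run q (run p \<sigma>)"
| "run (Cond b p q) \<sigma> = (if bval b \<sigma> then run p \<sigma> else run q \<sigma>)"
| "run (While b p) \<sigma> = \<sigma>"

text \<open>An upper bound, not an exact count: both branches of a \<open>Cond\<close> are
  added.\<close>

primrec cost :: "com \<Rightarrow> nat" where
  "cost Skip = 1"
| "cost (IAssign x e) = 1"
| "cost (IStore a d e) = 1"
| "cost (VAssign x e) = 1"
| "cost (VStore a d e) = 1"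
| "cost (Seq p q) = cost p + cost q"
| "cost (Cond b p q) = 1 + cost p + cost q"
| "cost (While b p) = 1"

lemma exec_run:
  assumes "loop_free p"
  shows "\<exists>k\<le>cost p. exec p \<sigma> k (run p \<sigma>)"
  using assms
proof (induction p arbitrary: \<sigma>)
  case (Seq p q)
  obtain k where k: "k \<le> cost p" "exec p \<sigma> k (run p \<sigma>)" using Seq by auto
  obtain l where l: "l \<le> cost q" "exec q (run p \<sigma>) l (run q (run p \<sigma>))" using Seq by auto
  show ?case using exec.Seq[OF k(2) l(2)] k(1) l(1) by (intro exI[of _ "k + l"]) simp
next
  case (Cond b p q)
  show ?case
  proof (cases "bval b \<sigma>")
    case True
    obtain k where "k \<le> cost p" "exec p \<sigma> k (run p \<sigma>)" using Cond by auto
    then show ?thesis using True exec.CondTrue[OF True] by (intro exI[of _ "1 + k"]) simp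
  next
    case False
    obtain k where "k \<le> cost q" "exec q \<sigma> k (run q \<sigma>)" using Cond by auto
    then show ?thesis using False exec.CondFalse[OF False] by (intro exI[of _ "1 + k"]) simp
  qed
qed (auto intro!: exI[of _ 1] exec.intros simp del: One_nat_def)

text \<open>The measure d is an argument of the invariant and not a function of the state, because
  it may depend on ghost data such as the set of jobs already placed, which no register
  stores.\<close>

lemma exec_while:
  assumes lf: "loop_free p"
    and step: "\<And>\<sigma> d. Inv d \<sigma> \<Longrightarrow> bval b \<sigma> \<Longrightarrow> \<exists>d'<d. Inv d' (run p \<sigma>)"
    and "Inv (d :: nat) \<sigma>"
  shows "\<exists>k \<tau> d'. exec (While b p) \<sigma> k \<tau> \<and> k \<le> 1 + (1 + cost p) * d \<and> Inv d' \<tau> \<and> \<not> bval b \<tau>"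
  using assms(3)
proof (induction d arbitrary: \<sigma> rule: less_induct)
  case (less d)
  show ?case
  proof (cases "bval b \<sigma>")
    case False
    have "exec (While b p) \<sigma> 1 \<sigma> \<and> 1 \<le> 1 + (1 + cost p) * d \<and> Inv d \<sigma> \<and> \<not> bval b \<sigma>"
      using less.prems exec.WhileFalse[OF False] False by simp
    then show ?thesis by blast
  next
    case True
    obtain e where e: "e < d" "Inv e (run p \<sigma>)" using step[OF less.prems True] by blast
    obtain k where k: "k \<le> cost p" "exec p \<sigma> k (run p \<sigma>)" using exec_run[OF lf] by blast
    obtain l \<tau> d' where l: "exec (While b p) (run p \<sigma>) l \<tau>" "l \<le> 1 + (1 + cost p) * e"
      "Inv d' \<tau>" "\<not> bval b \<tau>"
      using less.IH[OF e] by blast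
    have "(1 + cost p) * e + (1 + cost p) \<le> (1 + cost p) * d"
      using e(1) mult_le_mono2[of "Suc e" d "1 + cost p"] by simp
    then have "1 + k + l \<le> 1 + (1 + cost p) * d" using k(1) l(2) by linarith
    then show ?thesis using exec.WhileTrue[OF True k(2) l(1)] l(3,4) by blast
  qed
qed

subsection \<open>Linked lists\<close>

text \<open>Pointers are shifted by one, so that 0 is the null pointer.\<close>

primrec chain :: "(nat \<Rightarrow> nat) \<Rightarrow> nat \<Rightarrow> nat list \<Rightarrow> bool" where
  "chain nx h [] \<longleftrightarrow> h = 0"
| "chain nx h (x # xs) \<longleftrightarrow> h = Suc x \<and> chain nx (nx x) xs"

definition linked :: "nat \<Rightarrow> (nat \<Rightarrow> nat set) \<Rightarrow> (nat \<Rightarrow> nat) \<Rightarrow> (nat \<Rightarrow> nat) \<Rightarrow> bool" where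
  "linked c X nx hp \<longleftrightarrow> (\<forall>i<c. \<exists>xs. chain nx (hp i) xs \<and> distinct xs \<and> set xs = X i)"

lemma chain_upd: "x \<notin> set xs \<Longrightarrow> chain (nx(x := y)) h xs \<longleftrightarrow> chain nx h xs"
  by (induction xs arbitrary: h) auto

text \<open>All lists share one link array, so overwriting the link of x is harmless only if x lies
  on none of them.\<close>

lemma linked_push:
  assumes "linked c X nx hp" "\<And>i. i < c \<Longrightarrow> x \<notin> X i"
  shows "linked c (X(i := insert x (X i))) (nx(x := hp i)) (hp(i := Suc x))"
  unfolding linked_def
proof (intro allI impI)
  fix l assume l: "l < c"
  then obtain xs where xs: "chain nx (hp l) xs" "distinct xs" "set xs = X l"
    using assms(1) by (auto simp: linked_def)
  have c: "chain (nx(x := hp i)) (hp l) xs" using xs assms(2)[OF l] chain_upd by simp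
  show "\<exists>xs. chain (nx(x := hp i)) ((hp(i := Suc x)) l) xs \<and> distinct xs
      \<and> set xs = (X(i := insert x (X i))) l"
  proof (cases "l = i")
    case True
    then show ?thesis using c xs assms(2)[OF l] by (intro exI[of _ "x # xs"]) auto
  next
    case False
    then show ?thesis using c xs by auto
  qed
qed

text \<open>The stale link of the removed element may stay: \<open>linked\<close> constrains links
  along the chains only.\<close>

lemma linked_pop:
  assumes "linked c X nx hp" "hp i = Suc x"
  shows "linked c (X(i := X i - {x})) nx (hp(i := nx x))"
  unfolding linked_def
proof (intro allI impI)
  fix l assume l: "l < c"
  then obtain xs where xs: "chain nx (hp l) xs" "distinct xs" "set xs = X l"
    using assms(1) by (auto simp: linked_def)
  show "\<exists>xs. chain nx ((hp(i := nx x)) l) xs \<and> distinct xs \<and> set xs = (X(i := X i - {x})) l"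
  proof (cases "l = i")
    case True
    then show ?thesis using xs assms(2) by (cases xs) auto
  qed (use xs in auto)
qed

lemma linked_null: "linked c X nx hp \<Longrightarrow> i < c \<Longrightarrow> hp i = 0 \<longleftrightarrow> X i = {}"
  unfolding linked_def by (metis Zero_not_Suc chain.simps empty_set list.exhaust list.set_intros(1) empty_iff)

lemma linked_head: "linked c X nx hp \<Longrightarrow> i < c \<Longrightarrow> hp i = Suc x \<Longrightarrow> x \<in> X i"
  unfolding linked_def by (metis Suc_inject Zero_not_Suc chain.simps list.exhaust list.set_intros(1))

lemma linked_cong:
  "linked c X nx hp \<Longrightarrow> (\<And>i. i < c \<Longrightarrow> X i = Y i) \<Longrightarrow> linked c Y nx hp"
  by (simp add: linked_def)

subsection \<open>Counting machines\<close>

text \<open>\<open>own u\<close> is the class whose setup opened machine \<open>u\<close>.\<close>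

definition owned :: "nat \<Rightarrow> (nat \<Rightarrow> nat) \<Rightarrow> nat \<Rightarrow> nat set" where
  "owned used own i = {u. u < used \<and> own u = i}"

lemma finite_owned [simp]: "finite (owned used own i)"
  by (simp add: owned_def)

lemma owned_new:
  "owned (Suc used) (own(used := i)) l =
     (if l = i then insert used (owned used own l) else owned used own l)"
  by (auto simp: owned_def less_Suc_eq)

lemma used_notin_owned [simp]: "used \<notin> owned used own i"
  by (simp add: owned_def)

section \<open>Loads and numbers of opened machines\<close>

lemma sum_upd:
  fixes f :: "nat \<Rightarrow> real"
  assumes "finite A"
  shows "(\<Sum>u\<in>A. (f(x := y)) u - s) = (\<Sum>u\<in>A. f u - s) + (if x \<in> A then y - f x else 0)"
proof -
  have "(\<Sum>u\<in>A. (f(x := y)) u - s) = (\<Sum>u\<in>A. (f u - s) + (if u = x then y - f x else 0))"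
    by (intro sum.cong) auto
  then show ?thesis using assms by (simp add: sum.distrib)
qed

lemma P_sum_insert:
  "finite A \<Longrightarrow> j \<notin> A \<Longrightarrow> P_sum I (insert j A) = P_sum I A + ptime I j"
  by (simp add: P_sum_def)

text \<open>Before the last phase an opened machine carries a single setup, so subtracting it once
  per machine leaves processing time only. The strict bound
  \<open>real (stime I (own u)) < ld u\<close> records that each opened machine has received a job;
  it makes a partly filled machine count in \<open>opened_card_le_m_cls\<close>.\<close>

definition loads :: "inst \<Rightarrow> real \<Rightarrow> nat set \<Rightarrow> nat \<Rightarrow> (nat \<Rightarrow> nat) \<Rightarrow> (nat \<Rightarrow> real) \<Rightarrow> bool" where
  "loads I T D used own ld \<longleftrightarrow> finite D
     \<and> (\<forall>i<nclasses I. (\<Sum>u\<in>owned used own i. ld u - real (stime I i))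
          \<le> real (P_sum I (D \<inter> class_jobs I i)))
     \<and> (\<forall>u<used. own u < nclasses I \<and> real (stime I (own u)) < ld u \<and> ld u \<le> 3 / 2 * T)
     \<and> (\<forall>u\<ge>used. ld u = 0)"

text \<open>\<open>Q\<close> is the set of machines that were opened for a middle job, the other machines were opened
  for a long job.\<close>

definition opened :: "inst \<Rightarrow> real \<Rightarrow> nat set \<Rightarrow> nat \<Rightarrow> (nat \<Rightarrow> nat) \<Rightarrow> nat set \<Rightarrow> (nat \<Rightarrow> real) \<Rightarrow> bool" where
  "opened I T D used own Q ld \<longleftrightarrow> Q \<subseteq> {..<used}
     \<and> (\<forall>i<nclasses I.
          (\<Sum>u\<in>owned used own i \<inter> Q. ld u - real (stime I i)) \<le> real (P_sum I (D \<inter> mid_jobs I T i))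
        \<and> card (owned used own i - Q) \<le> card (D \<inter> long_jobs I T i)
        \<and> (\<forall>u\<in>owned used own i \<inter> Q. \<forall>v\<in>owned used own i \<inter> Q. ld u < T \<and> ld v < T \<longrightarrow> u = v))"

lemma loads_new:
  assumes "loads I T D used own ld" "j \<notin> D" "j \<in> class_jobs I i" "i < nclasses I"
    and "1 \<le> ptime I j" "0 \<le> T" "real (stime I i) + real (ptime I j) \<le> T"
  shows "loads I T (insert j D) (Suc used) (own(used := i))
      (ld(used := real (stime I i) + real (ptime I j)))"
  unfolding loads_def
proof (intro conjI allI impI)
  fix l assume l: "l < nclasses I"
  have D: "finite D" using assms(1) by (simp add: loads_def)
  show "(\<Sum>u\<in>owned (Suc used) (own(used := i)) l.
      (ld(used := real (stime I i) + real (ptime I j))) u - real (stime I l))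
      \<le> real (P_sum I (insert j D \<inter> class_jobs I l))"
  proof (cases "l = i")
    case True
    then show ?thesis using assms l D
      by (simp add: owned_new sum_upd P_sum_insert loads_def del: fun_upd_apply)
  next
    case False
    then have "j \<notin> class_jobs I l" using assms(3) by (auto simp: class_jobs_def)
    then show ?thesis using False assms l D
      by (simp add: owned_new sum_upd P_sum_insert loads_def del: fun_upd_apply)
  qed
qed (use assms in \<open>auto simp: loads_def less_Suc_eq\<close>)

text \<open>The bound 3/2 T is kept because a load below T grows by at most T/2.\<close>

lemma loads_top:
  assumes "loads I T D used own ld" "j \<notin> D" "j \<in> class_jobs I i" "u \<in> owned used own i"
    and "ld u < T" "real (ptime I j) \<le> T / 2"
  shows "loads I T (insert j D) used own (ld(u := ld u + real (ptime I j)))"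
  unfolding loads_def
proof (intro conjI allI impI)
  fix l assume l: "l < nclasses I"
  have D: "finite D" using assms(1) by (simp add: loads_def)
  show "(\<Sum>v\<in>owned used own l. (ld(u := ld u + real (ptime I j))) v - real (stime I l))
      \<le> real (P_sum I (insert j D \<inter> class_jobs I l))"
  proof (cases "l = i")
    case True
    then show ?thesis using assms l D
      by (simp add: sum_upd P_sum_insert loads_def del: fun_upd_apply)
  next
    case False
    then have "j \<notin> class_jobs I l" "u \<notin> owned used own l"
      using assms(3,4) by (auto simp: class_jobs_def owned_def)
    then show ?thesis using False assms(1,2) l D
      by (simp add: sum_upd P_sum_insert loads_def del: fun_upd_apply)
  qed
next
  fix v assume "v < used"
  then show "own v < nclasses I" "real (stime I (own v)) < (ld(u := ld u + real (ptime I j))) v"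
     "(ld(u := ld u + real (ptime I j))) v \<le> 3 / 2 * T"
    using assms by (auto simp: loads_def add_strict_increasing2 less_le_trans)
qed (use assms in \<open>auto simp: loads_def owned_def\<close>)

text \<open>The new machine is paid for by its long job and stays outside \<open>Q\<close>, so the
  sums over middle machines do not change.\<close>

lemma opened_long:
  assumes "opened I T D used own Q ld" "finite D" "j \<notin> D" "j \<in> long_jobs I T i" "i < nclasses I"
  shows "opened I T (insert j D) (Suc used) (own(used := i)) Q (ld(used := x))"
proof -
  have nQ: "used \<notin> Q" using assms(1) by (auto simp: opened_def)
  have nm: "j \<notin> mid_jobs I T l" for l using assms(4) by (auto simp: mid_jobs_def long_jobs_def)
  have eq: "owned (Suc used) (own(used := i)) l \<inter> Q = owned used own l \<inter> Q" for l
    using nQ by (auto simp: owned_new)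
  have D: "insert j D \<inter> mid_jobs I T l = D \<inter> mid_jobs I T l" for l using nm by auto
  have ld: "(ld(used := x)) u = ld u" if "u \<in> Q" for u using that nQ by auto
  show ?thesis
    unfolding opened_def eq D
  proof (intro conjI allI impI)
    show "Q \<subseteq> {..<Suc used}" using assms(1) by (auto simp: opened_def)
    fix l assume l: "l < nclasses I"
    show "(\<Sum>u\<in>owned used own l \<inter> Q. (ld(used := x)) u - real (stime I l))
        \<le> real (P_sum I (D \<inter> mid_jobs I T l))"
      using assms(1) l ld by (simp add: opened_def)
    show "\<forall>u\<in>owned used own l \<inter> Q. \<forall>v\<in>owned used own l \<inter> Q.
        (ld(used := x)) u < T \<and> (ld(used := x)) v < T \<longrightarrow> u = v"
      using assms(1) l ld by (simp add: opened_def)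
    have old: "card (owned used own l - Q) \<le> card (D \<inter> long_jobs I T l)"
      using assms(1) l by (simp add: opened_def)
    show "card (owned (Suc used) (own(used := i)) l - Q) \<le> card (insert j D \<inter> long_jobs I T l)"
    proof (cases "l = i")
      case True
      have "insert j D \<inter> long_jobs I T l = insert j (D \<inter> long_jobs I T l)" using assms(4) True by auto
      moreover have "owned (Suc used) (own(used := i)) l - Q = insert used (owned used own l - Q)"
        using nQ True by (auto simp: owned_new)
      ultimately show ?thesis using old assms(2,3) by simp
    next
      case False
      then have "j \<notin> long_jobs I T l" using assms(4) by (auto simp: long_jobs_def class_jobs_def)
      then show ?thesis using old False by (simp add: owned_new)
    qed
  qed
qed

text \<open>By \<open>full\<close> the other machines of the class have reached T, so the new one is
  the only machine of the class that can be below T.\<close>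

lemma opened_mid:
  assumes "opened I T D used own Q ld" "finite D" "j \<notin> D" "j \<in> mid_jobs I T i" "i < nclasses I"
    and full: "\<And>u. u \<in> owned used own i \<Longrightarrow> T \<le> ld u"
  shows "opened I T (insert j D) (Suc used) (own(used := i)) (insert used Q)
      (ld(used := real (stime I i) + real (ptime I j)))"
proof -
  let ?ld = "ld(used := real (stime I i) + real (ptime I j))"
  have nQ: "used \<notin> Q" using assms(1) by (auto simp: opened_def)
  have nm: "j \<notin> long_jobs I T l" for l using assms(4) by (auto simp: mid_jobs_def long_jobs_def)
  have eq: "owned (Suc used) (own(used := i)) l \<inter> insert used Q =
      (if l = i then insert used (owned used own l \<inter> Q) else owned used own l \<inter> Q)" for l
    by (auto simp: owned_new)
  have eq': "owned (Suc used) (own(used := i)) l - insert used Q = owned used own l - Q" for l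
    by (auto simp: owned_new)
  have D: "insert j D \<inter> long_jobs I T l = D \<inter> long_jobs I T l" for l using nm by auto
  show ?thesis
    unfolding opened_def eq' D
  proof (intro conjI allI impI)
    show "insert used Q \<subseteq> {..<Suc used}" using assms(1) by (auto simp: opened_def)
    fix l assume l: "l < nclasses I"
    show "card (owned used own l - Q) \<le> card (D \<inter> long_jobs I T l)"
      using assms(1) l by (simp add: opened_def)
    have old: "(\<Sum>u\<in>owned used own l \<inter> Q. ld u - real (stime I l))
        \<le> real (P_sum I (D \<inter> mid_jobs I T l))"
      using assms(1) l by (simp add: opened_def)
    show "(\<Sum>u\<in>owned (Suc used) (own(used := i)) l \<inter> insert used Q. ?ld u - real (stime I l))
        \<le> real (P_sum I (insert j D \<inter> mid_jobs I T l))"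
    proof (cases "l = i")
      case True
      then show ?thesis using old assms
        by (simp add: eq sum_upd P_sum_insert del: fun_upd_apply)
    next
      case False
      then have "j \<notin> mid_jobs I T l" using assms(4) by (auto simp: mid_jobs_def class_jobs_def)
      then show ?thesis using old False assms by (simp add: eq sum_upd P_sum_insert del: fun_upd_apply)
    qed
    show "\<forall>u\<in>owned (Suc used) (own(used := i)) l \<inter> insert used Q.
        \<forall>v\<in>owned (Suc used) (own(used := i)) l \<inter> insert used Q. ?ld u < T \<and> ?ld v < T \<longrightarrow> u = v"
    proof (cases "l = i")
      case True
      then have "u = used" if "u \<in> owned (Suc used) (own(used := i)) l \<inter> insert used Q" "?ld u < T" for u
        using that full[of u] unfolding eq by (auto split: if_splits)
      then show ?thesis by blast
    next
      case False
      then show ?thesis using assms(1) l nQ unfolding eq by (auto simp: opened_def)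
    qed
  qed
qed

text \<open>The machine u may have been opened for a long job. Then the sum over \<open>Q\<close> is
  unchanged while its bound grows. Loads never decrease, so there is still at most one middle
  machine below T.\<close>

lemma opened_top:
  assumes "opened I T D used own Q ld" "finite D" "j \<notin> D" "j \<in> mid_jobs I T i"
    and u: "u \<in> owned used own i"
  shows "opened I T (insert j D) used own Q (ld(u := ld u + real (ptime I j)))"
proof -
  let ?ld = "ld(u := ld u + real (ptime I j))"
  have nm: "j \<notin> long_jobs I T l" for l using assms(4) by (auto simp: mid_jobs_def long_jobs_def)
  have D: "insert j D \<inter> long_jobs I T l = D \<inter> long_jobs I T l" for l using nm by auto
  have le: "ld v \<le> ?ld v" for v by simp
  show ?thesis
    unfolding opened_def D
  proof (intro conjI allI impI)
    show "Q \<subseteq> {..<used}" using assms(1) by (auto simp: opened_def)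
    fix l assume l: "l < nclasses I"
    show "card (owned used own l - Q) \<le> card (D \<inter> long_jobs I T l)"
      using assms(1) l by (simp add: opened_def)
    have old: "(\<Sum>u\<in>owned used own l \<inter> Q. ld u - real (stime I l))
        \<le> real (P_sum I (D \<inter> mid_jobs I T l))"
      using assms(1) l by (simp add: opened_def)
    have "u \<notin> owned used own l" "j \<notin> mid_jobs I T l" if "l \<noteq> i"
      using u that assms(4) by (auto simp: owned_def mid_jobs_def class_jobs_def)
    then show "(\<Sum>v\<in>owned used own l \<inter> Q. ?ld v - real (stime I l))
        \<le> real (P_sum I (insert j D \<inter> mid_jobs I T l))"
      using old assms by (cases "l = i") (simp_all add: sum_upd P_sum_insert del: fun_upd_apply)
    show "\<forall>u\<in>owned used own l \<inter> Q. \<forall>v\<in>owned used own l \<inter> Q. ?ld u < T \<and> ?ld v < T \<longrightarrow> u = v"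
      using assms(1) l le unfolding opened_def by (meson le_less_trans)
  qed
qed

text \<open>All middle machines of class \<open>i\<close> but at most one carry middle jobs of total length
  \<open>T - s\<^sub>i\<close> or more, and the remaining one carries some.\<close>

lemma opened_card_le_m_cls:
  assumes valid: "valid_inst I" and T: "T \<ge> T_min I" and i: "i < nclasses I"
    and opn: "opened I T D used own Q ld" and lds: "loads I T D used own ld"
  shows "int (card (owned used own i)) \<le> m_cls I T i"
proof -
  let ?s = "real (stime I i)" and ?W = "owned used own i \<inter> Q" and ?P = "real (P_sum I (mid_jobs I T i))"
  have pos: "0 < T - ?s" using stime_less_T[OF valid T i] by simp
  have "card (owned used own i) = card ?W + card (owned used own i - Q)"
    by (metis card_Un_disjoint finite_Int finite_Diff finite_owned Int_Diff_Un Int_Diff_disjoint)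
  moreover have "card (owned used own i - Q) \<le> card (long_jobs I T i)"
    using opn i card_mono[of "long_jobs I T i" "D \<inter> long_jobs I T i"]
    unfolding opened_def by fastforce
  moreover have "int (card ?W) \<le> \<lceil>?P / (T - ?s)\<rceil>"
  proof (cases "?W = {}")
    case True
    have "0 \<le> ?P / (T - ?s)" using pos by simp
    then have "0 \<le> \<lceil>?P / (T - ?s)\<rceil>" by linarith
    then show ?thesis using True by simp
  next
    case False
    have ge: "?s < ld u" if "u \<in> ?W" for u using that lds by (auto simp: loads_def owned_def)
    have "P_sum I (D \<inter> mid_jobs I T i) \<le> P_sum I (mid_jobs I T i)" by (intro P_sum_mono) auto
    then have "(\<Sum>u\<in>?W. ld u - ?s) \<le> ?P"
      using opn i unfolding opened_def by fastforce
    \<comment> \<open>Strictness matters: \<open>card ?W - 1 < q\<close> is what integrality turns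
      into \<open>card ?W \<le> \<lceil>q\<rceil>\<close>.\<close>
    moreover have "(real (card ?W) - 1) * (T - ?s) < (\<Sum>u\<in>?W. ld u - ?s)"
    proof -
      \<comment> \<open>The middle machine below T if there is one, otherwise any; its job yields
        the strict inequality.\<close>
      obtain w where w: "w \<in> ?W" "\<And>u. u \<in> ?W \<Longrightarrow> u \<noteq> w \<Longrightarrow> T \<le> ld u"
      proof (cases "\<exists>w\<in>?W. ld w < T")
        case True
        then obtain w where w: "w \<in> ?W" "ld w < T" by auto
        have "T \<le> ld u" if "u \<in> ?W" "u \<noteq> w" for u
          using opn i w that unfolding opened_def by (meson not_less)
        then show ?thesis using that w by blast
      next
        case F: False
        then show ?thesis using that False by (meson ex_in_conv not_less)
      qed
      have "(real (card ?W) - 1) * (T - ?s) = (\<Sum>u\<in>?W - {w}. T - ?s)"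
        using arg_cong[OF card_Suc_Diff1[OF _ w(1)], of real] by simp
      also have "\<dots> \<le> (\<Sum>u\<in>?W - {w}. ld u - ?s)" using w(2) by (intro sum_mono) auto
      also have "\<dots> < (\<Sum>u\<in>?W. ld u - ?s)" using w(1) ge[OF w(1)] by (simp add: sum.remove)
      finally show ?thesis .
    qed
    ultimately have "real (card ?W) - 1 < ?P / (T - ?s)" using pos by (simp add: less_divide_eq)
    then show ?thesis by linarith
  qed
  ultimately show ?thesis using m_cls_eq[OF valid T i] by linarith
qed

subsection \<open>Opening machines and placing jobs\<close>

text \<open>Registers, in addition to those of the input and output conventions. Index variables:
  4 current job, 5 current class, 6 current machine, 7 number of machines opened. Index arrays: 4 and 5
  heads and links of the lists (one per class) of machines with load below \<open>T\<close>, 6 and 7 heads and links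
  of the lists of jobs left over. Value array 4 holds the loads of the machines; value variables:
  1 load charged to the current machine, 2 setup time still to be charged for the current class.\<close>

definition put_setup :: com where
  "put_setup = Seq (IStore 2 (IVar 3) (IVar 6)) (Seq (IStore 3 (IVar 3) (IVar 5))
     (Seq (VStore 3 (IVar 3) (VArr 4 (IVar 6)))
     (Seq (VStore 4 (IVar 6) (VAdd (VArr 4 (IVar 6)) (VArr 1 (IVar 5))))
       (IAssign 3 (IAdd (IVar 3) (IConst 1))))))"

definition put_job :: com where
  "put_job = Seq (IStore 1 (IVar 4) (IVar 6)) (Seq (VStore 2 (IVar 4) (VArr 4 (IVar 6)))
     (VStore 4 (IVar 6) (VAdd (VArr 4 (IVar 6)) (VArr 0 (IVar 4)))))"

definition inputs :: "inst \<Rightarrow> real \<Rightarrow> state \<Rightarrow> bool" where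
  "inputs I T \<sigma> \<longleftrightarrow> ivar \<sigma> 1 = njobs I \<and> ivar \<sigma> 2 = nclasses I \<and> vvar \<sigma> 0 = T
     \<and> (\<forall>j<njobs I. iarr \<sigma> 0 j = cls I j \<and> varr \<sigma> 0 j = real (ptime I j))
     \<and> (\<forall>i<nclasses I. varr \<sigma> 1 i = real (stime I i))"

lemma output_put_setup:
  "output_schedule (run put_setup \<sigma>)
     = add_setup (ivar \<sigma> 6) (ivar \<sigma> 5) (varr \<sigma> 4 (ivar \<sigma> 6)) (output_schedule \<sigma>)"
  by (simp add: put_setup_def output_schedule_def add_setup_def)

lemma output_put_job:
  "output_schedule (run put_job \<sigma>)
     = add_job (ivar \<sigma> 4) (ivar \<sigma> 6) (varr \<sigma> 4 (ivar \<sigma> 6)) (output_schedule \<sigma>)"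
  by (simp add: put_job_def output_schedule_def add_job_def)

lemma put_setup_frame [simp]:
  "ivar (run put_setup \<sigma>) = (ivar \<sigma>)(3 := Suc (ivar \<sigma> 3))"
  "a \<noteq> 2 \<Longrightarrow> a \<noteq> 3 \<Longrightarrow> iarr (run put_setup \<sigma>) a = iarr \<sigma> a"
  "vvar (run put_setup \<sigma>) = vvar \<sigma>"
  "a \<noteq> 3 \<Longrightarrow> a \<noteq> 4 \<Longrightarrow> varr (run put_setup \<sigma>) a = varr \<sigma> a"
  "varr (run put_setup \<sigma>) 4
     = (varr \<sigma> 4)(ivar \<sigma> 6 := varr \<sigma> 4 (ivar \<sigma> 6) + varr \<sigma> 1 (ivar \<sigma> 5))"
  by (simp_all add: put_setup_def)

lemma put_job_frame [simp]:
  "ivar (run put_job \<sigma>) = ivar \<sigma>"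
  "a \<noteq> 1 \<Longrightarrow> iarr (run put_job \<sigma>) a = iarr \<sigma> a"
  "vvar (run put_job \<sigma>) = vvar \<sigma>"
  "a \<noteq> 2 \<Longrightarrow> a \<noteq> 4 \<Longrightarrow> varr (run put_job \<sigma>) a = varr \<sigma> a"
  "varr (run put_job \<sigma>) 4
     = (varr \<sigma> 4)(ivar \<sigma> 6 := varr \<sigma> 4 (ivar \<sigma> 6) + varr \<sigma> 0 (ivar \<sigma> 4))"
  by (simp_all add: put_job_def)

lemma loop_free_put [simp]: "loop_free put_setup" "loop_free put_job"
  by (simp_all add: put_setup_def put_job_def)

text \<open>The new machine becomes the head of the list of its class, so a subsequent
  \<open>place_top\<close> puts the current job on it.\<close>

definition open_machine :: com where
  "open_machine = Seq (IAssign 6 (IVar 7)) (Seq (IStore 5 (IVar 7) (IArr 4 (IVar 5)))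
     (Seq (IAssign 7 (IAdd (IVar 7) (IConst 1))) (Seq (IStore 4 (IVar 5) (IVar 7)) put_setup)))"

text \<open>A machine leaves its list as soon as its load reaches T. The head of a list is thus
  always a machine that can take a further job of length at most T/2.\<close>

definition place_top :: com where
  "place_top = Seq (IAssign 6 (ISub (IArr 4 (IVar 5)) (IConst 1))) (Seq put_job
     (Cond (VLess (VArr 4 (IVar 6)) (VVar 0)) Skip (IStore 4 (IVar 5) (IArr 5 (IVar 6)))))"

definition tops :: "nat \<Rightarrow> (nat \<Rightarrow> nat) \<Rightarrow> nat \<Rightarrow> nat option" where
  "tops used own = (\<lambda>u. if u < used then Some (own u) else None)"

text \<open>Machine indices are bounded by the number of machines opened so far; that this number is
  at most \<open>machines I\<close> follows only later, from the comparison with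
  \<open>m_cls\<close>.\<close>

definition open_lists :: "inst \<Rightarrow> real \<Rightarrow> nat set \<Rightarrow> (nat \<Rightarrow> nat) \<Rightarrow> state \<Rightarrow> bool" where
  "open_lists I T D own \<sigma> \<longleftrightarrow> inputs I T \<sigma>
     \<and> partial_schedule I (ivar \<sigma> 7) D (output_schedule \<sigma>) (varr \<sigma> 4) (tops (ivar \<sigma> 7) own)
     \<and> linked (nclasses I) (\<lambda>i. {u \<in> owned (ivar \<sigma> 7) own i. varr \<sigma> 4 u < T}) (iarr \<sigma> 5) (iarr \<sigma> 4)"

lemma output_schedule_cong:
  assumes "ivar \<sigma> 3 = ivar \<tau> 3" "iarr \<sigma> 1 = iarr \<tau> 1" "iarr \<sigma> 2 = iarr \<tau> 2" "iarr \<sigma> 3 = iarr \<tau> 3"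
    "varr \<sigma> 2 = varr \<tau> 2" "varr \<sigma> 3 = varr \<tau> 3"
  shows "output_schedule \<sigma> = output_schedule \<tau>"
  using assms by (simp add: output_schedule_def)

lemma open_machine_correct:
  fixes \<sigma> :: state
  defines "\<tau> \<equiv> run open_machine \<sigma>"
  assumes "open_lists I T D own \<sigma>" "ivar \<sigma> 5 = i" "i < nclasses I" "real (stime I i) < T"
    "varr \<sigma> 4 (ivar \<sigma> 7) = 0"
  shows "open_lists I T D (own(ivar \<sigma> 7 := i)) \<tau>"
    "ivar \<tau> 7 = Suc (ivar \<sigma> 7)" "ivar \<tau> 4 = ivar \<sigma> 4" "ivar \<tau> 5 = i"
    "iarr \<tau> 4 i = Suc (ivar \<sigma> 7)" "iarr \<tau> 6 = iarr \<sigma> 6" "iarr \<tau> 7 = iarr \<sigma> 7"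
    "varr \<tau> 4 = (varr \<sigma> 4)(ivar \<sigma> 7 := real (stime I i))"
proof -
  note prems = assms(2-)
  let ?u = "ivar \<sigma> 7" and ?ld = "varr \<sigma> 4"
  define \<sigma>' where "\<sigma>' = run (Seq (IAssign 6 (IVar 7)) (Seq (IStore 5 (IVar 7) (IArr 4 (IVar 5)))
     (Seq (IAssign 7 (IAdd (IVar 7) (IConst 1))) (IStore 4 (IVar 5) (IVar 7))))) \<sigma>"
  have \<tau>: "\<tau> = run put_setup \<sigma>'" by (simp add: \<tau>_def \<sigma>'_def open_machine_def)
  have \<sigma>': "ivar \<sigma>' = (ivar \<sigma>)(6 := ?u, 7 := Suc ?u)" "vvar \<sigma>' = vvar \<sigma>" "varr \<sigma>' = varr \<sigma>"
    "iarr \<sigma>' = (iarr \<sigma>)(5 := (iarr \<sigma> 5)(?u := iarr \<sigma> 4 i), 4 := (iarr \<sigma> 4)(i := Suc ?u))"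
    using prems by (simp_all add: \<sigma>'_def fun_upd_twist)
  have s: "varr \<sigma> 1 i = real (stime I i)"
    using prems by (simp add: open_lists_def inputs_def)
  show \<tau>s: "ivar \<tau> 7 = Suc (ivar \<sigma> 7)" "ivar \<tau> 4 = ivar \<sigma> 4" "ivar \<tau> 5 = i"
    "iarr \<tau> 4 i = Suc (ivar \<sigma> 7)" "iarr \<tau> 6 = iarr \<sigma> 6" "iarr \<tau> 7 = iarr \<sigma> 7"
    and ld: "varr \<tau> 4 = (varr \<sigma> 4)(ivar \<sigma> 7 := real (stime I i))"
    using prems s by (simp_all add: \<tau> \<sigma>')
  have out: "output_schedule \<tau> = add_setup ?u i (?ld ?u) (output_schedule \<sigma>)"
    using prems by (simp add: \<tau> output_put_setup \<sigma>' output_schedule_cong[of \<sigma>' \<sigma>])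
  have "partial_schedule I (Suc ?u) D (output_schedule \<sigma>) ?ld (tops ?u own)"
    using prems by (auto simp: open_lists_def intro: partial_schedule_mono)
  from partial_schedule_add_setup[OF this, of ?u i]
  have ps: "partial_schedule I (Suc ?u) D (output_schedule \<tau>) (?ld(?u := real (stime I i)))
      ((tops ?u own)(?u := Some i))"
    using prems out by simp
  have "(tops ?u own)(?u := Some i) = tops (Suc ?u) (own(?u := i))"
    by (auto simp: tops_def fun_eq_iff)
  with ps have ps: "partial_schedule I (Suc ?u) D (output_schedule \<tau>) (?ld(?u := real (stime I i)))
      (tops (Suc ?u) (own(?u := i)))" by simp
  have "linked (nclasses I) (\<lambda>i. {u \<in> owned ?u own i. ?ld u < T}) (iarr \<sigma> 5) (iarr \<sigma> 4)"
    using prems by (simp add: open_lists_def)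
  then have "linked (nclasses I)
      ((\<lambda>i. {u \<in> owned ?u own i. ?ld u < T})(i := insert ?u {u \<in> owned ?u own i. ?ld u < T}))
      ((iarr \<sigma> 5)(?u := iarr \<sigma> 4 i)) ((iarr \<sigma> 4)(i := Suc ?u))"
    by (rule linked_push) simp
  then have "linked (nclasses I)
      (\<lambda>l. {u \<in> owned (Suc ?u) (own(?u := i)) l. (?ld(?u := real (stime I i))) u < T})
      ((iarr \<sigma> 5)(?u := iarr \<sigma> 4 i)) ((iarr \<sigma> 4)(i := Suc ?u))"
    by (rule linked_cong) (use prems in \<open>auto simp: owned_new; auto simp: owned_def\<close>)
  moreover have "iarr \<tau> 5 = (iarr \<sigma> 5)(?u := iarr \<sigma> 4 i)" "iarr \<tau> 4 = (iarr \<sigma> 4)(i := Suc ?u)"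
    by (simp_all add: \<tau> \<sigma>')
  moreover have "inputs I T \<tau>"
    using prems by (simp add: open_lists_def inputs_def \<tau> \<sigma>')
  ultimately show "open_lists I T D (own(ivar \<sigma> 7 := i)) \<tau>"
    unfolding open_lists_def \<tau>s(1) ld using ps by simp
qed

lemma open_lists_head:
  assumes "open_lists I T D own \<sigma>" "i < nclasses I" "iarr \<sigma> 4 i = Suc u"
  shows "u \<in> owned (ivar \<sigma> 7) own i" "varr \<sigma> 4 u < T"
proof -
  have "u \<in> {u \<in> owned (ivar \<sigma> 7) own i. varr \<sigma> 4 u < T}"
    using assms unfolding open_lists_def by (blast dest: linked_head)
  then show "u \<in> owned (ivar \<sigma> 7) own i" "varr \<sigma> 4 u < T" by auto
qed

lemma open_lists_null:
  assumes "open_lists I T D own \<sigma>" "i < nclasses I" "iarr \<sigma> 4 i = 0" "u \<in> owned (ivar \<sigma> 7) own i"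
  shows "T \<le> varr \<sigma> 4 u"
proof -
  have "{u \<in> owned (ivar \<sigma> 7) own i. varr \<sigma> 4 u < T} = {}"
    using assms unfolding open_lists_def by (blast dest: linked_null)
  then show ?thesis using assms(4) by force
qed

lemma place_top_correct:
  fixes \<sigma> :: state
  defines "\<tau> \<equiv> run place_top \<sigma>"
  assumes ol: "open_lists I T D own \<sigma>" and i: "ivar \<sigma> 5 = i" "i < nclasses I"
    and j: "ivar \<sigma> 4 = j" "j < njobs I" "cls I j = i" "j \<notin> D" and u: "iarr \<sigma> 4 i = Suc u"
  shows "open_lists I T (insert j D) own \<tau>"
    "ivar \<tau> 7 = ivar \<sigma> 7" "ivar \<tau> 4 = j" "ivar \<tau> 5 = i"
    "iarr \<tau> 6 = iarr \<sigma> 6" "iarr \<tau> 7 = iarr \<sigma> 7"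
    "varr \<tau> 4 = (varr \<sigma> 4)(u := varr \<sigma> 4 u + real (ptime I j))"
proof -
  let ?ld = "varr \<sigma> 4" and ?ld' = "(varr \<sigma> 4)(u := varr \<sigma> 4 u + real (ptime I j))"
  define \<sigma>' where "\<sigma>' = run (IAssign 6 (ISub (IArr 4 (IVar 5)) (IConst 1))) \<sigma>"
  have \<sigma>': "ivar \<sigma>' = (ivar \<sigma>)(6 := u)" "vvar \<sigma>' = vvar \<sigma>" "varr \<sigma>' = varr \<sigma>" "iarr \<sigma>' = iarr \<sigma>"
    using i u by (simp_all add: \<sigma>'_def)
  have inp: "varr \<sigma> 0 j = real (ptime I j)" "vvar \<sigma> 0 = T"
    using ol j by (simp_all add: open_lists_def inputs_def)
  define \<rho> where "\<rho> = run put_job \<sigma>'"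
  have \<tau>: "\<tau> = (if ?ld' u < T then \<rho> else \<rho>\<lparr>iarr := (iarr \<rho>)(4 := (iarr \<sigma> 4)(i := iarr \<sigma> 5 u))\<rparr>)"
    using i j inp by (simp add: \<tau>_def place_top_def \<rho>_def \<sigma>' flip: \<sigma>'_def) (simp add: \<sigma>'_def u i)
  have \<rho>: "ivar \<rho> = (ivar \<sigma>)(6 := u)" "vvar \<rho> = vvar \<sigma>" "varr \<rho> 4 = ?ld'"
    using j inp by (simp_all add: \<rho>_def \<sigma>')
  show \<tau>s: "ivar \<tau> 7 = ivar \<sigma> 7" "ivar \<tau> 4 = j" "ivar \<tau> 5 = i"
    "iarr \<tau> 6 = iarr \<sigma> 6" "iarr \<tau> 7 = iarr \<sigma> 7" and ld: "varr \<tau> 4 = ?ld'"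
    using i j by (simp_all add: \<tau> \<rho>) (simp_all add: \<rho>_def \<sigma>')
  have "output_schedule \<tau> = output_schedule \<rho>"
    by (rule output_schedule_cong) (auto simp: \<tau>)
  also have "\<dots> = add_job j u (?ld u) (output_schedule \<sigma>)"
    using j by (simp add: \<rho>_def output_put_job \<sigma>' output_schedule_cong[of \<sigma>' \<sigma>])
  finally have out: "output_schedule \<tau> = add_job j u (?ld u) (output_schedule \<sigma>)" .
  have "tops (ivar \<sigma> 7) own u = Some (cls I j)"
    using open_lists_head[OF ol i(2) u] j by (simp add: tops_def owned_def)
  then have "partial_schedule I (ivar \<sigma> 7) (insert j D) (output_schedule \<tau>) ?ld' (tops (ivar \<sigma> 7) own)"
    unfolding out using ol j(4) by (intro partial_schedule_add_job) (auto simp: open_lists_def)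
  moreover have "inputs I T \<tau>"
    using ol by (auto simp: open_lists_def inputs_def \<tau> \<rho>) (auto simp: \<rho>_def \<sigma>')
  moreover have "linked (nclasses I) (\<lambda>l. {v \<in> owned (ivar \<sigma> 7) own l. ?ld' v < T}) (iarr \<tau> 5) (iarr \<tau> 4)"
  proof -
    have lk: "linked (nclasses I) (\<lambda>l. {v \<in> owned (ivar \<sigma> 7) own l. ?ld v < T}) (iarr \<sigma> 5) (iarr \<sigma> 4)"
      using ol by (simp add: open_lists_def)
    have hp: "u \<in> owned (ivar \<sigma> 7) own i" "?ld u < T" using open_lists_head[OF ol i(2) u] .
    have \<rho>5: "iarr \<rho> 5 = iarr \<sigma> 5" "iarr \<rho> 4 = iarr \<sigma> 4" by (simp_all add: \<rho>_def \<sigma>')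
    show ?thesis
    proof (cases "?ld' u < T")
      case True
      have "linked (nclasses I) (\<lambda>l. {v \<in> owned (ivar \<sigma> 7) own l. ?ld' v < T}) (iarr \<sigma> 5) (iarr \<sigma> 4)"
        using lk by (rule linked_cong) (use True hp in auto)
      then show ?thesis using True by (simp add: \<tau> \<rho>5)
    next
      case False
      have "linked (nclasses I) (\<lambda>l. {v \<in> owned (ivar \<sigma> 7) own l. ?ld' v < T})
          (iarr \<sigma> 5) ((iarr \<sigma> 4)(i := iarr \<sigma> 5 u))"
        using linked_pop[OF lk u] by (rule linked_cong) (use False hp in \<open>auto simp: owned_def\<close>)
      then show ?thesis using False by (simp add: \<tau> \<rho>5)
    qed
  qed
  ultimately show "open_lists I T (insert j D) own \<tau>"
    unfolding open_lists_def \<tau>s(1) ld by simp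
qed

subsection \<open>Placing the big jobs\<close>

definition big :: "inst \<Rightarrow> real \<Rightarrow> nat set" where
  "big I T = {j. j < njobs I \<and> T / 2 < real (stime I (cls I j)) + real (ptime I j)}"

definition is_big :: bexp where
  "is_big = VLess (VHalf (VVar 0)) (VAdd (VArr 1 (IVar 5)) (VArr 0 (IVar 4)))"

definition is_long :: bexp where
  "is_long = VLess (VHalf (VVar 0)) (VArr 0 (IVar 4))"

definition has_open :: bexp where
  "has_open = ILess (IConst 0) (IArr 4 (IVar 5))"

definition body_big :: com where
  "body_big = Seq (IAssign 5 (IArr 0 (IVar 4)))
     (Seq (Cond is_big
            (Seq (Cond (BAnd has_open (BNot is_long)) Skip open_machine) place_top)
            Skip)
       (IAssign 4 (IAdd (IVar 4) (IConst 1))))"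

definition more_jobs :: bexp where
  "more_jobs = ILess (IVar 4) (IVar 1)"

text \<open>The ghost data \<open>own\<close> and \<open>Q\<close> are not stored in any register.
  At most one machine is opened per job, \<open>ivar \<sigma> 7 \<le> ivar \<sigma> 4\<close>, which
  later bounds the number of full machines that the last loop skips. Register array 6 being zero
  means that the lists of jobs left over start empty.\<close>

definition inv_big :: "inst \<Rightarrow> real \<Rightarrow> state \<Rightarrow> bool" where
  "inv_big I T \<sigma> \<longleftrightarrow> (\<exists>own Q. let D = big I T \<inter> {..<ivar \<sigma> 4} in
     ivar \<sigma> 4 \<le> njobs I \<and> ivar \<sigma> 7 \<le> ivar \<sigma> 4 \<and> iarr \<sigma> 6 = (\<lambda>_. 0)
     \<and> open_lists I T D own \<sigma> \<and> loads I T D (ivar \<sigma> 7) own (varr \<sigma> 4)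
     \<and> opened I T D (ivar \<sigma> 7) own Q (varr \<sigma> 4))"

lemma open_lists_cong:
  assumes "open_lists I T D own \<sigma>" "\<And>x. x \<noteq> 4 \<Longrightarrow> x \<noteq> 5 \<Longrightarrow> ivar \<tau> x = ivar \<sigma> x"
    and "iarr \<tau> = iarr \<sigma>" "vvar \<tau> = vvar \<sigma>" "varr \<tau> = varr \<sigma>"
  shows "open_lists I T D own \<tau>"
  using assms output_schedule_cong[of \<sigma> \<tau>] by (simp add: open_lists_def inputs_def)

lemma body_big_correct:
  assumes valid: "valid_inst I" and T: "T \<ge> T_min I"
    and inv: "inv_big I T \<sigma>" and more: "bval more_jobs \<sigma>"
  shows "inv_big I T (run body_big \<sigma>)" "ivar (run body_big \<sigma>) 4 = Suc (ivar \<sigma> 4)"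
proof -
  let ?j = "ivar \<sigma> 4" and ?used = "ivar \<sigma> 7"
  let ?i = "cls I ?j" and ?D = "big I T \<inter> {..<?j}" and ?D' = "big I T \<inter> {..<Suc ?j}"
  obtain own Q where used: "?used \<le> ?j" and r6: "iarr \<sigma> 6 = (\<lambda>_. 0)"
    and ol: "open_lists I T ?D own \<sigma>" and lds: "loads I T ?D ?used own (varr \<sigma> 4)"
    and opn: "opened I T ?D ?used own Q (varr \<sigma> 4)"
    using inv by (auto simp: inv_big_def Let_def)
  have inp: "inputs I T \<sigma>" using ol by (simp add: open_lists_def)
  then have j: "?j < njobs I" using more by (simp add: more_jobs_def inputs_def)
  then have i: "?i < nclasses I" "1 \<le> ptime I ?j" using valid by (auto simp: valid_inst_def)
  have sT: "real (stime I ?i) < T" by (rule stime_less_T[OF valid T i(1)])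
  have stT: "real (stime I ?i) + real (ptime I ?j) \<le> T" by (rule T_min_bounds[OF valid T j])
  have jc: "?j \<in> class_jobs I ?i" using j by (simp add: class_jobs_def)
  have jD: "?j \<notin> ?D" by simp
  have fin: "finite ?D" by simp
  define \<sigma>1 where "\<sigma>1 = run (IAssign 5 (IArr 0 (IVar 4))) \<sigma>"
  have \<sigma>1: "ivar \<sigma>1 = (ivar \<sigma>)(5 := ?i)" "iarr \<sigma>1 = iarr \<sigma>" "vvar \<sigma>1 = vvar \<sigma>" "varr \<sigma>1 = varr \<sigma>"
    using inp j by (simp_all add: \<sigma>1_def inputs_def)
  have ol1: "open_lists I T ?D own \<sigma>1" by (rule open_lists_cong[OF ol]) (simp_all add: \<sigma>1)
  have big: "bval is_big \<sigma>1 \<longleftrightarrow> ?j \<in> big I T"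
    using inp j i by (simp add: is_big_def \<sigma>1 inputs_def big_def)
  have long: "bval is_long \<sigma>1 \<longleftrightarrow> T / 2 < real (ptime I ?j)"
    using inp j i by (simp add: is_long_def \<sigma>1 inputs_def)
  have "\<exists>\<sigma>2. run body_big \<sigma> = \<sigma>2\<lparr>ivar := (ivar \<sigma>2)(4 := Suc (ivar \<sigma>2 4))\<rparr> \<and> ivar \<sigma>2 4 = ?j
    \<and> (\<exists>own' Q'. ivar \<sigma>2 7 \<le> Suc ?j \<and> iarr \<sigma>2 6 = (\<lambda>_. 0)
         \<and> open_lists I T ?D' own' \<sigma>2 \<and> loads I T ?D' (ivar \<sigma>2 7) own' (varr \<sigma>2 4)
         \<and> opened I T ?D' (ivar \<sigma>2 7) own' Q' (varr \<sigma>2 4))"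
  proof (cases "?j \<in> big I T")
    case False
    have "?D' = ?D" using False by (auto simp: less_Suc_eq)
    moreover have "run body_big \<sigma> = \<sigma>1\<lparr>ivar := (ivar \<sigma>1)(4 := Suc (ivar \<sigma>1 4))\<rparr>"
      using False big by (simp add: body_big_def \<sigma>1_def)
    ultimately show ?thesis using ol1 lds opn used r6 \<sigma>1 by (intro exI[of _ \<sigma>1]) auto
  next
    case True
    have D': "?D' = insert ?j ?D" using True by (auto simp: less_Suc_eq)
    show ?thesis
    proof (cases "bval has_open \<sigma>1 \<and> \<not> bval is_long \<sigma>1")
      case True2: True
      define \<sigma>2 where "\<sigma>2 = run place_top \<sigma>1"
      obtain u where u: "iarr \<sigma>1 4 ?i = Suc u"
        using True2 by (auto simp: has_open_def \<sigma>1 gr0_conv_Suc)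
      note pt = place_top_correct[OF ol1 _ i(1) _ j refl jD u, folded \<sigma>2_def, simplified \<sigma>1, simplified]
      note hp = open_lists_head[OF ol1 i(1) u, unfolded \<sigma>1, simplified]
      have mid: "?j \<in> mid_jobs I T ?i"
        using True True2 long jc by (auto simp: mid_jobs_def big_def)
      have le: "real (ptime I ?j) \<le> T / 2" using mid by (simp add: mid_jobs_def)
      have "run body_big \<sigma> = \<sigma>2\<lparr>ivar := (ivar \<sigma>2)(4 := Suc (ivar \<sigma>2 4))\<rparr>"
        using True big True2 unfolding \<sigma>2_def by (simp add: body_big_def flip: \<sigma>1_def) (simp add: \<sigma>1_def)
      moreover have "loads I T ?D' ?used own (varr \<sigma>2 4)"
        unfolding D' pt(7) by (rule loads_top[OF lds jD jc hp le])
      moreover have "opened I T ?D' ?used own Q (varr \<sigma>2 4)"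
        unfolding D' pt(7) by (rule opened_top[OF opn fin jD mid hp(1)])
      ultimately show ?thesis using pt used r6 unfolding D'
        by (intro exI[of _ \<sigma>2] conjI exI[of _ own] exI[of _ Q]) auto
    next
      case False2: False
      define \<rho> where "\<rho> = run open_machine \<sigma>1"
      define \<sigma>2 where "\<sigma>2 = run place_top \<rho>"
      let ?own = "own(?used := ?i)"
      have ld0: "varr \<sigma> 4 ?used = 0" using lds by (simp add: loads_def)
      note om = open_machine_correct[OF ol1 _ i(1) sT, folded \<rho>_def, simplified \<sigma>1, simplified, OF ld0]
      note pt = place_top_correct[OF om(1) om(4) i(1) om(3) j refl jD om(5), folded \<sigma>2_def,
        unfolded om(7,8,2,6), simplified]
      have "run body_big \<sigma> = \<sigma>2\<lparr>ivar := (ivar \<sigma>2)(4 := Suc (ivar \<sigma>2 4))\<rparr>"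
        using True big False2 unfolding \<sigma>2_def \<rho>_def by (auto simp: body_big_def \<sigma>1_def)
      moreover have "loads I T ?D' (ivar \<sigma>2 7) ?own (varr \<sigma>2 4)"
        unfolding D' pt(2,7) by (rule loads_new[OF lds jD jc i _ stT]) (use sT in simp)
      moreover have "\<exists>Q'. opened I T ?D' (ivar \<sigma>2 7) ?own Q' (varr \<sigma>2 4)"
      proof (cases "bval is_long \<sigma>1")
        case True
        then have "?j \<in> long_jobs I T ?i" using long jc by (simp add: long_jobs_def)
        from opened_long[OF opn fin jD this i(1)] show ?thesis unfolding D' pt(2,7) by blast
      next
        case False
        then have mid: "?j \<in> mid_jobs I T ?i"
          using True long jc by (auto simp: mid_jobs_def big_def)
        \<comment> \<open>A job that is not long opens a machine only if the list of its class is
          empty, that is, if all machines of the class have load at least T. This is the premise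
          \<open>full\<close> of \<open>opened_mid\<close>.\<close>
        have "iarr \<sigma>1 4 ?i = 0" using False False2 by (simp add: has_open_def \<sigma>1)
        from open_lists_null[OF ol1 i(1) this] have "\<And>u. u \<in> owned ?used own ?i \<Longrightarrow> T \<le> varr \<sigma> 4 u"
          by (simp add: \<sigma>1)
        from opened_mid[OF opn fin jD mid i(1) this] show ?thesis unfolding D' pt(2,7) by blast
      qed
      moreover have "ivar \<sigma>2 7 \<le> Suc ?j" "ivar \<sigma>2 4 = ?j" "iarr \<sigma>2 6 = (\<lambda>_. 0)"
        "open_lists I T ?D' ?own \<sigma>2"
        using pt used r6 unfolding D' by auto
      ultimately show ?thesis by blast
    qed
  qed
  then obtain \<sigma>2 own' Q' where r: "run body_big \<sigma> = \<sigma>2\<lparr>ivar := (ivar \<sigma>2)(4 := Suc (ivar \<sigma>2 4))\<rparr>"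
    "ivar \<sigma>2 4 = ?j" "ivar \<sigma>2 7 \<le> Suc ?j" "iarr \<sigma>2 6 = (\<lambda>_. 0)"
    and ol2: "open_lists I T ?D' own' \<sigma>2" and l2: "loads I T ?D' (ivar \<sigma>2 7) own' (varr \<sigma>2 4)"
    and o2: "opened I T ?D' (ivar \<sigma>2 7) own' Q' (varr \<sigma>2 4)"
    by blast
  show "ivar (run body_big \<sigma>) 4 = Suc ?j" using r by simp
  have "open_lists I T ?D' own' (run body_big \<sigma>)"
    by (rule open_lists_cong[OF ol2]) (simp_all add: r)
  then show "inv_big I T (run body_big \<sigma>)"
    unfolding inv_big_def Let_def using r l2 o2 j by (intro exI[of _ own'] exI[of _ Q']) auto
qed

subsection \<open>Placing the small jobs on open machines\<close>

definition push_rest :: com where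
  "push_rest = Seq (IStore 7 (IVar 4) (IArr 6 (IVar 5))) (IStore 6 (IVar 5) (IAdd (IVar 4) (IConst 1)))"

definition body_small :: com where
  "body_small = Seq (IAssign 5 (IArr 0 (IVar 4)))
     (Seq (Cond is_big Skip (Cond has_open place_top push_rest))
       (IAssign 4 (IAdd (IVar 4) (IConst 1))))"

definition left_over :: "inst \<Rightarrow> nat set \<Rightarrow> nat \<Rightarrow> nat \<Rightarrow> nat set" where
  "left_over I D j i = {l \<in> class_jobs I i. l < j \<and> l \<notin> D}"

text \<open>No machine is opened in this phase, hence \<open>used\<close> and \<open>own\<close> are
  parameters. The last conjunct persists because loads never decrease; it is what later pays for the
  extra setup of a class with jobs left over.\<close>

definition inv_small :: "inst \<Rightarrow> real \<Rightarrow> nat \<Rightarrow> (nat \<Rightarrow> nat) \<Rightarrow> state \<Rightarrow> bool" where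
  "inv_small I T used own \<sigma> \<longleftrightarrow> ivar \<sigma> 4 \<le> njobs I \<and> ivar \<sigma> 7 = used
     \<and> (\<exists>D. big I T \<subseteq> D \<and> D \<subseteq> big I T \<union> {..<ivar \<sigma> 4}
         \<and> open_lists I T D own \<sigma> \<and> loads I T D used own (varr \<sigma> 4)
         \<and> linked (nclasses I) (left_over I D (ivar \<sigma> 4)) (iarr \<sigma> 7) (iarr \<sigma> 6)
         \<and> (\<forall>i<nclasses I. left_over I D (ivar \<sigma> 4) i \<noteq> {} \<longrightarrow>
              (\<forall>u\<in>owned used own i. T \<le> varr \<sigma> 4 u)))"

lemma body_small_correct:
  assumes valid: "valid_inst I" and T: "T \<ge> T_min I"
    and inv: "inv_small I T used own \<sigma>" and more: "bval more_jobs \<sigma>"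
  shows "inv_small I T used own (run body_small \<sigma>)" "ivar (run body_small \<sigma>) 4 = Suc (ivar \<sigma> 4)"
proof -
  let ?j = "ivar \<sigma> 4" and ?X = "\<lambda>D. left_over I D (ivar \<sigma> 4)" and ?X' = "\<lambda>D. left_over I D (Suc (ivar \<sigma> 4))"
  let ?i = "cls I ?j"
  obtain D where used: "ivar \<sigma> 7 = used" and D: "big I T \<subseteq> D" "D \<subseteq> big I T \<union> {..<?j}"
    and ol: "open_lists I T D own \<sigma>" and lds: "loads I T D used own (varr \<sigma> 4)"
    and lk: "linked (nclasses I) (?X D) (iarr \<sigma> 7) (iarr \<sigma> 6)"
    and full: "\<And>i u. i < nclasses I \<Longrightarrow> ?X D i \<noteq> {} \<Longrightarrow> u \<in> owned used own i \<Longrightarrow> T \<le> varr \<sigma> 4 u"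
    using inv unfolding inv_small_def by blast
  have inp: "inputs I T \<sigma>" using ol by (simp add: open_lists_def)
  then have j: "?j < njobs I" using more by (simp add: more_jobs_def inputs_def)
  then have i: "?i < nclasses I" "1 \<le> ptime I ?j" using valid by (auto simp: valid_inst_def)
  have jc: "?j \<in> class_jobs I ?i" using j by (simp add: class_jobs_def)
  define \<sigma>1 where "\<sigma>1 = run (IAssign 5 (IArr 0 (IVar 4))) \<sigma>"
  have \<sigma>1: "ivar \<sigma>1 = (ivar \<sigma>)(5 := ?i)" "iarr \<sigma>1 = iarr \<sigma>" "vvar \<sigma>1 = vvar \<sigma>" "varr \<sigma>1 = varr \<sigma>"
    using inp j by (simp_all add: \<sigma>1_def inputs_def)
  have ol1: "open_lists I T D own \<sigma>1" by (rule open_lists_cong[OF ol]) (simp_all add: \<sigma>1)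
  have isbig: "bval is_big \<sigma>1 \<longleftrightarrow> ?j \<in> big I T"
    using inp j i by (simp add: is_big_def \<sigma>1 inputs_def big_def)
  have "\<exists>\<sigma>2. run body_small \<sigma> = \<sigma>2\<lparr>ivar := (ivar \<sigma>2)(4 := Suc (ivar \<sigma>2 4))\<rparr> \<and> ivar \<sigma>2 4 = ?j
    \<and> ivar \<sigma>2 7 = used \<and> (\<exists>D. big I T \<subseteq> D \<and> D \<subseteq> big I T \<union> {..<Suc ?j}
         \<and> open_lists I T D own \<sigma>2 \<and> loads I T D used own (varr \<sigma>2 4)
         \<and> linked (nclasses I) (?X' D) (iarr \<sigma>2 7) (iarr \<sigma>2 6)
         \<and> (\<forall>i<nclasses I. ?X' D i \<noteq> {} \<longrightarrow> (\<forall>u\<in>owned used own i. T \<le> varr \<sigma>2 4 u)))"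
  proof (cases "?j \<in> D")
    case True
    then have jb: "?j \<in> big I T" using D by auto
    have X: "?X' D = ?X D" using True by (auto simp: left_over_def less_Suc_eq fun_eq_iff)
    have "run body_small \<sigma> = \<sigma>1\<lparr>ivar := (ivar \<sigma>1)(4 := Suc (ivar \<sigma>1 4))\<rparr>"
      using jb isbig by (simp add: body_small_def \<sigma>1_def)
    moreover have "D \<subseteq> big I T \<union> {..<Suc ?j}" using D by auto
    ultimately show ?thesis using ol1 lds lk full used D(1)
      by (intro exI[of _ \<sigma>1] conjI exI[of _ D]) (auto simp: X \<sigma>1)
  next
    case False
    then have jb: "?j \<notin> big I T" using D by auto
    then have small: "real (ptime I ?j) \<le> T / 2" using j by (simp add: big_def)
    show ?thesis
    proof (cases "bval has_open \<sigma>1")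
      case True
      define \<sigma>2 where "\<sigma>2 = run place_top \<sigma>1"
      obtain u where u: "iarr \<sigma>1 4 ?i = Suc u"
        using True by (auto simp: has_open_def \<sigma>1 gr0_conv_Suc)
      note pt = place_top_correct[OF ol1 _ i(1) _ j refl False u, folded \<sigma>2_def, simplified \<sigma>1, simplified]
      note hp = open_lists_head[OF ol1 i(1) u, unfolded \<sigma>1, simplified, unfolded used]
      have "run body_small \<sigma> = \<sigma>2\<lparr>ivar := (ivar \<sigma>2)(4 := Suc (ivar \<sigma>2 4))\<rparr>"
        using jb isbig True unfolding \<sigma>2_def by (simp add: body_small_def \<sigma>1_def)
      moreover have "loads I T (insert ?j D) used own (varr \<sigma>2 4)"
        unfolding pt(7) by (rule loads_top[OF lds False jc hp small])
      moreover have X: "?X' (insert ?j D) = ?X D"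
        by (auto simp: left_over_def less_Suc_eq fun_eq_iff)
      moreover have "T \<le> varr \<sigma>2 4 v"
        if "l < nclasses I" "?X' (insert ?j D) l \<noteq> {}" "v \<in> owned used own l" for l v
        using full[of l v] that unfolding X pt(7) by auto
      ultimately show ?thesis using pt used D lk
        by (intro exI[of _ \<sigma>2] conjI exI[of _ "insert ?j D"]) auto
    next
      case False2: False
      define \<sigma>2 where "\<sigma>2 = run push_rest \<sigma>1"
      have \<sigma>2: "ivar \<sigma>2 = ivar \<sigma>1" "vvar \<sigma>2 = vvar \<sigma>" "varr \<sigma>2 = varr \<sigma>"
        "iarr \<sigma>2 = (iarr \<sigma>)(7 := (iarr \<sigma> 7)(?j := iarr \<sigma> 6 ?i), 6 := (iarr \<sigma> 6)(?i := Suc ?j))"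
        by (simp_all add: \<sigma>2_def push_rest_def \<sigma>1)
      have "run body_small \<sigma> = \<sigma>2\<lparr>ivar := (ivar \<sigma>2)(4 := Suc (ivar \<sigma>2 4))\<rparr>"
        using jb isbig False2 unfolding \<sigma>2_def by (simp add: body_small_def \<sigma>1_def)
      moreover have "open_lists I T D own \<sigma>2"
        using ol1 output_schedule_cong[of \<sigma>2 \<sigma>1] by (simp add: open_lists_def inputs_def \<sigma>2 \<sigma>1)
      moreover have X: "?X' D l = ((?X D)(?i := insert ?j (?X D ?i))) l" for l
        using jc False by (auto simp: left_over_def less_Suc_eq class_jobs_def)
      moreover have "linked (nclasses I) (?X' D) (iarr \<sigma>2 7) (iarr \<sigma>2 6)"
      proof -
        have "linked (nclasses I) ((?X D)(?i := insert ?j (?X D ?i)))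
            ((iarr \<sigma> 7)(?j := iarr \<sigma> 6 ?i)) ((iarr \<sigma> 6)(?i := Suc ?j))"
          using lk by (rule linked_push) (simp add: left_over_def)
        then have "linked (nclasses I) (?X' D)
            ((iarr \<sigma> 7)(?j := iarr \<sigma> 6 ?i)) ((iarr \<sigma> 6)(?i := Suc ?j))"
          by (rule linked_cong) (simp add: X)
        then show ?thesis by (simp add: \<sigma>2)
      qed
      moreover have "T \<le> varr \<sigma>2 4 v"
        if "l < nclasses I" "?X' D l \<noteq> {}" "v \<in> owned used own l" for l v
      proof (cases "l = ?i")
        case True
        \<comment> \<open>The job is left over precisely because its list is empty, so all machines
          of the class are full.\<close>
        have "iarr \<sigma>1 4 ?i = 0" using False2 by (simp add: has_open_def \<sigma>1)
        from open_lists_null[OF ol1 i(1) this] show ?thesis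
          using True that(3) used by (simp add: \<sigma>1 \<sigma>2)
      next
        case False
        then show ?thesis using full[of l v] that X by (simp add: \<sigma>2)
      qed
      ultimately show ?thesis using used D lds
        by (intro exI[of _ \<sigma>2] conjI exI[of _ D]) (auto simp: \<sigma>2 \<sigma>1)
    qed
  qed
  then obtain \<sigma>2 D' where r: "run body_small \<sigma> = \<sigma>2\<lparr>ivar := (ivar \<sigma>2)(4 := Suc (ivar \<sigma>2 4))\<rparr>"
    "ivar \<sigma>2 4 = ?j" "ivar \<sigma>2 7 = used" "big I T \<subseteq> D'" "D' \<subseteq> big I T \<union> {..<Suc ?j}"
    and ol2: "open_lists I T D' own \<sigma>2" and l2: "loads I T D' used own (varr \<sigma>2 4)"
    and k2: "linked (nclasses I) (?X' D') (iarr \<sigma>2 7) (iarr \<sigma>2 6)"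
    and f2: "\<forall>i<nclasses I. ?X' D' i \<noteq> {} \<longrightarrow> (\<forall>u\<in>owned used own i. T \<le> varr \<sigma>2 4 u)"
    by blast
  show "ivar (run body_small \<sigma>) 4 = Suc ?j" using r by simp
  have "open_lists I T D' own (run body_small \<sigma>)"
    by (rule open_lists_cong[OF ol2]) (simp_all add: r)
  then show "inv_small I T used own (run body_small \<sigma>)"
    unfolding inv_small_def using r l2 k2 f2 j by (intro conjI exI[of _ D']) auto
qed

subsection \<open>The load still to be placed\<close>

text \<open>\<open>i\<close> is the current class and \<open>sc\<close> its setup time if it is still to be charged.\<close>

definition pending :: "inst \<Rightarrow> nat set \<Rightarrow> nat \<Rightarrow> real \<Rightarrow> real" where
  "pending I D i sc = (\<Sum>l\<in>{i..<nclasses I}. if class_jobs I l \<subseteq> D then 0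
     else (if l = i then sc else real (stime I l)) + real (P_sum I (class_jobs I l - D)))"

lemma pending_nonneg: "0 \<le> sc \<Longrightarrow> 0 \<le> pending I D i sc"
  unfolding pending_def by (intro sum_nonneg) auto

lemma pending_Suc:
  assumes "i < nclasses I" "class_jobs I i \<subseteq> D"
    and "Suc i < nclasses I \<Longrightarrow> sc' = real (stime I (Suc i))"
  shows "pending I D (Suc i) sc' = pending I D i sc"
proof -
  have "pending I D i sc = (\<Sum>l\<in>{Suc i..<nclasses I}. if class_jobs I l \<subseteq> D then 0
     else (if l = i then sc else real (stime I l)) + real (P_sum I (class_jobs I l - D)))"
    using assms(1,2) by (simp add: pending_def sum.atLeast_Suc_lessThan)
  also have "\<dots> = pending I D (Suc i) sc'"
    unfolding pending_def using assms(3) by (intro sum.cong) auto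
  finally show ?thesis by simp
qed

text \<open>The amount removed is exactly what \<open>charge\<close> adds to the counter, so charged
  and pending load together stay constant when a job is placed where it fits.\<close>

lemma pending_insert:
  assumes "i < nclasses I" "x \<in> class_jobs I i - D"
  shows "pending I (insert x D) i 0 = pending I D i sc - (sc + real (ptime I x))"
proof -
  let ?R = "\<lambda>D sc l. if class_jobs I l \<subseteq> D then 0
     else (if l = i then sc else real (stime I l)) + real (P_sum I (class_jobs I l - D))"
  have split: "{i..<nclasses I} = insert i {Suc i..<nclasses I}" using assms(1) by auto
  have "(\<Sum>l\<in>{Suc i..<nclasses I}. ?R (insert x D) 0 l) = (\<Sum>l\<in>{Suc i..<nclasses I}. ?R D sc l)"
  proof (rule sum.cong)
    fix l assume "l \<in> {Suc i..<nclasses I}"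
    then have "l \<noteq> i" "x \<notin> class_jobs I l" using assms(2) by (auto simp: class_jobs_def)
    then show "?R (insert x D) 0 l = ?R D sc l"
      by (simp add: subset_insert Diff_insert0)
  qed simp
  moreover have "?R (insert x D) 0 i = ?R D sc i - (sc + real (ptime I x))"
  proof -
    have "class_jobs I i - D = insert x (class_jobs I i - insert x D)" using assms(2) by auto
    then have P: "P_sum I (class_jobs I i - D) = P_sum I (class_jobs I i - insert x D) + ptime I x"
      using P_sum_insert[of "class_jobs I i - insert x D" x I]
      by (metis DiffE finite_Diff finite_class_jobs insertI1)
    \<comment> \<open>If x was the last job left over, the summand drops to 0 by the case
      distinction in \<open>pending\<close>. The other branch has the same value, since nothing
      remains and the setup time is now 0.\<close>
    have "P_sum I (class_jobs I i - insert x D) = 0" if "class_jobs I i \<subseteq> insert x D"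
    proof -
      have "class_jobs I i - insert x D = {}" using that by auto
      then show ?thesis by (simp only: P_sum_def sum.empty)
    qed
    moreover have "\<not> class_jobs I i \<subseteq> D" using assms(2) by blast
    ultimately show ?thesis using P by simp
  qed
  ultimately show ?thesis unfolding pending_def split by simp
qed

section \<open>Total load and number of opened machines\<close>

lemma loads_total_le:
  assumes used: "used \<le> m" and lds: "loads I T D used own ld"
  shows "(\<Sum>v<m. ld v) \<le> (\<Sum>i<nclasses I. real (card (owned used own i)) * real (stime I i)
      + real (P_sum I (D \<inter> class_jobs I i)))"
proof -
  have "(\<Sum>v<m. ld v) = (\<Sum>v<used. ld v)"
    using used lds by (intro sum.mono_neutral_right) (auto simp: loads_def)
  also have "\<dots> = (\<Sum>i<nclasses I. \<Sum>v\<in>{v \<in> {..<used}. own v = i}. ld v)"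
    using lds by (intro sum.group[symmetric]) (auto simp: loads_def)
  also have "\<dots> \<le> (\<Sum>i<nclasses I. real (card (owned used own i)) * real (stime I i)
      + real (P_sum I (D \<inter> class_jobs I i)))"
  proof (rule sum_mono)
    fix i assume "i \<in> {..<nclasses I}"
    then have "(\<Sum>v\<in>owned used own i. ld v - real (stime I i)) \<le> real (P_sum I (D \<inter> class_jobs I i))"
      using lds by (simp add: loads_def)
    then show "(\<Sum>v\<in>{v \<in> {..<used}. own v = i}. ld v)
        \<le> real (card (owned used own i)) * real (stime I i) + real (P_sum I (D \<inter> class_jobs I i))"
      by (simp add: sum_subtractf owned_def)
  qed
  finally show ?thesis .
qed

lemma used_le_machines:
  assumes "\<And>i. i < nclasses I \<Longrightarrow> int (card (owned used own i)) \<le> m_cls I T i"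
    and "m_total I T \<le> int (machines I)" "\<And>u. u < used \<Longrightarrow> own u < nclasses I"
  shows "used \<le> machines I"
proof -
  have "(\<Sum>i<nclasses I. \<Sum>v\<in>{v \<in> {..<used}. own v = i}. 1) = (\<Sum>v<used. 1::nat)"
    using assms(3) by (intro sum.group) auto
  then have eq: "(\<Sum>i<nclasses I. card (owned used own i)) = used" by (simp add: owned_def)
  have "int used = (\<Sum>i<nclasses I. int (card (owned used own i)))"
    using arg_cong[OF eq, of int] by simp
  also have "\<dots> \<le> m_total I T"
    unfolding m_total_def using assms(1) by (intro sum_mono) simp
  finally show ?thesis using assms(2) by simp
qed

text \<open>A class with jobs left over has filled all its machines up to \<open>T\<close>, so that it either has
  opened fewer than \<open>m\<^sub>i\<close> machines or has \<open>x\<^sub>i > 0\<close>; in both cases \<open>L\<^sub>n\<^sub>o\<^sub>n\<^sub>p\<close> accounts for one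
  more setup.\<close>

lemma total_load_le_L_nonp:
  assumes valid: "valid_inst I" and used: "used \<le> m" and lds: "loads I T D used own ld"
    and card: "\<And>i. i < nclasses I \<Longrightarrow> int (card (owned used own i)) \<le> m_cls I T i"
    and full: "\<And>i u. i < nclasses I \<Longrightarrow> \<not> class_jobs I i \<subseteq> D \<Longrightarrow> u \<in> owned used own i \<Longrightarrow> T \<le> ld u"
  shows "(\<Sum>v<m. ld v) + pending I D 0 (real (stime I 0)) \<le> L_nonp I T"
proof -
  let ?s = "\<lambda>i. real (stime I i)" and ?k = "\<lambda>i. real (card (owned used own i))"
  let ?P = "\<lambda>i. real (P_sum I (class_jobs I i))" and ?PD = "\<lambda>i. real (P_sum I (D \<inter> class_jobs I i))"
  let ?r = "\<lambda>i. if class_jobs I i \<subseteq> D then 0 else ?s i + real (P_sum I (class_jobs I i - D))"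
  have "pending I D 0 (?s 0) = (\<Sum>i<nclasses I. ?r i)"
    unfolding pending_def by (intro sum.cong) auto
  then have "(\<Sum>v<m. ld v) + pending I D 0 (?s 0) \<le> (\<Sum>i<nclasses I. ?k i * ?s i + ?PD i + ?r i)"
    using loads_total_le[OF used lds] by (simp add: sum.distrib)
  also have "\<dots> \<le> (\<Sum>i<nclasses I. ?P i + (of_int (m_cls I T i) + (if x_cls I T i > 0 then 1 else 0)) * ?s i)"
  proof (rule sum_mono)
    fix i assume "i \<in> {..<nclasses I}"
    then have i: "i < nclasses I" by simp
    have k: "?k i \<le> of_int (m_cls I T i)" using card[OF i] by linarith
    have P: "?P i = ?PD i + real (P_sum I (class_jobs I i - D))"
      using sum.Int_Diff[of "class_jobs I i" "ptime I" D] by (simp add: P_sum_def Int_commute)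
    show "?k i * ?s i + ?PD i + ?r i \<le>
        ?P i + (of_int (m_cls I T i) + (if x_cls I T i > 0 then 1 else 0)) * ?s i"
    proof (cases "class_jobs I i \<subseteq> D")
      case True
      then have "?r i = 0" by simp
      moreover have "?k i * ?s i \<le> of_int (m_cls I T i) * ?s i"
        using k by (intro mult_right_mono) auto
      ultimately have "?k i * ?s i + ?PD i + ?r i \<le> ?P i + of_int (m_cls I T i) * ?s i"
        using P by linarith
      also have "\<dots> \<le> ?P i + (of_int (m_cls I T i) + (if x_cls I T i > 0 then 1 else 0)) * ?s i"
        by (intro add_left_mono mult_right_mono) auto
      finally show ?thesis .
    next
      case False
      then obtain j where j: "j \<in> class_jobs I i - D" by auto
      then have "1 \<le> ptime I j" using valid by (auto simp: class_jobs_def valid_inst_def)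
      also have "ptime I j \<le> P_sum I (class_jobs I i - D)"
        unfolding P_sum_def using j by (intro member_le_sum) auto
      \<comment> \<open>A job left over has positive length; this makes \<open>lt\<close> strict, as
        needed for \<open>x_cls\<close> to be positive.\<close>
      finally have pos: "?PD i < ?P i" using P by simp
      have "?k i * (T - ?s i) \<le> (\<Sum>u\<in>owned used own i. ld u - ?s i)"
        using sum_mono[of "owned used own i" "\<lambda>_. T - ?s i" "\<lambda>u. ld u - ?s i"] full[OF i False] by simp
      also have "\<dots> \<le> ?PD i" using lds i by (simp add: loads_def)
      finally have lt: "?k i * (T - ?s i) < ?P i" using pos by linarith
      have "?k i + 1 \<le> of_int (m_cls I T i) + (if x_cls I T i > 0 then 1 else 0)"
      proof (cases "int (card (owned used own i)) = m_cls I T i")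
        case True
        then have "x_cls I T i > 0" using lt by (simp add: x_cls_def flip: True)
        then show ?thesis using k by simp
      next
        case False
        then have "int (card (owned used own i)) + 1 \<le> m_cls I T i" using card[OF i] by linarith
        then have "?k i + 1 \<le> of_int (m_cls I T i)" by linarith
        then show ?thesis by simp
      qed
      then have "(?k i + 1) * ?s i \<le> (of_int (m_cls I T i) + (if x_cls I T i > 0 then 1 else 0)) * ?s i"
        by (intro mult_right_mono) auto
      then show ?thesis using P False by (simp add: distrib_right)
    qed
  qed
  also have "\<dots> = L_nonp I T"
    unfolding L_nonp_eq P_sum_partition_classes[OF valid] by (simp add: sum.distrib)
  finally show ?thesis .
qed

subsection \<open>Placing the jobs left over\<close>

definition place_next :: com where
  "place_next = Seq put_job (Seq (IStore 6 (IVar 5) (IArr 7 (IVar 4))) (VAssign 2 (VConst 0)))"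

definition charge :: vexp where
  "charge = VAdd (VAdd (VVar 1) (VVar 2)) (VArr 0 (IVar 4))"

text \<open>The counter restarts from the load of the next machine. If that exceeds T, the job
  remains at the head of its list and the counter forces another crossing in the next round.\<close>

definition cross :: com where
  "cross = Seq (IAssign 6 (IAdd (IVar 6) (IConst 1))) (Seq (VAssign 1 (VArr 4 (IVar 6)))
     (Cond (VLess (VVar 0) (VVar 1)) Skip (Seq put_setup place_next)))"

text \<open>Setup times are at least 1, so a positive value variable 2 tells that the setup of the
  current class is still due.\<close>

definition fit :: com where
  "fit = Seq (VAssign 1 charge)
     (Seq (Cond (VLess (VConst 0) (VVar 2)) put_setup Skip) place_next)"

text \<open>Past the last class the value read need not be a setup time, but then the loop
  ends.\<close>

definition next_class :: com where
  "next_class = Seq (IAssign 5 (IAdd (IVar 5) (IConst 1))) (VAssign 2 (VArr 1 (IVar 5)))"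

text \<open>Nested loops over classes, jobs and machines are merged into one: each round advances
  the class, places a job or skips a full machine. This keeps the body loop-free.\<close>

definition body_rest :: com where
  "body_rest = Cond (ILess (IConst 0) (IArr 6 (IVar 5)))
     (Seq (IAssign 4 (ISub (IArr 6 (IVar 5)) (IConst 1)))
       (Cond (VLess (VVar 0) charge) cross fit))
     next_class"

definition more_classes :: bexp where
  "more_classes = ILess (IVar 5) (IVar 2)"

text \<open>Machines before the current one have been charged more than \<open>T\<close> each. A job that does not
  fit is charged to the machine that it overflows, but is placed, with a setup of its own that is
  never charged, on top of the next machine with load at most \<open>T\<close>; while that machine is being
  searched, the last disjunct applies: the job is already charged but still pending.\<close>

definition rest_state ::
  "inst \<Rightarrow> real \<Rightarrow> nat \<Rightarrow> nat set \<Rightarrow> (nat \<Rightarrow> nat option) \<Rightarrow> state \<Rightarrow> bool" where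
  "rest_state I T used D tp \<sigma> \<longleftrightarrow>
     (let i = ivar \<sigma> 5; u = ivar \<sigma> 6; ld = varr \<sigma> 4; cnt = vvar \<sigma> 1; sc = vvar \<sigma> 2;
          w = real u * T + cnt + (\<Sum>v\<in>{u<..<machines I}. ld v) + pending I D i sc
      in inputs I T \<sigma> \<and> partial_schedule I (machines I) D (output_schedule \<sigma>) ld tp
       \<and> linked (nclasses I) (\<lambda>l. class_jobs I l - D) (iarr \<sigma> 7) (iarr \<sigma> 6)
       \<and> i \<le> nclasses I \<and> u < machines I \<and> big I T \<subseteq> D \<and> D \<subseteq> {..<njobs I}
       \<and> (\<forall>l<i. class_jobs I l \<subseteq> D)
       \<and> (\<forall>v. ld v \<le> 3 / 2 * T) \<and> (\<forall>v>u. used \<le> v \<longrightarrow> ld v = 0)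
       \<and> (cnt \<le> T \<longrightarrow> ld u \<le> cnt + T / 2)
       \<and> (i < nclasses I \<longrightarrow> sc = real (stime I i) \<or> sc = 0 \<and> (cnt \<le> T \<longrightarrow> tp u = Some i))
       \<and> (w \<le> real (machines I) * T
          \<or> cnt > T \<and> i < nclasses I \<and> (\<exists>x. iarr \<sigma> 6 i = Suc x
              \<and> w - (sc + real (ptime I x)) \<le> real (machines I) * T)))"

section \<open>Effect of the placement commands\<close>

lemma place_next_effect:
  assumes "inputs I T \<sigma>" "ivar \<sigma> 4 = x" "ivar \<sigma> 5 = i" "ivar \<sigma> 6 = u" "x < njobs I"
    "cls I x = i" "iarr \<sigma> 6 i = Suc x" "x \<notin> D" "tp u = Some i"
    and ps: "partial_schedule I mb D (output_schedule \<sigma>) (varr \<sigma> 4) tp"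
    and lk: "linked (nclasses I) (\<lambda>l. class_jobs I l - D) (iarr \<sigma> 7) (iarr \<sigma> 6)"
  shows "ivar (run place_next \<sigma>) = ivar \<sigma>" "vvar (run place_next \<sigma>) = (vvar \<sigma>)(2 := 0)"
    "varr (run place_next \<sigma>) 4 = (varr \<sigma> 4)(u := varr \<sigma> 4 u + real (ptime I x))"
    "inputs I T (run place_next \<sigma>)"
    "partial_schedule I mb (insert x D) (output_schedule (run place_next \<sigma>))
      (varr (run place_next \<sigma>) 4) tp"
    "linked (nclasses I) (\<lambda>l. class_jobs I l - insert x D)
      (iarr (run place_next \<sigma>) 7) (iarr (run place_next \<sigma>) 6)"
proof -
  let ?\<tau> = "run place_next \<sigma>"
  have t: "varr \<sigma> 0 x = real (ptime I x)" using assms by (simp add: inputs_def)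
  show "ivar ?\<tau> = ivar \<sigma>" "vvar ?\<tau> = (vvar \<sigma>)(2 := 0)"
    and ld: "varr ?\<tau> 4 = (varr \<sigma> 4)(u := varr \<sigma> 4 u + real (ptime I x))"
    using assms(2-7) t by (simp_all add: place_next_def)
  show "inputs I T ?\<tau>" using assms(1) by (simp add: place_next_def inputs_def)
  have "output_schedule ?\<tau> = output_schedule (run put_job \<sigma>)"
    by (rule output_schedule_cong) (simp_all add: place_next_def)
  then have out: "output_schedule ?\<tau> = add_job x u (varr \<sigma> 4 u) (output_schedule \<sigma>)"
    using assms by (simp add: output_put_job)
  show "partial_schedule I mb (insert x D) (output_schedule ?\<tau>) (varr ?\<tau> 4) tp"
    unfolding out ld using assms by (intro partial_schedule_add_job) auto
  have "linked (nclasses I) (\<lambda>l. class_jobs I l - insert x D) (iarr \<sigma> 7)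
      ((iarr \<sigma> 6)(i := iarr \<sigma> 7 x))"
    using linked_pop[OF lk assms(7)]
    by (rule linked_cong) (use assms(5,6) in \<open>auto simp: class_jobs_def\<close>)
  then show "linked (nclasses I) (\<lambda>l. class_jobs I l - insert x D) (iarr ?\<tau> 7) (iarr ?\<tau> 6)"
    using assms(2,3) by (simp add: place_next_def)
qed

lemma inputs_cong:
  assumes "inputs I T \<sigma>" "ivar \<tau> 1 = ivar \<sigma> 1" "ivar \<tau> 2 = ivar \<sigma> 2" "vvar \<tau> 0 = vvar \<sigma> 0"
    "iarr \<tau> 0 = iarr \<sigma> 0" "varr \<tau> 0 = varr \<sigma> 0" "varr \<tau> 1 = varr \<sigma> 1"
  shows "inputs I T \<tau>"
  using assms by (simp add: inputs_def)

lemma put_setup_effect: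
  assumes "inputs I T \<sigma>" "ivar \<sigma> 5 = i" "ivar \<sigma> 6 = u" "i < nclasses I" "u < mb"
    and "partial_schedule I mb D (output_schedule \<sigma>) (varr \<sigma> 4) tp"
  shows "inputs I T (run put_setup \<sigma>)"
    "varr (run put_setup \<sigma>) 4 = (varr \<sigma> 4)(u := varr \<sigma> 4 u + real (stime I i))"
    "partial_schedule I mb D (output_schedule (run put_setup \<sigma>)) (varr (run put_setup \<sigma>) 4)
      (tp(u := Some i))"
proof -
  show "inputs I T (run put_setup \<sigma>)" using assms(1) by (rule inputs_cong) simp_all
  show ld: "varr (run put_setup \<sigma>) 4 = (varr \<sigma> 4)(u := varr \<sigma> 4 u + real (stime I i))"
    using assms(1-4) by (simp add: inputs_def)
  show "partial_schedule I mb D (output_schedule (run put_setup \<sigma>)) (varr (run put_setup \<sigma>) 4)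
      (tp(u := Some i))"
    unfolding ld output_put_setup using partial_schedule_add_setup[OF assms(6,5,4)] assms(2,3) by simp
qed

lemma sum_greaterThanLessThan_first:
  "Suc u < m \<Longrightarrow> (\<Sum>v\<in>{u<..<m}. f v) = f (Suc u) + (\<Sum>v\<in>{Suc u<..<m}. f v :: real)"
  by (simp add: atLeastSucLessThan_greaterThanLessThan[symmetric] sum.atLeast_Suc_lessThan)

lemma card_insert_measure:
  assumes "x \<in> {..<n} - D" "D \<subseteq> {..<n :: nat}"
  shows "n - card (insert x D) < n - card D"
proof -
  have "card (insert x D) \<le> card {..<n}" using assms by (intro card_mono) auto
  moreover have "card (insert x D) = Suc (card D)"
    using assms finite_subset[OF assms(2)] by simp
  ultimately show ?thesis by simp
qed

text \<open>The measure counts classes, unplaced jobs and opened machines still ahead. None of the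
  three ever grows, and a machine skipped without placing a job has load above T, so it is one of
  the opened machines.\<close>

lemma body_rest_correct:
  assumes valid: "valid_inst I" and T: "T \<ge> T_min I"
    and inv: "rest_state I T used D tp \<sigma>" and more: "bval more_classes \<sigma>"
  defines "\<tau> \<equiv> run body_rest \<sigma>"
  defines "\<mu> \<equiv> \<lambda>D \<sigma>. (nclasses I - ivar \<sigma> 5) + (njobs I - card D) + (used - ivar \<sigma> 6)"
  shows "\<exists>D' tp'. rest_state I T used D' tp' \<tau> \<and> \<mu> D' \<tau> < \<mu> D \<sigma>"
proof -
  define i u ld cnt sc m where "i = ivar \<sigma> 5" and "u = ivar \<sigma> 6" and "ld = varr \<sigma> 4"
    and "cnt = vvar \<sigma> 1" and "sc = vvar \<sigma> 2" and "m = machines I"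
  note defs = i_def u_def ld_def cnt_def sc_def m_def
  note folds = i_def u_def ld_def cnt_def[simplified] sc_def m_def
  define w where "w = real u * T + cnt + (\<Sum>v\<in>{u<..<m}. ld v) + pending I D i sc"
  have inp: "inputs I T \<sigma>"
    and ps: "partial_schedule I m D (output_schedule \<sigma>) ld tp"
    and lk: "linked (nclasses I) (\<lambda>l. class_jobs I l - D) (iarr \<sigma> 7) (iarr \<sigma> 6)"
    and u: "u < m" and D: "big I T \<subseteq> D" "D \<subseteq> {..<njobs I}"
    and cover: "\<And>l. l < i \<Longrightarrow> class_jobs I l \<subseteq> D"
    and ld: "\<And>v. ld v \<le> 3 / 2 * T" "\<And>v. u < v \<Longrightarrow> used \<le> v \<Longrightarrow> ld v = 0"
      "cnt \<le> T \<Longrightarrow> ld u \<le> cnt + T / 2"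
    and sc': "i < nclasses I \<Longrightarrow> sc = real (stime I i) \<or> sc = 0 \<and> (cnt \<le> T \<longrightarrow> tp u = Some i)"
    and w: "w \<le> real m * T \<or> cnt > T \<and> i < nclasses I \<and> (\<exists>x. iarr \<sigma> 6 i = Suc x
              \<and> w - (sc + real (ptime I x)) \<le> real m * T)"
    using inv unfolding rest_state_def Let_def w_def defs by blast+
  have i: "i < nclasses I" using more inp by (simp add: more_classes_def inputs_def i_def)
  note sc = sc'[OF i]
  have s1: "1 \<le> stime I i" using valid i by (simp add: valid_inst_def)
  have sc0: "0 \<le> sc" using sc by auto
  have T0: "0 < T" using stime_less_T[OF valid T i] by linarith
  have ldpos: "0 \<le> ld v" for v using partial_scheduleD(6)[OF ps] .
  show ?thesis
  proof (cases "iarr \<sigma> 6 i")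
    case 0
    have Ci: "class_jobs I i \<subseteq> D" using linked_null[OF lk i] 0 by auto
    have \<tau>: "\<tau> = \<sigma>\<lparr>ivar := (ivar \<sigma>)(5 := Suc i), vvar := (vvar \<sigma>)(2 := varr \<sigma> 1 (Suc i))\<rparr>"
      using 0 by (simp add: \<tau>_def body_rest_def next_class_def i_def)
    have ss: "Suc i < nclasses I \<Longrightarrow> varr \<sigma> 1 (Suc i) = real (stime I (Suc i))"
      using inp by (simp add: inputs_def)
    have "pending I D (Suc i) (varr \<sigma> 1 (Suc i)) = pending I D i sc"
      by (rule pending_Suc[OF i Ci ss])
    \<comment> \<open>The exceptional disjunct requires a job at the head of the list, which is
      empty here.\<close>
    moreover have "w \<le> real m * T" using w 0 by auto
    moreover have "inputs I T \<tau>" using inp by (rule inputs_cong) (simp_all add: \<tau>)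
    moreover have "output_schedule \<tau> = output_schedule \<sigma>"
      by (rule output_schedule_cong) (simp_all add: \<tau>)
    moreover have "class_jobs I l \<subseteq> D" if "l < Suc i" for l
      using cover Ci that by (cases "l = i") auto
    ultimately have "rest_state I T used D tp \<tau>"
      using ps lk i u D ld ss unfolding rest_state_def Let_def w_def
      by (simp add: \<tau> flip: folds)
    moreover have "\<mu> D \<tau> < \<mu> D \<sigma>" using i by (simp add: \<mu>_def \<tau> flip: i_def)
    ultimately show ?thesis by blast
  next
    case (Suc x)
    have "x \<in> class_jobs I i - D" by (rule linked_head[OF lk i Suc])
    then have x: "x < njobs I" "cls I x = i" "x \<notin> D" "x \<in> class_jobs I i - D"
      by (auto simp: class_jobs_def)
    have tx: "varr \<sigma> 0 x = real (ptime I x)" "vvar \<sigma> 0 = T"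
      using inp x by (simp_all add: inputs_def)
    have t1: "1 \<le> ptime I x" using valid x by (simp add: valid_inst_def)
    have small: "real (stime I i) + real (ptime I x) \<le> T / 2" using D(1) x by (auto simp: big_def)
    define b where "b = sc + real (ptime I x)"
    have pend: "pending I (insert x D) i 0 = pending I D i sc - b"
      unfolding b_def by (rule pending_insert[OF i x(4)])
    have pend0: "0 \<le> pending I D i sc - b" using pending_nonneg[of 0 I "insert x D" i] pend by simp
    define \<sigma>1 where "\<sigma>1 = run (IAssign 4 (ISub (IArr 6 (IVar 5)) (IConst 1))) \<sigma>"
    have \<sigma>1: "ivar \<sigma>1 = (ivar \<sigma>)(4 := x)" "iarr \<sigma>1 = iarr \<sigma>" "vvar \<sigma>1 = vvar \<sigma>" "varr \<sigma>1 = varr \<sigma>"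
      using Suc by (simp_all add: \<sigma>1_def flip: i_def)
    have chg: "vval charge \<sigma>1 = cnt + b"
      by (simp add: charge_def \<sigma>1 tx b_def flip: folds)
    have \<tau>: "\<tau> = run (if T < cnt + b then cross else fit) \<sigma>1"
      using Suc chg tx by (simp add: \<tau>_def body_rest_def \<sigma>1 flip: \<sigma>1_def i_def)
        (simp add: \<sigma>1_def flip: i_def)
    have D': "insert x D \<subseteq> {..<njobs I}" "big I T \<subseteq> insert x D"
      "\<And>l. l < i \<Longrightarrow> class_jobs I l \<subseteq> insert x D"
      using D x cover by auto
    have meas: "njobs I - card (insert x D) < njobs I - card D"
      using card_insert_measure[of x "njobs I" D] D(2) x by auto
    show ?thesis
    proof (cases "T < cnt + b")
      case True
      define u' cnt' where "u' = Suc u" and "cnt' = ld u'"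
      define \<sigma>2 where "\<sigma>2 = \<sigma>1\<lparr>ivar := (ivar \<sigma>1)(6 := u'), vvar := (vvar \<sigma>1)(1 := cnt')\<rparr>"
      have \<sigma>2: "ivar \<sigma>2 = (ivar \<sigma>)(4 := x, 6 := u')" "iarr \<sigma>2 = iarr \<sigma>"
        "vvar \<sigma>2 = (vvar \<sigma>)(1 := cnt')" "varr \<sigma>2 = varr \<sigma>"
        by (simp_all add: \<sigma>2_def \<sigma>1)
      have \<tau>2: "\<tau> = (if T < cnt' then \<sigma>2 else run place_next (run put_setup \<sigma>2))"
        using True tx by (simp add: \<tau> cross_def \<sigma>2_def \<sigma>1 u'_def cnt'_def u_def ld_def)
      have out2: "output_schedule \<sigma>2 = output_schedule \<sigma>"
        by (rule output_schedule_cong) (simp_all add: \<sigma>2)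
      have inp2: "inputs I T \<sigma>2" using inp by (rule inputs_cong) (simp_all add: \<sigma>2)
      \<comment> \<open>The machine that is closed has been charged more than T: either
        \<open>cnt + b\<close> exceeds T now, or the job was charged before and \<open>cnt\<close>
        alone does. Counting only T for it makes the inequality strict.\<close>
      have budget: "real u' * T + (\<Sum>v\<in>{u<..<m}. ld v) + (pending I D i sc - b) < real m * T"
      proof -
        have u': "real u' * T = real u * T + T" by (simp add: u'_def algebra_simps)
        from w show ?thesis
        proof
          assume "w \<le> real m * T"
          then show ?thesis using True u' unfolding w_def by linarith
        next
          assume "cnt > T \<and> i < nclasses I \<and> (\<exists>x. iarr \<sigma> 6 i = Suc x
              \<and> w - (sc + real (ptime I x)) \<le> real m * T)"
          then have "cnt > T" "w - b \<le> real m * T" using Suc by (auto simp: b_def)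
          then show ?thesis using u' unfolding w_def by linarith
        qed
      qed
      have "0 \<le> (\<Sum>v\<in>{u<..<m}. ld v)" using ldpos by (intro sum_nonneg) auto
      then have "real u' * T < real m * T" using budget pend0 by linarith
      \<comment> \<open>The program does not compare machine indices with the number of machines;
        the load budget alone guarantees that a next machine exists.\<close>
      then have u'm: "u' < m" using T0 by simp
      have split: "(\<Sum>v\<in>{u<..<m}. ld v) = cnt' + (\<Sum>v\<in>{u'<..<m}. ld v)"
        using u'm unfolding u'_def cnt'_def by (rule sum_greaterThanLessThan_first)
      show ?thesis
      proof (cases "T < cnt'")
        case full: True
        then have "\<tau> = \<sigma>2" using \<tau>2 by simp
        moreover have "rest_state I T used D tp \<sigma>2"
        proof -
          have "ld v = 0" if "u' < v" "used \<le> v" for v using ld(2)[of v] that by (simp add: u'_def)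
          moreover have "real u' * T + cnt' + (\<Sum>v\<in>{u'<..<m}. ld v) + pending I D i sc
              - (sc + real (ptime I x)) \<le> real m * T"
            using budget split unfolding b_def by linarith
          ultimately show ?thesis
            using inp2 ps lk i u'm D cover ld(1) sc full Suc
            unfolding rest_state_def Let_def by (simp add: \<sigma>2 out2 flip: folds) blast
        qed
        moreover have "u' < used"
        proof (rule ccontr)
          assume "\<not> u' < used"
          then have "cnt' = 0" using ld(2)[of u'] by (simp add: cnt'_def u'_def)
          then show False using full T0 by simp
        qed
        then have "\<mu> D \<sigma>2 < \<mu> D \<sigma>" by (simp add: \<mu>_def \<sigma>2 u'_def flip: u_def)
        ultimately show ?thesis by metis
      next
        case False
        define \<sigma>3 where "\<sigma>3 = run put_setup \<sigma>2"
        have i2: "ivar \<sigma>2 5 = i" "ivar \<sigma>2 6 = u'" by (simp_all add: \<sigma>2 flip: folds)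
        have ps2: "partial_schedule I m D (output_schedule \<sigma>2) (varr \<sigma>2 4) tp"
          using ps by (simp add: out2 \<sigma>2 ld_def)
        note su = put_setup_effect[OF inp2 i2 i u'm ps2, folded \<sigma>3_def]
        have \<sigma>3: "ivar \<sigma>3 4 = x" "ivar \<sigma>3 5 = i" "ivar \<sigma>3 6 = u'" "iarr \<sigma>3 6 = iarr \<sigma> 6"
          "iarr \<sigma>3 7 = iarr \<sigma> 7" "vvar \<sigma>3 = (vvar \<sigma>)(1 := cnt')"
          by (simp_all add: \<sigma>3_def \<sigma>2 flip: folds)
        note pn = place_next_effect[OF su(1) \<sigma>3(1-3) x(1,2) _ x(3) _ su(3), unfolded \<sigma>3, OF Suc _ lk]
        have \<tau>3: "\<tau> = run place_next \<sigma>3" using False \<tau>2 by (simp add: \<sigma>3_def)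
        have lds: "varr \<tau> 4 = ld(u' := cnt' + real (stime I i) + real (ptime I x))"
          using pn(3) su(2) by (simp add: \<tau>3 \<sigma>2 cnt'_def flip: ld_def)
        have iv: "ivar \<tau> 5 = i" "ivar \<tau> 6 = u'" "vvar \<tau> 1 = cnt'" "vvar \<tau> 2 = 0"
          using pn(1,2) \<sigma>3 by (simp_all add: \<tau>3)
        \<comment> \<open>The uncharged setup and job are together at most T/2 by
          \<open>small\<close>, and \<open>cnt'\<close> is at most T. This is the whole gap between
          the load and the charge of the new machine.\<close>
        have le: "cnt' + real (stime I i) + real (ptime I x) \<le> cnt' + T / 2"
          "cnt' + real (stime I i) + real (ptime I x) \<le> 3 / 2 * T"
          using small False by linarith+
        have "rest_state I T used (insert x D) (tp(u' := Some i)) \<tau>"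
        proof -
          have "(\<Sum>v\<in>{u'<..<m}. (varr \<tau> 4) v) = (\<Sum>v\<in>{u'<..<m}. ld v)"
            unfolding lds by (intro sum.cong) auto
          then have "real u' * T + cnt' + (\<Sum>v\<in>{u'<..<m}. (varr \<tau> 4) v)
              + pending I (insert x D) i 0 \<le> real m * T"
            using budget split pend by linarith
          moreover have "ld v = 0" if "u' < v" "used \<le> v" for v
            using ld(2)[of v] that by (simp add: u'_def)
          moreover have "inputs I T \<tau>" 
            "partial_schedule I m (insert x D) (output_schedule \<tau>) (varr \<tau> 4) (tp(u' := Some i))"
            "linked (nclasses I) (\<lambda>l. class_jobs I l - insert x D) (iarr \<tau> 7) (iarr \<tau> 6)"
            using pn(4-6) by (simp_all add: \<tau>3)
          moreover have "(varr \<tau> 4) v \<le> 3 / 2 * T" for v unfolding lds using ld(1) le(2) by simp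
          moreover have "(varr \<tau> 4) u' \<le> cnt' + T / 2" unfolding lds using le(1) by simp
          moreover have "(varr \<tau> 4) v = 0" if "u' < v" "used \<le> v" for v
            unfolding lds using ld(2)[of v] that by (simp add: u'_def)
          ultimately show ?thesis
            using i u'm D' unfolding rest_state_def Let_def iv m_def[symmetric] by auto
        qed
        moreover have "\<mu> (insert x D) \<tau> < \<mu> D \<sigma>"
          using meas by (simp add: \<mu>_def iv u'_def flip: folds)
        ultimately show ?thesis by blast
      qed
    next
      case False
      then have fits: "cnt + b \<le> T" by simp
      have b0: "0 < b" using sc0 t1 by (simp add: b_def)
      then have cT: "cnt \<le> T" using fits by simp
      have w1: "w \<le> real m * T" using w cT by auto
      define \<sigma>2 where "\<sigma>2 = run (VAssign 1 charge) \<sigma>1"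
      have \<sigma>2: "ivar \<sigma>2 = (ivar \<sigma>)(4 := x)" "iarr \<sigma>2 = iarr \<sigma>"
        "vvar \<sigma>2 = (vvar \<sigma>)(1 := cnt + b)" "varr \<sigma>2 = varr \<sigma>"
        using chg by (simp_all add: \<sigma>2_def \<sigma>1)
      have out2: "output_schedule \<sigma>2 = output_schedule \<sigma>"
        by (rule output_schedule_cong) (simp_all add: \<sigma>2)
      have inp2: "inputs I T \<sigma>2" using inp by (rule inputs_cong) (simp_all add: \<sigma>2)
      have i2: "ivar \<sigma>2 5 = i" "ivar \<sigma>2 6 = u" by (simp_all add: \<sigma>2 flip: folds)
      have ps2: "partial_schedule I m D (output_schedule \<sigma>2) (varr \<sigma>2 4) tp"
        using ps by (simp add: out2 \<sigma>2 ld_def)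
      define \<sigma>3 where "\<sigma>3 = (if 0 < sc then run put_setup \<sigma>2 else \<sigma>2)"
      have \<tau>3: "\<tau> = run place_next \<sigma>3"
        using False by (simp add: \<tau> fit_def \<sigma>3_def \<sigma>2 flip: \<sigma>2_def sc_def) (simp add: \<sigma>2_def \<sigma>1 flip: sc_def)
      have "inputs I T \<sigma>3 \<and> varr \<sigma>3 4 = ld(u := ld u + sc)
          \<and> (\<exists>tp'. tp' u = Some i \<and> partial_schedule I m D (output_schedule \<sigma>3) (varr \<sigma>3 4) tp')"
      proof (cases "0 < sc")
        case True
        then have "sc = real (stime I i)" using sc by auto
        then show ?thesis
          using put_setup_effect[OF inp2 i2 i u ps2] True
          by (auto simp: \<sigma>3_def \<sigma>2 ld_def[symmetric] intro!: exI[of _ "tp(u := Some i)"])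
      next
        case False
        \<comment> \<open>A setup time cannot be 0, so the setup of class i has been charged
          already, and since \<open>cnt \<le> T\<close> class i is on top of the current
          machine.\<close>
        then have "sc = 0" "tp u = Some i" using sc s1 cT by auto
        then show ?thesis using inp2 ps2 by (auto simp: \<sigma>3_def \<sigma>2 ld_def)
      qed
      then obtain tp' where inp3: "inputs I T \<sigma>3" and ld3: "varr \<sigma>3 4 = ld(u := ld u + sc)"
        and tp': "tp' u = Some i" "partial_schedule I m D (output_schedule \<sigma>3) (varr \<sigma>3 4) tp'"
        by blast
      have \<sigma>3: "ivar \<sigma>3 4 = x" "ivar \<sigma>3 5 = i" "ivar \<sigma>3 6 = u" "iarr \<sigma>3 6 = iarr \<sigma> 6"
        "iarr \<sigma>3 7 = iarr \<sigma> 7" "vvar \<sigma>3 = (vvar \<sigma>)(1 := cnt + b)"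
        by (simp_all add: \<sigma>3_def \<sigma>2 flip: folds)
      note pn = place_next_effect[OF inp3 \<sigma>3(1-3) x(1,2) _ x(3) tp', unfolded \<sigma>3, OF Suc lk]
      have lds: "varr \<tau> 4 = ld(u := ld u + b)"
        using pn(3) ld3 by (simp add: \<tau>3 b_def add.assoc)
      have iv: "ivar \<tau> 5 = i" "ivar \<tau> 6 = u" "vvar \<tau> 1 = cnt + b" "vvar \<tau> 2 = 0"
        using pn(1,2) \<sigma>3 by (simp_all add: \<tau>3)
      \<comment> \<open>The load exceeds the charge by at most T/2, and the charge stays at most
        T.\<close>
      have le: "ld u + b \<le> cnt + b + T / 2" "ld u + b \<le> 3 / 2 * T" using ld(3)[OF cT] fits by linarith+
      have "rest_state I T used (insert x D) tp' \<tau>"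
      proof -
        have "(\<Sum>v\<in>{u<..<m}. (varr \<tau> 4) v) = (\<Sum>v\<in>{u<..<m}. ld v)"
          unfolding lds by (intro sum.cong) auto
        then have "real u * T + (cnt + b) + (\<Sum>v\<in>{u<..<m}. (varr \<tau> 4) v)
            + pending I (insert x D) i 0 \<le> real m * T"
          using w1 pend unfolding w_def by linarith
        moreover have "inputs I T \<tau>" 
          "partial_schedule I m (insert x D) (output_schedule \<tau>) (varr \<tau> 4) tp'"
          "linked (nclasses I) (\<lambda>l. class_jobs I l - insert x D) (iarr \<tau> 7) (iarr \<tau> 6)"
          using pn(4-6) by (simp_all add: \<tau>3)
        moreover have "(varr \<tau> 4) v \<le> 3 / 2 * T" for v unfolding lds using ld(1) le(2) by simp
        moreover have "(varr \<tau> 4) u \<le> cnt + b + T / 2" unfolding lds using le(1) by simp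
        moreover have "(varr \<tau> 4) v = 0" if "u < v" "used \<le> v" for v
          unfolding lds using ld(2)[of v] that by simp
        ultimately show ?thesis
          using i u D' tp'(1) unfolding rest_state_def Let_def iv m_def[symmetric] by auto
      qed
      moreover have "\<mu> (insert x D) \<tau> < \<mu> D \<sigma>"
        using meas by (simp add: \<mu>_def iv flip: folds)
      ultimately show ?thesis by blast
    qed
  qed
qed

subsection \<open>The algorithm\<close>

text \<open>Loads from the earlier phases count as charges, so the counter starts with the load of
  machine 0.\<close>

definition init_rest :: com where
  "init_rest = Seq (IAssign 5 (IConst 0)) (Seq (IAssign 6 (IConst 0))
     (Seq (VAssign 1 (VArr 4 (IConst 0))) (VAssign 2 (VArr 1 (IConst 0)))))"

definition schedule_program :: com where
  "schedule_program = Seq (While more_jobs body_big) (Seq (IAssign 4 (IConst 0))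
     (Seq (While more_jobs body_small) (Seq init_rest (While more_classes body_rest))))"

lemma loop_free_bodies: "loop_free body_big" "loop_free body_small" "loop_free body_rest"
  by (simp_all add: body_big_def body_small_def body_rest_def open_machine_def place_top_def
      push_rest_def cross_def fit_def next_class_def place_next_def)

lemma inv_big_input:
  assumes "valid_inst I"
  shows "inv_big I T (input_state I T)"
proof -
  have "inputs I T (input_state I T)"
    by (simp add: inputs_def input_state_def)
  moreover have "setups (output_schedule (input_state I T)) = []"
    by (simp add: output_schedule_def input_state_def)
  then have "partial_schedule I (ivar (input_state I T) 7) {} (output_schedule (input_state I T))
      (varr (input_state I T) 4) (tops (ivar (input_state I T) 7) own)" for own
    by (rule partial_schedule_empty) (simp_all add: input_state_def tops_def)
  moreover have "linked (nclasses I) (\<lambda>i. {u \<in> owned 0 own i. varr (input_state I T) 4 u < T})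
      (iarr (input_state I T) 5) (iarr (input_state I T) 4)" for own
    by (auto simp: linked_def owned_def input_state_def intro!: exI[of _ "[]"])
  ultimately have "open_lists I T {} own (input_state I T)" for own
    by (simp add: open_lists_def) (simp add: input_state_def)
  moreover have "loads I T {} 0 own (varr (input_state I T) 4)" for own
    by (simp add: loads_def owned_def input_state_def)
  moreover have "opened I T {} 0 own {} (varr (input_state I T) 4)" for own
    by (simp add: opened_def owned_def)
  ultimately show ?thesis
    unfolding inv_big_def Let_def by (intro exI conjI) (simp_all add: input_state_def)
qed

lemma exec_big:
  assumes "valid_inst I" "T \<ge> T_min I"
  shows "\<exists>k \<tau>. exec (While more_jobs body_big) (input_state I T) k \<tau>
    \<and> k \<le> 1 + (1 + cost body_big) * njobs I \<and> inv_big I T \<tau> \<and> ivar \<tau> 4 = njobs I"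
proof -
  let ?Inv = "\<lambda>d \<sigma>. inv_big I T \<sigma> \<and> d = njobs I - ivar \<sigma> 4"
  have more: "ivar \<sigma> 4 < njobs I \<longleftrightarrow> bval more_jobs \<sigma>" if "inv_big I T \<sigma>" for \<sigma>
    using that by (auto simp: inv_big_def Let_def open_lists_def inputs_def more_jobs_def)
  have step: "\<exists>d'<d. ?Inv d' (run body_big \<sigma>)" if "?Inv d \<sigma>" "bval more_jobs \<sigma>" for d \<sigma>
    using body_big_correct[OF assms, of \<sigma>] more[of \<sigma>] that by simp
  have "?Inv (njobs I) (input_state I T)"
    using inv_big_input[OF assms(1)] by (simp add: input_state_def)
  from exec_while[where Inv = ?Inv, OF loop_free_bodies(1) step this]
  obtain k \<tau> where "exec (While more_jobs body_big) (input_state I T) k \<tau>"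
    "k \<le> 1 + (1 + cost body_big) * njobs I" "inv_big I T \<tau>" "\<not> bval more_jobs \<tau>"
    by blast
  moreover have "ivar \<tau> 4 \<le> njobs I" using \<open>inv_big I T \<tau>\<close> by (auto simp: inv_big_def Let_def)
  ultimately show ?thesis using more[of \<tau>] by (metis le_neq_implies_less)
qed

lemma inv_small_start:
  assumes "valid_inst I" "T \<ge> T_min I" "inv_big I T \<sigma>" "ivar \<sigma> 4 = njobs I"
  obtains used own where "used \<le> njobs I" "\<And>i. i < nclasses I \<Longrightarrow> int (card (owned used own i)) \<le> m_cls I T i"
    "inv_small I T used own (run (IAssign 4 (IConst 0)) \<sigma>)"
    "ivar (run (IAssign 4 (IConst 0)) \<sigma>) 4 = 0"
proof -
  have "big I T \<inter> {..<njobs I} = big I T" by (auto simp: big_def)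
  then obtain own Q where *: "ivar \<sigma> 7 \<le> njobs I" "iarr \<sigma> 6 = (\<lambda>_. 0)"
    "open_lists I T (big I T) own \<sigma>" "loads I T (big I T) (ivar \<sigma> 7) own (varr \<sigma> 4)"
    "opened I T (big I T) (ivar \<sigma> 7) own Q (varr \<sigma> 4)"
    using assms(3,4) by (auto simp: inv_big_def Let_def)
  let ?\<tau> = "run (IAssign 4 (IConst 0)) \<sigma>"
  have "open_lists I T (big I T) own ?\<tau>" by (rule open_lists_cong[OF *(3)]) simp_all
  moreover have "left_over I (big I T) 0 i = {}" for i by (simp add: left_over_def)
  moreover have "linked (nclasses I) (left_over I (big I T) 0) (iarr \<sigma> 7) (iarr \<sigma> 6)"
    using *(2) by (auto simp: linked_def left_over_def intro!: exI[of _ "[]"])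
  ultimately have "inv_small I T (ivar \<sigma> 7) own ?\<tau>"
    using * unfolding inv_small_def by (intro conjI exI[of _ "big I T"]) simp_all
  then show ?thesis
    using that[of "ivar \<sigma> 7" own] *(1) opened_card_le_m_cls[OF assms(1,2) _ *(5,4)] by simp
qed

lemma exec_small:
  assumes "valid_inst I" "T \<ge> T_min I" "inv_small I T used own \<sigma>" "ivar \<sigma> 4 = 0"
  shows "\<exists>k \<tau>. exec (While more_jobs body_small) \<sigma> k \<tau>
    \<and> k \<le> 1 + (1 + cost body_small) * njobs I \<and> inv_small I T used own \<tau> \<and> ivar \<tau> 4 = njobs I"
proof -
  let ?Inv = "\<lambda>d \<sigma>. inv_small I T used own \<sigma> \<and> d = njobs I - ivar \<sigma> 4"
  have more: "ivar \<sigma> 4 < njobs I \<longleftrightarrow> bval more_jobs \<sigma>" if "inv_small I T used own \<sigma>" for \<sigma>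
    using that by (auto simp: inv_small_def open_lists_def inputs_def more_jobs_def)
  have step: "\<exists>d'<d. ?Inv d' (run body_small \<sigma>)" if "?Inv d \<sigma>" "bval more_jobs \<sigma>" for d \<sigma>
    using body_small_correct[OF assms(1,2), of used own \<sigma>] more[of \<sigma>] that by simp
  have "?Inv (njobs I) \<sigma>" using assms by simp
  from exec_while[where Inv = ?Inv, OF loop_free_bodies(2) step this]
  obtain k \<tau> where "exec (While more_jobs body_small) \<sigma> k \<tau>"
    "k \<le> 1 + (1 + cost body_small) * njobs I" "inv_small I T used own \<tau>" "\<not> bval more_jobs \<tau>"
    by blast
  moreover have "ivar \<tau> 4 \<le> njobs I" using \<open>inv_small I T used own \<tau>\<close> by (simp add: inv_small_def)
  ultimately show ?thesis using more[of \<tau>] by (metis le_neq_implies_less)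
qed

text \<open>Both conditions of the second case enter here: the bound on \<open>m_total\<close> puts
  all opened machines in range, and the bound on \<open>L_nonp\<close> provides the initial load
  budget.\<close>

lemma rest_state_start:
  assumes valid: "valid_inst I" and T: "T \<ge> T_min I"
    and inv: "inv_small I T used own \<sigma>" "ivar \<sigma> 4 = njobs I"
    and card: "\<And>i. i < nclasses I \<Longrightarrow> int (card (owned used own i)) \<le> m_cls I T i"
    and L: "L_nonp I T \<le> real (machines I) * T" and m: "m_total I T \<le> int (machines I)"
  shows "\<exists>D tp. rest_state I T used D tp (run init_rest \<sigma>)"
proof -
  let ?\<tau> = "run init_rest \<sigma>" and ?m = "machines I"
  obtain D where used: "ivar \<sigma> 7 = used" and D: "big I T \<subseteq> D" "D \<subseteq> big I T \<union> {..<njobs I}"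
    and ol: "open_lists I T D own \<sigma>" and lds: "loads I T D used own (varr \<sigma> 4)"
    and lk: "linked (nclasses I) (left_over I D (njobs I)) (iarr \<sigma> 7) (iarr \<sigma> 6)"
    and full: "\<And>i u. i < nclasses I \<Longrightarrow> left_over I D (njobs I) i \<noteq> {} \<Longrightarrow>
      u \<in> owned used own i \<Longrightarrow> T \<le> varr \<sigma> 4 u"
    using inv unfolding inv_small_def by auto
  have lo: "left_over I D (njobs I) i = class_jobs I i - D" for i
    by (auto simp: left_over_def class_jobs_def)
  have m1: "0 < ?m" and "cls I 0 < nclasses I" using valid by (auto simp: valid_inst_def)
  then have c: "0 < nclasses I" by linarith
  have um: "used \<le> ?m" using used_le_machines[OF card m] lds by (auto simp: loads_def)
  have inp: "inputs I T \<sigma>" using ol by (simp add: open_lists_def)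
  have T0: "0 < T" using stime_less_T[OF valid T c] by linarith
  have \<tau>: "ivar ?\<tau> = (ivar \<sigma>)(5 := 0, 6 := 0)" "iarr ?\<tau> = iarr \<sigma>" "varr ?\<tau> = varr \<sigma>"
    "vvar ?\<tau> = (vvar \<sigma>)(1 := varr \<sigma> 4 0, 2 := real (stime I 0))"
    using inp c by (simp_all add: init_rest_def inputs_def)
  have "partial_schedule I ?m D (output_schedule \<sigma>) (varr \<sigma> 4) (tops used own)"
    using ol um used by (auto simp: open_lists_def intro: partial_schedule_mono)
  moreover have "output_schedule ?\<tau> = output_schedule \<sigma>"
    by (rule output_schedule_cong) (simp_all add: \<tau>)
  moreover have "inputs I T ?\<tau>" using inp by (rule inputs_cong) (simp_all add: \<tau>)
  moreover have "D \<subseteq> {..<njobs I}" using D(2) by (auto simp: big_def)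
  moreover have "linked (nclasses I) (\<lambda>l. class_jobs I l - D) (iarr \<sigma> 7) (iarr \<sigma> 6)"
    using lk by (rule linked_cong) (simp add: lo)
  moreover have "varr \<sigma> 4 v \<le> 3 / 2 * T" for v
    using lds T0 by (cases "v < used") (auto simp: loads_def)
  moreover have "varr \<sigma> 4 v = 0" if "used \<le> v" for v using lds that by (simp add: loads_def)
  moreover have "(\<Sum>v<?m. varr \<sigma> 4 v) + pending I D 0 (real (stime I 0)) \<le> real ?m * T"
  proof -
    have "(\<Sum>v<?m. varr \<sigma> 4 v) + pending I D 0 (real (stime I 0)) \<le> L_nonp I T"
      by (rule total_load_le_L_nonp[OF valid um lds card]) (use full lo in auto)
    then show ?thesis using L by linarith
  qed
  \<comment> \<open>Machine 0 is split off because its load is held by the counter.\<close>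
  then have "varr \<sigma> 4 0 + (\<Sum>v\<in>{0<..<?m}. varr \<sigma> 4 v) + pending I D 0 (real (stime I 0)) \<le> real ?m * T"
    using m1 by (simp add: lessThan_atLeast0 sum.atLeast_Suc_lessThan atLeastSucLessThan_greaterThanLessThan)
  ultimately show ?thesis
    using D(1) m1 T0 unfolding rest_state_def Let_def
    by (intro exI[of _ D] exI[of _ "tops used own"]) (simp add: \<tau>)
qed

lemma exec_rest:
  assumes "valid_inst I" "T \<ge> T_min I" "rest_state I T used D tp \<sigma>"
    and used: "used \<le> njobs I" and c: "nclasses I \<le> njobs I"
  shows "\<exists>k \<tau>. exec (While more_classes body_rest) \<sigma> k \<tau>
    \<and> k \<le> 1 + (1 + cost body_rest) * (3 * njobs I)
    \<and> feasible I (output_schedule \<tau>) \<and> makespan I (output_schedule \<tau>) \<le> 3 / 2 * T"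
proof -
  let ?\<mu> = "\<lambda>D \<sigma>. (nclasses I - ivar \<sigma> 5) + (njobs I - card D) + (used - ivar \<sigma> 6)"
  let ?Inv = "\<lambda>d \<sigma>. \<exists>D tp. rest_state I T used D tp \<sigma> \<and> d = ?\<mu> D \<sigma>"
  have step: "\<exists>d'<d. ?Inv d' (run body_rest \<sigma>)" if Inv: "?Inv d \<sigma>" and more: "bval more_classes \<sigma>" for d \<sigma>
  proof -
    obtain D tp where "rest_state I T used D tp \<sigma>" "d = ?\<mu> D \<sigma>" using Inv by blast
    with body_rest_correct[OF assms(1,2) this(1) more] show ?thesis by blast
  qed
  have "?Inv (?\<mu> D \<sigma>) \<sigma>" using assms(3) by blast
  from exec_while[where Inv = ?Inv, OF loop_free_bodies(3) step this]
  obtain k \<tau> D' tp' where e: "exec (While more_classes body_rest) \<sigma> k \<tau>"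
    "k \<le> 1 + (1 + cost body_rest) * ?\<mu> D \<sigma>" "rest_state I T used D' tp' \<tau>" "\<not> bval more_classes \<tau>"
    by blast
  \<comment> \<open>Classes, unplaced jobs and opened machines number at most \<open>njobs I\<close>
    each.\<close>
  have "?\<mu> D \<sigma> \<le> 3 * njobs I" using used c by simp
  then have "(1 + cost body_rest) * ?\<mu> D \<sigma> \<le> (1 + cost body_rest) * (3 * njobs I)"
    by (rule mult_le_mono2)
  then have k: "k \<le> 1 + (1 + cost body_rest) * (3 * njobs I)" using e(2) by linarith
  have ps: "partial_schedule I (machines I) D' (output_schedule \<tau>) (varr \<tau> 4) tp'"
    and ld: "\<And>v. varr \<tau> 4 v \<le> 3 / 2 * T" and D': "D' \<subseteq> {..<njobs I}"
    and cov: "\<And>l. l < ivar \<tau> 5 \<Longrightarrow> class_jobs I l \<subseteq> D'" and inp: "inputs I T \<tau>"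
    using e(3) unfolding rest_state_def Let_def by blast+
  have "nclasses I \<le> ivar \<tau> 5" using e(4) inp by (simp add: more_classes_def inputs_def)
  then have "j \<in> D'" if "j < njobs I" for j
  proof -
    have "cls I j < nclasses I" using that assms(1) by (simp add: valid_inst_def)
    then have "class_jobs I (cls I j) \<subseteq> D'" using cov \<open>nclasses I \<le> ivar \<tau> 5\<close> by simp
    then show ?thesis using that by (auto simp: class_jobs_def)
  qed
  then have "D' = {..<njobs I}" using D' by auto
  then have "feasible I (output_schedule \<tau>)" "makespan I (output_schedule \<tau>) \<le> 3 / 2 * T"
    using partial_schedule_feasible partial_schedule_makespan_le[OF _ _ ld] ps assms(1)
    by (auto simp: valid_inst_def)
  then show ?thesis using e(1) k by blast
qed

lemma nclasses_le_njobs: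
  assumes "valid_inst I"
  shows "nclasses I \<le> njobs I"
proof -
  have "{..<nclasses I} \<subseteq> cls I ` {..<njobs I}" using assms by (force simp: valid_inst_def)
  then have "card {..<nclasses I} \<le> card {..<njobs I}" by (rule surj_card_le[rotated]) simp
  then show ?thesis by simp
qed

lemma schedule_program_correct:
  assumes valid: "valid_inst I" and T: "T \<ge> T_min I"
    and L: "L_nonp I T \<le> real (machines I) * T" and m: "m_total I T \<le> int (machines I)"
  shows "\<exists>k \<tau>. exec schedule_program (input_state I T) k \<tau>
    \<and> k \<le> (13 + cost body_big + cost body_small + 3 * cost body_rest) * njobs I
    \<and> feasible I (output_schedule \<tau>) \<and> makespan I (output_schedule \<tau>) \<le> 3 / 2 * T"
proof -
  let ?n = "njobs I"
  obtain k1 \<sigma>1 where 1: "exec (While more_jobs body_big) (input_state I T) k1 \<sigma>1"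
    "k1 \<le> 1 + (1 + cost body_big) * ?n" "inv_big I T \<sigma>1" "ivar \<sigma>1 4 = ?n"
    using exec_big[OF valid T] by blast
  define \<sigma>2 where "\<sigma>2 = run (IAssign 4 (IConst 0)) \<sigma>1"
  obtain used own where used: "used \<le> ?n" "\<And>i. i < nclasses I \<Longrightarrow> int (card (owned used own i)) \<le> m_cls I T i"
    and 2: "inv_small I T used own \<sigma>2" "ivar \<sigma>2 4 = 0"
    using inv_small_start[OF valid T 1(3,4)] unfolding \<sigma>2_def by blast
  obtain k3 \<sigma>3 where 3: "exec (While more_jobs body_small) \<sigma>2 k3 \<sigma>3"
    "k3 \<le> 1 + (1 + cost body_small) * ?n" "inv_small I T used own \<sigma>3" "ivar \<sigma>3 4 = ?n"
    using exec_small[OF valid T 2] by blast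
  obtain D tp where 4: "rest_state I T used D tp (run init_rest \<sigma>3)"
    using rest_state_start[OF valid T 3(3,4) used(2) L m] by blast
  obtain k5 \<tau> where 5: "exec (While more_classes body_rest) (run init_rest \<sigma>3) k5 \<tau>"
    "k5 \<le> 1 + (1 + cost body_rest) * (3 * ?n)"
    "feasible I (output_schedule \<tau>)" "makespan I (output_schedule \<tau>) \<le> 3 / 2 * T"
    using exec_rest[OF valid T 4 used(1) nclasses_le_njobs[OF valid]] by blast
  obtain k2 where e2: "exec (IAssign 4 (IConst 0)) \<sigma>1 k2 \<sigma>2" "k2 \<le> 1"
    using exec_run[of "IAssign 4 (IConst 0)" \<sigma>1] unfolding \<sigma>2_def by auto
  have "loop_free init_rest" "cost init_rest = 4" by (simp_all add: init_rest_def)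
  then obtain k4 where e4: "exec init_rest \<sigma>3 k4 (run init_rest \<sigma>3)" "k4 \<le> 4"
    using exec_run[of init_rest \<sigma>3] by auto
  have "exec schedule_program (input_state I T) (k1 + (k2 + (k3 + (k4 + k5)))) \<tau>"
    unfolding schedule_program_def
    by (rule exec.Seq[OF 1(1) exec.Seq[OF e2(1) exec.Seq[OF 3(1) exec.Seq[OF e4(1) 5(1)]]]])
  moreover have "k1 + (k2 + (k3 + (k4 + k5)))
      \<le> (13 + cost body_big + cost body_small + 3 * cost body_rest) * ?n"
  proof -
    have n: "1 \<le> ?n" using valid by (simp add: valid_inst_def)
    \<comment> \<open>The constant 8 consists of the three final loop tests, one assignment and the
      four commands of \<open>init_rest\<close>; the 5 counts the tests of 1 + 1 + 3 times
      \<open>njobs I\<close> rounds. As there is at least one job, 8 + 5 gives the 13.\<close>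
    have "k1 + (k2 + (k3 + (k4 + k5))) \<le> 8 + (5 + cost body_big + cost body_small + 3 * cost body_rest) * ?n"
      using 1(2) e2(2) 3(2) e4(2) 5(2) by (simp add: algebra_simps)
    also have "\<dots> \<le> 8 * ?n + (5 + cost body_big + cost body_small + 3 * cost body_rest) * ?n"
      using n by simp
    finally show ?thesis by (simp add: algebra_simps)
  qed
  ultimately show ?thesis using 5(3,4) by blast
qed

theorem theoremD5:
  shows
    "(\<forall>I (T::real). valid_inst I \<and> T \<ge> T_min I \<longrightarrow>
        (real (machines I) * T < L_nonp I T \<or> int (machines I) < m_total I T) \<longrightarrow>
        T < OPT_nonp I)
   \<and> (\<exists>p C. \<forall>I (T::real). valid_inst I \<and> T \<ge> T_min I \<longrightarrow>
        \<not> (real (machines I) * T < L_nonp I T \<or> int (machines I) < m_total I T) \<longrightarrow>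
        (\<exists>k \<tau>. exec p (input_state I T) k \<tau> \<and> k \<le> C * njobs I \<and>
           feasible I (output_schedule \<tau>) \<and>
           makespan I (output_schedule \<tau>) \<le> 3 / 2 * T))"
  using lower_bound schedule_program_correct by (meson not_less)

end
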